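(* Let $\mu_0\in(0,1)$, let $(X_n)_{n=1}^\infty$ be $[0,1]$-valued random variables, and consider $\mathcal P^{=}=\{P:\mathbb E_P[X_1]=\mu_0\}$ and $\mathcal Q^{\ne}=\{Q:\mathbb E_Q[X_1]\ne\mu_0\}$. Write $\Gamma=[-1/(1-\mu_0),1/\mu_0]$. Let $(\gamma_n)_{n=1}^\infty$ be a $\Gamma$-valued predictable sequence, let $$W_n^{=}:=\prod_{i=1}^n\left(1+\gamma_i(X_i-\mu_0)\right),$$ and suppose that $(\gamma_n)$ is chosen such that $W_n^=$ has sublinear portfolio regret, i.e. there is a deterministic sequence $r_n=o(n)$ with $$\max_{\gamma\in\Gamma}\sum_{i=1}^n\log(1+\gamma(X_i-\mu_0))-\log(W_n^=)\le r_n\quad\text{for all }n.$$ Then for any $Q\in\mathcal Q^{\ne}$, $$\lim_{n\to\infty}\frac1n\log(W_n^=)=\max_{\gamma\in\Gamma}\mathbb E_Q[\log(1+\gamma(X_1-\mu_0))]\quad Q\text{-almost surely,}$$ and for any $\mathcal P^=$-$e$-process $(W_n')$, $$\limsup_{n\to\infty}\frac1n\log(W_n')\le\max_{\gamma\in\Gamma}\mathbb E_Q[\log(1+\gamma(X_1-\mu_0))]\quad Q\text{-almost surely.}$$ Furthermore, letting $\gamma_Q^\star$ be a maximizer of $\mathbb E_Q[\log(1+\gamma(X_1-\mu_0))]$ over $\gamma\in\Gamma$ and $\tau_\alpha:=\inf\{n\in\mathbb N:W_n^=\ge1/\alpha\}$, $$\lim_{\alpha\to0^+}\frac{\mathbb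 E_Q[\tau_\alpha]}{\log(1/\alpha)}=\frac1{\mathbb E_Q[\log(1+\gamma_Q^\star(X_1-\mu_0))]},$$ and this is unimprovable over the class of all $\mathcal P^=$-$e$-processes: for any $\mathcal P^=$-$e$-process $(W_n')$ and $\alpha\in(0,1)$, the time $\tau_\alpha':=\inf\{n\in\mathbb N:W_n'\ge1/\alpha\}$ satisfies $$\frac{\mathbb E_Q[\tau_\alpha']}{\log(1/\alpha)}\ge\frac1{\mathbb E_Q[\log(1+\gamma_Q^\star(X_1-\mu_0))]}.$$
   Context: Under every distribution considered (in $\mathcal P^=$ or $\mathcal Q^{\ne}$), $(X_n)$ is i.i.d. with values in $[0,1]$; $\mathcal P^=$ and $\mathcal Q^{\ne}$ consist of all such distributions with the stated mean constraint. $\mathcal F_n=\sigma(X_1,\dots,X_n)$, $\mathcal F_0$ trivial; $(\gamma_n)$ predictable means $\gamma_n$ is $\mathcal F_{n-1}$-measurable. A test $P$-supermartingale is a nonnegative adapted process $(M_n)$ with $\mathbb E_P[M_n\mid\mathcal F_{n-1}]\le M_{n-1}$ $P$-a.s. for $n\ge2$ and $\mathbb E_P[M_1]\le1$. A $\mathcal P^=$-$e$-process is a nonnegative adapted process $(W_n')$ such that for each $P\in\mathcal P^=$ there is a test $P$-supermartingale $(M_n^{(P)})$ with $W_n'\le M_n^{(P)}$ for all $n$, $P$-a.s. Conventions: $\inf\emptyset=\infty$, $\log0=-\infty$. *)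

theory Defs
  imports "HOL-Probability.Probability"
begin

text \<open>
  A sample space \<^term>\<open>M\<close> enters only through its carrier and sigma-algebra. The last clause says
  that every i.i.d. law on \<open>[0,1]\<close> is realised by some probability on it, so that classes such as
  \<open>mean_eq\<close> below really consist of all such distributions (on a sample space that is too poor,
  being an e-process would be a vacuous requirement). The coordinate sequence on the product space
  is the standard example, see \<open>full_sequence_model_coordinates\<close>.
  Sequences are indexed from 1; index 0 is not used.
\<close>

definition iid_distributions :: "'a measure \<Rightarrow> (nat \<Rightarrow> 'a \<Rightarrow> real) \<Rightarrow> 'a measure set" where
  "iid_distributions M X = {P. prob_space P \<and> sets P = sets M \<and>
     prob_space.indep_vars P (\<lambda>_. borel) X {1..} \<and>
     (\<forall>n\<ge>1. distr P borel (X n) = distr P borel (X 1))}"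

definition full_sequence_model :: "'a measure \<Rightarrow> (nat \<Rightarrow> 'a \<Rightarrow> real) \<Rightarrow> bool" where
  "full_sequence_model M X \<longleftrightarrow>
     (\<forall>n\<ge>1. X n \<in> borel_measurable M \<and> (\<forall>\<omega>\<in>space M. X n \<omega> \<in> {0..1})) \<and>
     (\<forall>\<nu>. prob_space \<nu> \<and> sets \<nu> = sets borel \<and> (AE x in \<nu>. x \<in> {0..1}) \<longrightarrow>
        (\<exists>P\<in>iid_distributions M X. distr P borel (X 1) = \<nu>))"

definition mean_eq :: "'a measure \<Rightarrow> (nat \<Rightarrow> 'a \<Rightarrow> real) \<Rightarrow> real \<Rightarrow> 'a measure set" where
  "mean_eq M X \<mu>0 = {P \<in> iid_distributions M X. integral\<^sup>L P (X 1) = \<mu>0}"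

definition mean_neq :: "'a measure \<Rightarrow> (nat \<Rightarrow> 'a \<Rightarrow> real) \<Rightarrow> real \<Rightarrow> 'a measure set" where
  "mean_neq M X \<mu>0 = {Q \<in> iid_distributions M X. integral\<^sup>L Q (X 1) \<noteq> \<mu>0}"

definition nat_filtration :: "'a measure \<Rightarrow> (nat \<Rightarrow> 'a \<Rightarrow> real) \<Rightarrow> nat \<Rightarrow> 'a measure" where
  "nat_filtration M X n =
     sigma (space M) {X i -` B \<inter> space M | i B. i \<in> {1..n} \<and> B \<in> sets borel}"

definition predictable :: "'a measure \<Rightarrow> (nat \<Rightarrow> 'a \<Rightarrow> real) \<Rightarrow> (nat \<Rightarrow> 'a \<Rightarrow> real) \<Rightarrow> bool" where
  "predictable M X \<gamma> \<longleftrightarrow> (\<forall>n\<ge>1. \<gamma> n \<in> borel_measurable (nat_filtration M X (n - 1)))"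

definition nonneg_adapted :: "'a measure \<Rightarrow> (nat \<Rightarrow> 'a \<Rightarrow> real) \<Rightarrow> (nat \<Rightarrow> 'a \<Rightarrow> real) \<Rightarrow> bool" where
  "nonneg_adapted M X W \<longleftrightarrow>
     (\<forall>n\<ge>1. W n \<in> borel_measurable (nat_filtration M X n) \<and> (\<forall>\<omega>\<in>space M. 0 \<le> W n \<omega>))"

text \<open>
  Expectations are taken in \<open>[0,\<infinity>]\<close>, since the Bochner versions have junk values for
  non-integrable arguments; integrability is then a consequence.
\<close>

definition test_supermartingale ::
  "'a measure \<Rightarrow> (nat \<Rightarrow> 'a \<Rightarrow> real) \<Rightarrow> 'a measure \<Rightarrow> (nat \<Rightarrow> 'a \<Rightarrow> real) \<Rightarrow> bool" where
  "test_supermartingale M X P W \<longleftrightarrow> nonneg_adapted M X W \<and>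
     (\<integral>\<^sup>+\<omega>. ennreal (W 1 \<omega>) \<partial>P) \<le> 1 \<and>
     (\<forall>n\<ge>2. AE \<omega> in P.
        nn_cond_exp P (nat_filtration M X (n - 1)) (\<lambda>\<omega>'. ennreal (W n \<omega>')) \<omega> \<le> ennreal (W (n - 1) \<omega>))"

definition e_process ::
  "'a measure \<Rightarrow> (nat \<Rightarrow> 'a \<Rightarrow> real) \<Rightarrow> 'a measure set \<Rightarrow> (nat \<Rightarrow> 'a \<Rightarrow> real) \<Rightarrow> bool" where
  "e_process M X \<P> W \<longleftrightarrow> nonneg_adapted M X W \<and>
     (\<forall>P\<in>\<P>. \<exists>S. test_supermartingale M X P S \<and> (AE \<omega> in P. \<forall>n\<ge>1. W n \<omega> \<le> S n \<omega>))"

text \<open>Logarithm with \<open>log 0 = -\<infinity>\<close> (library \<^const>\<open>ln\<close> has \<open>ln 0 = 0\<close>); only used on \<open>[0,\<infinity>)\<close>.\<close>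

definition elog :: "real \<Rightarrow> ereal" where
  "elog x = (if x \<le> 0 then -\<infinity> else ereal (ln x))"

text \<open>
  Expectation of an extended real random variable as positive part minus negative part;
  only used for integrands that are bounded above, so \<open>\<infinity> - \<infinity>\<close> does not occur.
\<close>

definition eexpectation :: "'a measure \<Rightarrow> ('a \<Rightarrow> ereal) \<Rightarrow> ereal" where
  "eexpectation P f =
     enn2ereal (\<integral>\<^sup>+\<omega>. e2ennreal (f \<omega>) \<partial>P) - enn2ereal (\<integral>\<^sup>+\<omega>. e2ennreal (- f \<omega>) \<partial>P)"

definition bet_range :: "real \<Rightarrow> real set" where
  "bet_range \<mu>0 = {- 1 / (1 - \<mu>0) .. 1 / \<mu>0}"

definition wealth :: "(nat \<Rightarrow> 'a \<Rightarrow> real) \<Rightarrow> real \<Rightarrow> (nat \<Rightarrow> 'a \<Rightarrow> real) \<Rightarrow> nat \<Rightarrow> 'a \<Rightarrow> real" where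
  "wealth X \<mu>0 \<gamma> n \<omega> = (\<Prod>i=1..n. 1 + \<gamma> i \<omega> * (X i \<omega> - \<mu>0))"

definition log_growth :: "'a measure \<Rightarrow> (nat \<Rightarrow> 'a \<Rightarrow> real) \<Rightarrow> real \<Rightarrow> real \<Rightarrow> ereal" where
  "log_growth Q X \<mu>0 g = eexpectation Q (\<lambda>\<omega>. elog (1 + g * (X 1 \<omega> - \<mu>0)))"

text \<open>
  The supremum is a maximum: it is over a compact interval and the objective is upper
  semicontinuous. A value \<open>W n \<omega> = 0\<close> gives regret \<open>\<infinity>\<close>.
\<close>

definition portfolio_regret ::
  "(nat \<Rightarrow> 'a \<Rightarrow> real) \<Rightarrow> real \<Rightarrow> (nat \<Rightarrow> 'a \<Rightarrow> real) \<Rightarrow> nat \<Rightarrow> 'a \<Rightarrow> ereal" where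
  "portfolio_regret X \<mu>0 W n \<omega> =
     (SUP g\<in>bet_range \<mu>0. \<Sum>i=1..n. elog (1 + g * (X i \<omega> - \<mu>0))) - elog (W n \<omega>)"

definition sublinear_portfolio_regret ::
  "'a measure \<Rightarrow> (nat \<Rightarrow> 'a \<Rightarrow> real) \<Rightarrow> real \<Rightarrow> (nat \<Rightarrow> 'a \<Rightarrow> real) \<Rightarrow> bool" where
  "sublinear_portfolio_regret M X \<mu>0 W \<longleftrightarrow>
     (\<exists>r :: nat \<Rightarrow> real. r \<in> o(\<lambda>n. real n) \<and>
        (\<forall>n\<ge>1. \<forall>\<omega>\<in>space M. portfolio_regret X \<mu>0 W n \<omega> \<le> ereal (r n)))"

definition crossing_time :: "(nat \<Rightarrow> 'a \<Rightarrow> real) \<Rightarrow> real \<Rightarrow> 'a \<Rightarrow> enat" where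
  "crossing_time W \<alpha> \<omega> = (INF n\<in>{n. 1 \<le> n \<and> W n \<omega> \<ge> 1 / \<alpha>}. enat n)"

definition expected_crossing_time :: "'a measure \<Rightarrow> (nat \<Rightarrow> 'a \<Rightarrow> real) \<Rightarrow> real \<Rightarrow> ereal" where
  "expected_crossing_time Q W \<alpha> = enn2ereal (\<integral>\<^sup>+\<omega>. ennreal_of_enat (crossing_time W \<alpha> \<omega>) \<partial>Q)"

lemma full_sequence_model_coordinates:
  "full_sequence_model (\<Pi>\<^sub>M n\<in>UNIV. restrict_space borel {0..1::real}) (\<lambda>n \<omega>. \<omega> n)"
    (is "full_sequence_model ?M ?X")
proof -
  let ?B = "restrict_space borel {0..1::real}"
  have meas: "?X n \<in> borel_measurable ?M" for n
    by (rule measurable_compose[of _ _ ?B]) (auto intro: measurable_restrict_space1)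
  have val: "\<omega> n \<in> {0..1}" if "\<omega> \<in> space ?M" for \<omega> n
    using that by (auto simp: space_PiM space_restrict_space PiE_iff)
  have ex: "\<exists>P\<in>iid_distributions ?M ?X. distr P borel (?X 1) = \<nu>"
    if \<nu>: "prob_space \<nu>" "sets \<nu> = sets borel" "AE x in \<nu>. x \<in> {0..1}" for \<nu> :: "real measure"
  proof -
    interpret \<nu>: prob_space \<nu> by fact
    have sp\<nu>: "space \<nu> = UNIV" using sets_eq_imp_space_eq[OF \<nu>(2)] by simp
    define f where "f x = (if x \<in> {0..1} then x else (0::real))" for x
    have f_borel: "f \<in> borel_measurable borel"
      unfolding f_def by measurable
    have f: "f \<in> measurable \<nu> ?B"
      unfolding f_def by (intro measurable_restrict_space2) (auto simp: measurable_cong_sets[OF \<nu>(2) refl])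
    define \<nu>' where "\<nu>' = distr \<nu> ?B f"
    interpret \<nu>': prob_space \<nu>' unfolding \<nu>'_def by (rule \<nu>.prob_space_distr[OF f])
    interpret P: product_prob_space "\<lambda>_::nat. \<nu>'" UNIV ..
    let ?P = "\<Pi>\<^sub>M n\<in>(UNIV::nat set). \<nu>'"
    have sets: "sets ?P = sets ?M" by (intro sets_PiM_cong) (auto simp: \<nu>'_def)
    have id: "(\<lambda>x. x) \<in> measurable \<nu>' borel"
      unfolding \<nu>'_def by (auto intro: measurable_restrict_space1)
    have d: "distr ?P borel (?X n) = \<nu>" for n
    proof -
      have "distr ?P borel (?X n) = distr (distr ?P \<nu>' (?X n)) borel (\<lambda>x. x)"
        by (subst distr_distr[OF id]) (auto simp: o_def)
      also have "distr ?P \<nu>' (?X n) = \<nu>'" by (rule P.PiM_component) simp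
      also have "distr \<nu>' borel (\<lambda>x. x) = distr \<nu> borel f"
        unfolding \<nu>'_def by (subst distr_distr[OF _ f]) (auto simp: o_def intro: measurable_restrict_space1)
      also have "\<dots> = distr \<nu> borel (\<lambda>x. x)"
      proof (rule distr_cong_AE)
        show "AE x in \<nu>. f x = x" using \<nu>(3) by eventually_elim (auto simp: f_def)
      qed (use f_borel in \<open>auto simp: measurable_cong_sets[OF \<nu>(2) refl]\<close>)
      also have "\<dots> = \<nu>" using \<nu>(2) by (rule distr_id2[OF sym])
      finally show ?thesis .
    qed
    have "P.indep_vars (\<lambda>_. \<nu>') ?X UNIV"
    proof (subst P.indep_vars_iff_distr_eq_PiM)
      have "distr ?P ?P (\<lambda>x. restrict x UNIV) = ?P" by (simp add: restrict_UNIV)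
      moreover have "distr ?P \<nu>' (?X n) = \<nu>'" for n by (rule P.PiM_component) simp
      ultimately show "distr ?P ?P (\<lambda>x. \<lambda>i\<in>UNIV. x i) = (\<Pi>\<^sub>M i\<in>UNIV. distr ?P \<nu>' (?X i))"
        by (simp add: restrict_UNIV)
    qed auto
    then have "P.indep_vars (\<lambda>_. \<nu>') ?X {1..}" by (rule P.indep_vars_subset) auto
    then have "P.indep_vars (\<lambda>_. borel) (\<lambda>n. (\<lambda>x. x) \<circ> ?X n) {1..}"
      by (rule P.indep_vars_compose) (use id in auto)
    then have "?P \<in> iid_distributions ?M ?X"
      using d sets P.prob_space_axioms by (auto simp: iid_distributions_def o_def)
    with d show ?thesis by blast
  qed
  show ?thesis unfolding full_sequence_model_def using meas val ex by blast
qed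

end

theory Submission
  imports Defs
begin

text \<open>
  Write \<open>E = 1 + g (X - \<mu>0)\<close> for the payoff of an optimal bet \<open>g\<close> and \<open>l > 0\<close> for the maximal expected
  logarithm under \<open>Q\<close>. Optimality of \<open>g\<close> is equivalent to a family of linear inequalities: the payoff
  of any other bet, divided by \<open>E\<close>, has \<open>Q\<close>-expectation at most \<open>1\<close> (\<open>numeraire\<close>). They allow the
  measure with density \<open>1 / E\<close> with respect to the law of \<open>X\<close> to be completed, by atoms at \<open>0\<close> and
  \<open>1\<close>, to a law with mean \<open>\<mu>0\<close> against which the law of \<open>X\<close> has density exactly \<open>E\<close>
  (\<open>least_favourable_law\<close>). Let \<open>P\<close> be the null distribution of an i.i.d. sequence with this law. On
  the first \<open>n\<close> observations \<open>Q\<close> has density \<open>L n\<close>, the product of the optimal payoffs, with respect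
  to \<open>P\<close>. So the supermartingale \<open>S\<close> that dominates an e-process under \<open>P\<close> also dominates it under
  \<open>Q\<close>, and \<open>S / L\<close> is a supermartingale under \<open>Q\<close> that starts at \<open>1\<close>
  (\<open>likelihood_ratio_supermartingale\<close>).

  Both limits on e-processes follow. By Markov's inequality and Borel-Cantelli, \<open>S n\<close> is eventually
  at most \<open>n\<^sup>2 * L n\<close>, and the law of large numbers bounds the limit superior of \<open>ln (L n) / n\<close>
  by \<open>l\<close> (\<open>log_growth_rate_le\<close>). At the time \<open>\<tau>\<close> of crossing \<open>1 / \<alpha>\<close>, Jensen's inequality bounds the expectation
  of \<open>ln (S / L)\<close> by \<open>0\<close>, while Wald's identity evaluates the expectation of \<open>ln L\<close> as \<open>l\<close> times the
  expectation of \<open>\<tau>\<close>, so \<open>ln (1 / \<alpha>)\<close> is at most that product (\<open>summable_crossing_bound\<close>).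

  The betting strategy attains both limits. It is compared with the shrunken bet \<open>s * g\<close> for \<open>s < 1\<close>,
  whose logarithmic payoff is bounded and, by concavity, has expectation at least \<open>s * l\<close>. Up to the
  regret, \<open>ln (W n)\<close> is at least a random walk with this drift. The law of large numbers gives the
  growth rate (\<open>sublinear_regret_growth_rate_ge\<close>), and Wald's identity with a bounded overshoot gives
  the crossing time (\<open>sublinear_regret_crossing_bound\<close>). Since the wealth is itself an e-process
  (\<open>wealth_e_process\<close>), the general limits supply the reverse inequalities.
\<close>

section \<open>Bounded i.i.d. sequences and their natural filtration\<close>

locale unit_iid = prob_space P for P :: "'a measure" +
  fixes M :: "'a measure" and X :: "nat \<Rightarrow> 'a \<Rightarrow> real"
  assumes iid: "P \<in> iid_distributions M X"
    and X_range: "\<And>n \<omega>. 1 \<le> n \<Longrightarrow> \<omega> \<in> space M \<Longrightarrow> X n \<omega> \<in> {0..1}"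
begin

lemma sets_P: "sets P = sets M"
  using iid by (auto simp: iid_distributions_def)

lemma space_P: "space P = space M"
  using sets_P by (rule sets_eq_imp_space_eq)

lemma indep_X: "indep_vars (\<lambda>_. borel) X {1..}"
  using iid by (auto simp: iid_distributions_def)

lemma distr_X: "1 \<le> n \<Longrightarrow> distr P borel (X n) = distr P borel (X 1)"
  using iid unfolding iid_distributions_def by blast

lemma X_measurable: "1 \<le> n \<Longrightarrow> X n \<in> borel_measurable P"
  using indep_X by (auto simp: indep_vars_def)

lemma X_1_measurable [measurable]: "X 1 \<in> borel_measurable P" "X (Suc n) \<in> borel_measurable P"
  by (auto intro: X_measurable)

lemma filtration_generators: "{X i -` B \<inter> space M | i B. i \<in> {1..n} \<and> B \<in> sets borel} \<subseteq> sets P"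
  using X_measurable by (auto simp flip: space_P intro!: measurable_sets)

lemma space_filtration [simp]: "space (nat_filtration M X n) = space M"
  by (simp add: nat_filtration_def space_measure_of_conv)

lemma sets_filtration:
  "sets (nat_filtration M X n) =
     sigma_sets (space M) {X i -` B \<inter> space M | i B. i \<in> {1..n} \<and> B \<in> sets borel}"
  unfolding nat_filtration_def by (intro sets_measure_of) auto

lemma subalgebra_filtration: "subalgebra P (nat_filtration M X n)"
  unfolding subalgebra_def sets_filtration
  using sets.sigma_sets_subset[OF filtration_generators] by (simp add: space_P)

lemma subalgebra_filtration_mono:
  assumes "m \<le> n" shows "subalgebra (nat_filtration M X n) (nat_filtration M X m)"
  unfolding subalgebra_def sets_filtration using assms
  by (auto intro!: sigma_sets_mono' intro: order_trans)

lemma measurable_filtration_P: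
  "f \<in> measurable (nat_filtration M X n) N \<Longrightarrow> f \<in> measurable P N"
  by (rule measurable_from_subalg[OF subalgebra_filtration])

lemma measurable_filtration_mono:
  "f \<in> measurable (nat_filtration M X m) N \<Longrightarrow> m \<le> n \<Longrightarrow> f \<in> measurable (nat_filtration M X n) N"
  by (rule measurable_from_subalg[OF subalgebra_filtration_mono])

lemma sets_filtration_P: "A \<in> sets (nat_filtration M X n) \<Longrightarrow> A \<in> sets P"
  using subalgebra_filtration by (auto simp: subalgebra_def)

lemma sets_filtration_mono:
  "A \<in> sets (nat_filtration M X m) \<Longrightarrow> m \<le> n \<Longrightarrow> A \<in> sets (nat_filtration M X n)"
  using subalgebra_filtration_mono by (auto simp: subalgebra_def)

lemma X_adapted:
  assumes "1 \<le> i" "i \<le> n" shows "X i \<in> borel_measurable (nat_filtration M X n)"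
proof (rule measurableI)
  fix B :: "real set" assume "B \<in> sets borel"
  then show "X i -` B \<inter> space (nat_filtration M X n) \<in> sets (nat_filtration M X n)"
    unfolding sets_filtration using assms by (auto intro!: sigma_sets.Basic)
qed simp

lemma integral_X:
  fixes f :: "real \<Rightarrow> real"
  assumes "1 \<le> n" "f \<in> borel_measurable borel"
  shows "(\<integral>\<omega>. f (X n \<omega>) \<partial>P) = (\<integral>\<omega>. f (X 1 \<omega>) \<partial>P)"
  using distr_X[OF assms(1)] integral_distr[OF X_measurable[OF assms(1)] assms(2)]
    integral_distr[OF X_1_measurable(1) assms(2)] by simp

lemma nn_integral_X:
  fixes f :: "real \<Rightarrow> ennreal"
  assumes "1 \<le> n" "f \<in> borel_measurable borel"
  shows "(\<integral>\<^sup>+\<omega>. f (X n \<omega>) \<partial>P) = (\<integral>\<^sup>+\<omega>. f (X 1 \<omega>) \<partial>P)"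
  using distr_X[OF assms(1)] nn_integral_distr[OF X_measurable[OF assms(1)], of f]
    nn_integral_distr[OF X_1_measurable(1), of f] assms(2) by simp

lemma integrable_X:
  fixes f :: "real \<Rightarrow> real"
  assumes "1 \<le> n" "f \<in> borel_measurable borel" "integrable P (\<lambda>\<omega>. f (X 1 \<omega>))"
  shows "integrable P (\<lambda>\<omega>. f (X n \<omega>))"
  using distr_X[OF assms(1)] integrable_distr_eq[OF X_measurable[OF assms(1)] assms(2)]
    integrable_distr_eq[OF X_1_measurable(1) assms(2)] assms(3) by simp

lemma AE_X:
  assumes "1 \<le> n" "{x. R x} \<in> sets borel" "AE \<omega> in P. R (X 1 \<omega>)"
  shows "AE \<omega> in P. R (X n \<omega>)"
proof -
  have S: "{x \<in> space borel. R x} \<in> sets borel" using assms(2) by simp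
  have "AE x in distr P borel (X n). R x"
    using assms(3) unfolding distr_X[OF assms(1)] AE_distr_iff[OF X_1_measurable(1) S] .
  then show ?thesis unfolding AE_distr_iff[OF X_measurable[OF assms(1)] S] .
qed

text \<open>
  The generators of the past and of the next observation are indexed by disjoint sets, so the
  generated sigma-algebras inherit independence.
\<close>

lemma indep_set_filtration_next:
  "indep_set (sets (nat_filtration M X n))
     (sigma_sets (space P) {X (Suc n) -` B \<inter> space P | B. B \<in> sets borel})"
proof -
  let ?E = "\<lambda>i. {X i -` B \<inter> space P | B. B \<in> sets borel}"
  let ?I = "case_bool {1..n} {Suc n}"
  have "indep_sets (\<lambda>j. sigma_sets (space P) (\<Union>i\<in>?I j. ?E i)) UNIV"
  proof (rule indep_sets_collect_sigma)
    have "indep_sets ?E {1..}"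
      using indep_X unfolding indep_vars_def2 by auto
    then show "indep_sets ?E (\<Union>j\<in>UNIV. ?I j)"
      by (rule indep_sets_mono_index[rotated]) (auto split: bool.splits)
    show "Int_stable (?E i)" for i
    proof (rule Int_stableI)
      fix a b assume "a \<in> ?E i" "b \<in> ?E i"
      then obtain A B where "A \<in> sets borel" "B \<in> sets borel"
        "a = X i -` A \<inter> space P" "b = X i -` B \<inter> space P" by auto
      then show "a \<inter> b \<in> ?E i" by (auto intro!: exI[of _ "A \<inter> B"])
    qed
    show "disjoint_family_on ?I UNIV"
      by (auto simp: disjoint_family_on_def split: bool.splits)
  qed
  moreover have "(\<lambda>j. sigma_sets (space P) (\<Union>i\<in>?I j. ?E i)) =
      case_bool (sigma_sets (space P) (\<Union>i\<in>{1..n}. ?E i)) (sigma_sets (space P) (?E (Suc n)))"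
    by (auto simp: fun_eq_iff split: bool.splits)
  moreover have "(\<Union>i\<in>{1..n}. ?E i) = {X i -` B \<inter> space P | i B. i \<in> {1..n} \<and> B \<in> sets borel}"
    by blast
  ultimately show ?thesis
    unfolding indep_set_def sets_filtration by (simp only: space_P)
qed

lemma indep_filtration_next:
  fixes f :: "real \<Rightarrow> real"
  assumes Z: "Z \<in> measurable (nat_filtration M X n) N" and f: "f \<in> borel_measurable borel"
  shows "indep_var N Z borel (\<lambda>\<omega>. f (X (Suc n) \<omega>))"
proof -
  have i: "indep_var N Z borel (X (Suc n))"
    unfolding indep_var_eq indep_sets2_eq
  proof (intro conjI ballI)
    show "random_variable N Z" using Z by (rule measurable_filtration_P)
    show X: "random_variable borel (X (Suc n))" by simp
    let ?S = "sigma_sets (space P) {Z -` A \<inter> space P |A. A \<in> sets N}"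
    have S: "?S \<subseteq> sets (nat_filtration M X n)"
    proof -
      have "{Z -` A \<inter> space P |A. A \<in> sets N} \<subseteq> sets (nat_filtration M X n)"
        using measurable_sets[OF Z] by (auto simp: space_P)
      then show ?thesis
        using sets.sigma_sets_subset[of _ "nat_filtration M X n"] by (simp add: space_P)
    qed
    also have "\<dots> \<subseteq> events" using sets_filtration_P by auto
    finally show "?S \<subseteq> events" .
    show "sigma_sets (space P) {X (Suc n) -` A \<inter> space P |A. A \<in> sets borel} \<subseteq> events"
      using X by (intro sets.sigma_sets_subset) auto
    fix a b assume "a \<in> ?S" "b \<in> sigma_sets (space P) {X (Suc n) -` A \<inter> space P |A. A \<in> sets borel}"
    then show "prob (a \<inter> b) = prob a * prob b"
      using S indep_setD[OF indep_set_filtration_next[of n]] by auto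
  qed
  show ?thesis
    using indep_var_compose[OF i measurable_ident[of N] f] by (simp add: comp_def)
qed

text \<open>
  The form in which independence enters all later arguments: a quantity known at time \<open>n\<close>
  decouples from the next observation, which may then be replaced by the first one.
\<close>

lemma integral_mult_next:
  fixes f :: "real \<Rightarrow> real"
  assumes Z: "Z \<in> borel_measurable (nat_filtration M X n)" "integrable P Z"
    and f: "f \<in> borel_measurable borel" "integrable P (\<lambda>\<omega>. f (X 1 \<omega>))"
  shows "(\<integral>\<omega>. Z \<omega> * f (X (Suc n) \<omega>) \<partial>P) = (\<integral>\<omega>. Z \<omega> \<partial>P) * (\<integral>\<omega>. f (X 1 \<omega>) \<partial>P)"
    and "integrable P (\<lambda>\<omega>. Z \<omega> * f (X (Suc n) \<omega>))"
  using indep_var_lebesgue_integral[OF indep_filtration_next[OF Z(1) f(1)] Z(2)]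
    indep_var_integrable[OF indep_filtration_next[OF Z(1) f(1)] Z(2)]
    integrable_X[OF _ f, of "Suc n"] integral_X[OF _ f(1), of "Suc n"] by auto

text \<open>
  Hoeffding's inequality makes the probabilities of a fixed deviation from the mean decay
  geometrically in \<open>n\<close>, hence summable, and the first Borel-Cantelli lemma applies to each of
  countably many deviations.
\<close>

lemma bounded_strong_law:
  fixes f :: "real \<Rightarrow> real"
  assumes f: "f \<in> borel_measurable borel" and B: "\<And>x. x \<in> {0..1} \<Longrightarrow> \<bar>f x\<bar> \<le> B"
  shows "AE \<omega> in P. (\<lambda>n. (\<Sum>i=1..n. f (X i \<omega>)) / real n) \<longlonglongrightarrow> (\<integral>\<omega>. f (X 1 \<omega>) \<partial>P)"
proof -
  define m where "m = (\<integral>\<omega>. f (X 1 \<omega>) \<partial>P)"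
  define a where "a n \<omega> = (\<Sum>i=1..n. f (X i \<omega>)) / real n" for n \<omega>
  define D where "D \<epsilon> n = {\<omega> \<in> space P. \<epsilon> \<le> \<bar>a n \<omega> - m\<bar>}" for \<epsilon> n
  have [measurable]: "a n \<in> borel_measurable P" for n
    unfolding a_def using f X_measurable by (auto intro!: borel_measurable_sum measurable_compose[of _ _ _ f])
  have D_sets: "D \<epsilon> n \<in> sets P" for \<epsilon> n unfolding D_def by measurable
  define c where "c \<epsilon> = exp (- 2 * \<epsilon>\<^sup>2 / (2 * \<bar>B\<bar> + 2)\<^sup>2)" for \<epsilon> :: real
  have tail: "prob (D \<epsilon> n) \<le> 2 * c \<epsilon> ^ n" if n: "1 \<le> n" and \<epsilon>: "0 < \<epsilon>" for n \<epsilon>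
  proof -
    \<comment> \<open>The interval is widened by 1 on both sides to make it nondegenerate even if \<open>f\<close> vanishes.\<close>
    interpret H: Hoeffding_ineq_iid P "{1..n}" "\<lambda>i \<omega>. f (X i \<omega>)" "\<lambda>\<omega>. f (X 1 \<omega>)"
      "- \<bar>B\<bar> - 1" "\<bar>B\<bar> + 1" m
    proof unfold_locales
      show "indep_vars (\<lambda>_. borel) (\<lambda>i \<omega>. f (X i \<omega>)) {1..n}"
        by (rule indep_vars_compose2[OF indep_vars_subset[OF indep_X]]) (use f in auto)
      show "distr P borel (\<lambda>\<omega>. f (X i \<omega>)) = distr P borel (\<lambda>\<omega>. f (X 1 \<omega>))" if "i \<in> {1..n}" for i
        using that distr_X[of i] f X_measurable[of i] distr_distr[of f borel borel "X i" P]
          distr_distr[of f borel borel "X 1" P] by (simp add: comp_def)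
      show "random_variable borel (\<lambda>\<omega>. f (X 1 \<omega>))" using f by simp
      show "AE \<omega> in P. f (X 1 \<omega>) \<in> {- \<bar>B\<bar> - 1..\<bar>B\<bar> + 1}"
      proof (rule AE_I2)
        fix \<omega> assume "\<omega> \<in> space P"
        then have "\<bar>f (X 1 \<omega>)\<bar> \<le> B" using B X_range[of 1 \<omega>] by (simp add: space_P)
        then show "f (X 1 \<omega>) \<in> {- \<bar>B\<bar> - 1..\<bar>B\<bar> + 1}" by auto
      qed
    qed (auto simp: m_def)
    have "prob (D \<epsilon> n) \<le> 2 * exp (- 2 * real n * \<epsilon>\<^sup>2 / (2 * \<bar>B\<bar> + 2)\<^sup>2)"
      using H.Hoeffding_ineq_abs_ge'[of \<epsilon>] n \<epsilon> unfolding D_def a_def by simp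
    also have "exp (- 2 * real n * \<epsilon>\<^sup>2 / (2 * \<bar>B\<bar> + 2)\<^sup>2) = c \<epsilon> ^ n"
      unfolding c_def by (simp flip: exp_of_nat_mult)
    finally show ?thesis .
  qed
  have "AE \<omega> in P. eventually (\<lambda>n. \<omega> \<in> space P - D (1 / real (Suc k)) n) sequentially" for k
  proof (rule borel_cantelli_AE1)
    let ?\<epsilon> = "1 / real (Suc k)"
    have "c ?\<epsilon> < 1" unfolding c_def by (auto simp: divide_simps add_pos_nonneg)
    then have "summable (\<lambda>n. 2 * c ?\<epsilon> ^ n)"
      by (intro summable_mult summable_geometric) (simp add: c_def)
    then show "summable (\<lambda>n. prob (D ?\<epsilon> n))"
      by (rule summable_comparison_test'[where N = 1]) (use tail in auto)
  qed (use D_sets in \<open>auto simp: emeasure_eq_measure\<close>)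
  then have "AE \<omega> in P. \<forall>k. eventually (\<lambda>n. \<omega> \<in> space P - D (1 / real (Suc k)) n) sequentially"
    by (simp add: AE_all_countable)
  then show ?thesis
  proof eventually_elim
    case (elim \<omega>)
    have "(\<lambda>n. a n \<omega>) \<longlonglongrightarrow> m"
    proof (rule tendstoI)
      fix e :: real assume "0 < e"
      then obtain k where k: "inverse (real (Suc k)) < e" using reals_Archimedean by blast
      show "\<forall>\<^sub>F n in sequentially. dist (a n \<omega>) m < e"
        using elim[rule_format, of k]
        by eventually_elim (use k in \<open>auto simp: D_def dist_real_def inverse_eq_divide\<close>)
    qed
    then show ?case by (simp add: a_def m_def)
  qed
qed

end

text \<open>
  If one observation under \<open>Q\<close> has density \<open>e\<close> with respect to \<open>P\<close>, then \<open>n\<close> of them have the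
  product density. Both sides define finite measures on the observed past, and independence makes
  them agree on cylinders, an intersection-stable generator. On the whole sample space
  \<open>Q\<close> and \<open>P\<close> are in general mutually singular, hence the restriction to \<open>n\<close> observations.
\<close>

lemma change_of_measure:
  fixes e :: "real \<Rightarrow> ennreal"
  assumes "unit_iid P M X" "unit_iid Q M X"
    and e: "e \<in> borel_measurable borel"
    and law: "distr Q borel (X 1) = density (distr P borel (X 1)) e"
    and Z: "Z \<in> borel_measurable (nat_filtration M X n)"
  shows "(\<integral>\<^sup>+\<omega>. Z \<omega> \<partial>Q) = (\<integral>\<^sup>+\<omega>. (\<Prod>i=1..n. e (X i \<omega>)) * Z \<omega> \<partial>P)"
proof -
  interpret P: unit_iid P M X by fact
  interpret Q: unit_iid Q M X by fact
  let ?F = "nat_filtration M X n"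
  define L where "L \<omega> = (\<Prod>i=1..n. e (X i \<omega>))" for \<omega>
  have L: "L \<in> borel_measurable ?F"
    unfolding L_def using P.X_adapted e by (auto intro!: borel_measurable_prod measurable_compose[of _ _ _ e])
  define cyl where "cyl B = {\<omega> \<in> space M. \<forall>i\<in>{1..n}. X i \<omega> \<in> B i}" for B :: "nat \<Rightarrow> real set"
  let ?G = "{cyl B | B. \<forall>i. B i \<in> sets borel}"
  have cyl_sets: "cyl B \<in> sets ?F" if "\<forall>i. B i \<in> sets borel" for B
  proof -
    have "cyl B = {\<omega> \<in> space ?F. \<forall>i\<in>{1..n}. X i \<omega> \<in> B i}" by (simp add: cyl_def)
    also have "\<dots> \<in> sets ?F"
    proof (rule sets.sets_Collect_finite_All)
      fix i assume "i \<in> {1..n}"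
      then have "X i -` B i \<inter> space ?F \<in> sets ?F"
        using that P.X_adapted[of i n] by (intro measurable_sets) auto
      also have "X i -` B i \<inter> space ?F = {x \<in> space ?F. X i x \<in> B i}" by auto
      finally show "{x \<in> space ?F. X i x \<in> B i} \<in> sets ?F" .
    qed simp
    finally show ?thesis .
  qed
  have gen: "sets ?F = sigma_sets (space M) ?G"
  proof
    show "sets ?F \<subseteq> sigma_sets (space M) ?G"
      unfolding P.sets_filtration
    proof (rule sigma_sets_mono', safe)
      fix i B assume *: "i \<in> {1..n}" "B \<in> sets (borel :: real measure)"
      then have "X i -` B \<inter> space M = cyl (\<lambda>j. if j = i then B else UNIV)"
        by (auto simp: cyl_def)
      then show "\<exists>B'. X i -` B \<inter> space M = cyl B' \<and> (\<forall>i. B' i \<in> sets borel)" using * by auto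
    qed
    show "sigma_sets (space M) ?G \<subseteq> sets ?F"
      using sets.sigma_sets_subset[of ?G ?F] cyl_sets by auto
  qed
  have stab: "Int_stable ?G"
  proof (rule Int_stableI)
    fix a b assume "a \<in> ?G" "b \<in> ?G"
    then obtain A B where "\<forall>i. A i \<in> sets borel" "\<forall>i. B i \<in> sets borel" "a = cyl A" "b = cyl B" by auto
    moreover have "cyl A \<inter> cyl B = cyl (\<lambda>i. A i \<inter> B i)" by (auto simp: cyl_def)
    ultimately show "a \<inter> b \<in> ?G" by blast
  qed
  have cylQ: "emeasure Q (cyl B) = (\<integral>\<^sup>+\<omega>. L \<omega> * indicator (cyl B) \<omega> \<partial>P)"
    if B: "\<forall>i. B i \<in> sets borel" for B
  proof -
    have B'[measurable]: "B i \<in> sets borel" for i using B by simp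
    have "emeasure Q (cyl B) = (\<integral>\<^sup>+\<omega>. indicator (cyl B) \<omega> \<partial>Q)"
      using cyl_sets[OF B] Q.sets_filtration_P by simp
    also have "\<dots> = (\<integral>\<^sup>+\<omega>. (\<Prod>i=1..n. indicator (B i) (X i \<omega>)) \<partial>Q)"
      by (intro nn_integral_cong) (auto simp: cyl_def Q.space_P indicator_def intro!: prod.neutral)
    also have "\<dots> = (\<Prod>i=1..n. \<integral>\<^sup>+\<omega>. indicator (B i) (X i \<omega>) \<partial>Q)"
      by (intro Q.indep_vars_nn_integral
          Q.indep_vars_compose2[OF Q.indep_vars_subset[OF Q.indep_X]]) auto
    also have "\<dots> = (\<Prod>i=1..n. \<integral>\<^sup>+\<omega>. e (X i \<omega>) * indicator (B i) (X i \<omega>) \<partial>P)"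
    proof (rule prod.cong[OF refl])
      fix i assume i: "i \<in> {1..n}"
      have "(\<integral>\<^sup>+\<omega>. indicator (B i) (X i \<omega>) \<partial>Q) = (\<integral>\<^sup>+\<omega>. indicator (B i) (X 1 \<omega>) \<partial>Q)"
        by (rule Q.nn_integral_X) (use i in auto)
      also have "\<dots> = (\<integral>\<^sup>+x. indicator (B i) x \<partial>distr Q borel (X 1))"
        by (subst nn_integral_distr) auto
      also have "\<dots> = (\<integral>\<^sup>+x. e x * indicator (B i) x \<partial>distr P borel (X 1))"
        unfolding law using e by (subst nn_integral_density) auto
      also have "\<dots> = (\<integral>\<^sup>+\<omega>. e (X 1 \<omega>) * indicator (B i) (X 1 \<omega>) \<partial>P)"
        using e by (subst nn_integral_distr) auto
      also have "\<dots> = (\<integral>\<^sup>+\<omega>. e (X i \<omega>) * indicator (B i) (X i \<omega>) \<partial>P)"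
        by (rule P.nn_integral_X[symmetric]) (use i e in auto)
      finally show "(\<integral>\<^sup>+\<omega>. indicator (B i) (X i \<omega>) \<partial>Q) = \<dots>" .
    qed
    also have "\<dots> = (\<integral>\<^sup>+\<omega>. (\<Prod>i=1..n. e (X i \<omega>) * indicator (B i) (X i \<omega>)) \<partial>P)"
      by (intro P.indep_vars_nn_integral[symmetric]
          P.indep_vars_compose2[OF P.indep_vars_subset[OF P.indep_X], where Y = "\<lambda>i x. e x * indicator (B i) x"])
        (use e in auto)
    also have "\<dots> = (\<integral>\<^sup>+\<omega>. L \<omega> * indicator (cyl B) \<omega> \<partial>P)"
    proof (intro nn_integral_cong)
      fix \<omega> assume "\<omega> \<in> space P"
      then have "(\<Prod>i=1..n. indicator (B i) (X i \<omega>)) = (indicator (cyl B) \<omega> :: ennreal)"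
        by (auto simp: cyl_def P.space_P indicator_def intro!: prod.neutral)
      then show "(\<Prod>i=1..n. e (X i \<omega>) * indicator (B i) (X i \<omega>)) = L \<omega> * indicator (cyl B) \<omega>"
        by (simp add: prod.distrib L_def)
    qed
    finally show ?thesis .
  qed
  have L': "L \<in> borel_measurable (restr_to_subalg P ?F)"
    by (rule measurable_in_subalg[OF P.subalgebra_filtration L])
  \<comment> \<open>The constant sequence \<open>space M\<close> is the exhaustion by sets of finite measure that uniqueness requires.\<close>
  have eq: "restr_to_subalg Q ?F = density (restr_to_subalg P ?F) L"
  proof (rule measure_eqI_generator_eq[OF stab, where \<Omega> = "space M" and A = "\<lambda>_. space M"])
    show "?G \<subseteq> Pow (space M)" by (auto simp: cyl_def)
    show "sets (restr_to_subalg Q ?F) = sigma_sets (space M) ?G"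
      using gen by (simp add: sets_restr_to_subalg[OF Q.subalgebra_filtration])
    show "sets (density (restr_to_subalg P ?F) L) = sigma_sets (space M) ?G"
      using gen by (simp add: sets_restr_to_subalg[OF P.subalgebra_filtration])
    have "space M = cyl (\<lambda>_. UNIV)" by (auto simp: cyl_def)
    then show "range (\<lambda>_::nat. space M) \<subseteq> ?G" by auto
    show "emeasure (restr_to_subalg Q ?F) (space M) \<noteq> \<infinity>" for i :: nat
      using emeasure_restr_to_subalg[OF Q.subalgebra_filtration, of "space M" n] sets.top[of ?F]
      by (simp add: Q.emeasure_eq_measure)
    fix C assume "C \<in> ?G"
    then obtain B where B: "\<forall>i. B i \<in> sets borel" "C = cyl B" by auto
    have C: "C \<in> sets ?F" using cyl_sets B by auto
    have "emeasure (density (restr_to_subalg P ?F) L) C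
        = (\<integral>\<^sup>+\<omega>. L \<omega> * indicator C \<omega> \<partial>restr_to_subalg P ?F)"
      using L' C by (intro emeasure_density) (auto simp: sets_restr_to_subalg[OF P.subalgebra_filtration])
    also have "\<dots> = (\<integral>\<^sup>+\<omega>. L \<omega> * indicator C \<omega> \<partial>P)"
      using L C by (intro nn_integral_subalgebra2[OF P.subalgebra_filtration]) auto
    finally show "emeasure (restr_to_subalg Q ?F) C = emeasure (density (restr_to_subalg P ?F) L) C"
      using cylQ[OF B(1)] B(2) C emeasure_restr_to_subalg[OF Q.subalgebra_filtration C] by simp
  qed auto
  have "(\<integral>\<^sup>+\<omega>. Z \<omega> \<partial>Q) = (\<integral>\<^sup>+\<omega>. Z \<omega> \<partial>restr_to_subalg Q ?F)"
    by (rule nn_integral_subalgebra2[OF Q.subalgebra_filtration Z, symmetric])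
  also have "\<dots> = (\<integral>\<^sup>+\<omega>. L \<omega> * Z \<omega> \<partial>restr_to_subalg P ?F)"
    unfolding eq by (rule nn_integral_density[OF L']) (rule measurable_in_subalg[OF P.subalgebra_filtration Z])
  also have "\<dots> = (\<integral>\<^sup>+\<omega>. L \<omega> * Z \<omega> \<partial>P)"
    using L Z by (intro nn_integral_subalgebra2[OF P.subalgebra_filtration]) auto
  finally show ?thesis by (simp add: L_def)
qed

section \<open>Log-optimal bets\<close>

definition payoff :: "real \<Rightarrow> real \<Rightarrow> real \<Rightarrow> real" where
  "payoff \<mu>0 g x = 1 + g * (x - \<mu>0)"

lemma payoff_measurable [measurable]: "payoff \<mu>0 g \<in> borel_measurable borel"
  unfolding payoff_def by measurable

lemma payoff_zero [simp]: "payoff \<mu>0 0 x = 1"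
  by (simp add: payoff_def)

lemma payoff_convex: "payoff \<mu>0 ((1 - t) * g + t * h) x = (1 - t) * payoff \<mu>0 g x + t * payoff \<mu>0 h x"
  by (simp add: payoff_def algebra_simps)

lemma elog_measurable [measurable]: "elog \<in> borel_measurable borel"
  unfolding elog_def by measurable

text \<open>
  The gap between an upper bound \<open>c\<close> and \<open>log y\<close>, with value \<open>\<infinity>\<close> for a ruinous \<open>y\<close>. It is nonnegative
  as long as \<open>log y \<le> c\<close>, which makes Fatou's lemma available for logarithms.
\<close>

definition log_loss :: "real \<Rightarrow> real \<Rightarrow> ennreal" where
  "log_loss c y = e2ennreal (ereal c - elog y)"

lemma log_loss_measurable [measurable]: "log_loss c \<in> borel_measurable borel"
  unfolding log_loss_def by measurable

lemma log_loss_pos: "0 < y \<Longrightarrow> log_loss c y = ennreal (c - ln y)"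
  by (simp add: log_loss_def elog_def)

lemma log_loss_nonpos: "y \<le> 0 \<Longrightarrow> log_loss c y = \<infinity>"
  by (simp add: log_loss_def elog_def)

text \<open>
  At positive \<open>y\<close> the loss is continuous. At \<open>0\<close> it is infinite, and it exceeds any given level
  as soon as its argument is small enough.
\<close>

lemma log_loss_lower_semicontinuous:
  assumes u: "u \<longlonglongrightarrow> y" and y: "0 \<le> y"
  shows "log_loss c y \<le> liminf (\<lambda>k. log_loss c (u k))"
proof (cases "y = 0")
  case False
  then have "0 < y" using y by simp
  then have ev: "eventually (\<lambda>k. 0 < u k) sequentially" using order_tendstoD(1)[OF u] by blast
  have "(\<lambda>k. ennreal (c - ln (u k))) \<longlonglongrightarrow> ennreal (c - ln y)"
    using u \<open>0 < y\<close> by (intro tendsto_intros) auto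
  then have "(\<lambda>k. log_loss c (u k)) \<longlonglongrightarrow> log_loss c y"
    unfolding log_loss_pos[OF \<open>0 < y\<close>]
    by (rule Lim_transform_eventually) (use ev in \<open>auto elim!: eventually_mono simp: log_loss_pos\<close>)
  then show ?thesis by (simp add: lim_imp_Liminf)
next
  case True
  show ?thesis
    unfolding le_Liminf_iff
  proof (intro allI impI)
    fix l assume "l < log_loss c y"
    then obtain r where r: "l = ennreal r" "0 \<le> r" by (cases l) (auto simp: log_loss_nonpos True)
    have "eventually (\<lambda>k. u k < exp (c - r - 1)) sequentially"
      using order_tendstoD(2)[OF u, of "exp (c - r - 1)"] True by simp
    then show "eventually (\<lambda>k. l < log_loss c (u k)) sequentially"
    proof eventually_elim
      case (elim k)
      show ?case
      proof (cases "0 < u k")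
        case True
        then have "ln (u k) < c - r - 1" using elim by (metis ln_exp ln_less_cancel_iff exp_gt_zero)
        then have "r < c - ln (u k)" by simp
        then show ?thesis using True r by (simp add: log_loss_pos ennreal_less_iff)
      qed (use r in \<open>simp add: log_loss_nonpos\<close>)
    qed
  qed
qed

text \<open>
  An expectation in the extended reals is a difference of two integrals. Shifting by an upper bound
  of the integrand turns it into a single nonnegative integral, which is easier to compare and
  to pass to limits with.
\<close>

lemma eexpectation_bounded_above:
  assumes "prob_space P" and [measurable]: "f \<in> borel_measurable P"
    and bound: "\<And>\<omega>. \<omega> \<in> space P \<Longrightarrow> f \<omega> \<le> ereal c" and c: "0 \<le> c"
  shows "eexpectation P f = ereal c - enn2ereal (\<integral>\<^sup>+\<omega>. e2ennreal (ereal c - f \<omega>) \<partial>P)"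
proof -
  interpret prob_space P by fact
  define A where "A = (\<integral>\<^sup>+\<omega>. e2ennreal (f \<omega>) \<partial>P)"
  define B where "B = (\<integral>\<^sup>+\<omega>. e2ennreal (- f \<omega>) \<partial>P)"
  define H where "H = (\<integral>\<^sup>+\<omega>. e2ennreal (ereal c - f \<omega>) \<partial>P)"
  have "A \<le> (\<integral>\<^sup>+\<omega>. ennreal c \<partial>P)"
    unfolding A_def using bound by (intro nn_integral_mono) (auto simp: e2ennreal_mono simp flip: e2ennreal_ereal)
  then have A: "A \<le> ennreal c" by (simp add: emeasure_space_1)
  then obtain a where a: "A = ennreal a" "0 \<le> a" by (cases A) (auto simp: top_unique)
  have "H + A = (\<integral>\<^sup>+\<omega>. e2ennreal (ereal c - f \<omega>) + e2ennreal (f \<omega>) \<partial>P)"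
    unfolding H_def A_def by (intro nn_integral_add[symmetric]) auto
  also have "\<dots> = (\<integral>\<^sup>+\<omega>. ennreal c + e2ennreal (- f \<omega>) \<partial>P)"
  proof (intro nn_integral_cong)
    fix \<omega> assume "\<omega> \<in> space P"
    then have "f \<omega> \<le> ereal c" by (rule bound)
    then show "e2ennreal (ereal c - f \<omega>) + e2ennreal (f \<omega>) = ennreal c + e2ennreal (- f \<omega>)"
      using c by (cases "f \<omega>"; cases "0 \<le> real_of_ereal (f \<omega>)")
        (auto simp: e2ennreal_neg ennreal_neg simp flip: ennreal_plus)
  qed
  also have "\<dots> = ennreal c + B"
    unfolding B_def by (subst nn_integral_add) (auto simp: emeasure_space_1)
  finally have eq: "H + ennreal a = ennreal c + B" using a by simp
  show ?thesis
    unfolding eexpectation_def A_def[symmetric] B_def[symmetric] H_def[symmetric] a(1)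
  proof (cases H)
    case (real h)
    then obtain b where b: "B = ennreal b" "0 \<le> b" using eq by (cases B) auto
    have "h + a = c + b" using eq real a b c by (simp flip: ennreal_plus)
    then show "enn2ereal (ennreal a) - enn2ereal B = ereal c - enn2ereal H"
      using real a b c by (simp add: enn2ereal_ennreal)
  next
    case top
    then have "B = top" using eq c by (cases B) (auto simp flip: ennreal_plus)
    then show "enn2ereal (ennreal a) - enn2ereal B = ereal c - enn2ereal H"
      using top a by (simp add: enn2ereal_ennreal)
  qed
qed

locale unit_betting = unit_iid Q M X for Q :: "'a measure" and M X +
  fixes \<mu>0 :: real
  assumes \<mu>0: "0 < \<mu>0" "\<mu>0 < 1"
begin

text \<open>
  The logarithm of a bound on all payoffs: the largest payoffs \<open>1 / \<mu>0\<close> and \<open>1 / (1 - \<mu>0)\<close> belong to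
  the two extreme bets, and their sum dominates both.
\<close>

definition cap :: real where
  "cap = ln (1 / \<mu>0 + 1 / (1 - \<mu>0))"

lemma cap_pos: "0 < cap"
proof -
  have "1 < 1 / \<mu>0" using \<mu>0 by simp
  moreover have "0 < 1 / (1 - \<mu>0)" using \<mu>0 by simp
  ultimately show ?thesis unfolding cap_def by (intro ln_gt_zero) linarith
qed

text \<open>
  The payoff is affine in \<open>x\<close>, so it is a convex combination of its values at \<open>0\<close> and \<open>1\<close>, and
  the end points of the bet range are exactly what keeps those two nonnegative.
\<close>

lemma payoff_bounds:
  assumes "g \<in> bet_range \<mu>0" "x \<in> {0..1}"
  shows "0 \<le> payoff \<mu>0 g x" "payoff \<mu>0 g x \<le> exp cap"
proof -
  have g: "g * \<mu>0 \<le> 1" "- 1 \<le> g * (1 - \<mu>0)"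
    using assms \<mu>0 by (auto simp: bet_range_def field_simps)
  have e: "payoff \<mu>0 g x = (1 - x) * (1 - g * \<mu>0) + x * (1 + g * (1 - \<mu>0))"
    by (simp add: payoff_def algebra_simps)
  show "0 \<le> payoff \<mu>0 g x" 
    unfolding e using mult_nonneg_nonneg[of "1 - x" "1 - g * \<mu>0"] mult_nonneg_nonneg[of x "1 + g * (1 - \<mu>0)"]
      g assms(2) by simp
  have K: "exp cap = 1 / \<mu>0 + 1 / (1 - \<mu>0)"
    unfolding cap_def using \<mu>0 by (simp add: add_pos_pos)
  have "1 - g * \<mu>0 \<le> exp cap"
  proof -
    have "- g \<le> 1 / (1 - \<mu>0)" using assms by (auto simp: bet_range_def)
    then have "- g * \<mu>0 \<le> 1 / (1 - \<mu>0) * \<mu>0" using \<mu>0 by (intro mult_right_mono) auto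
    then have "1 - g * \<mu>0 \<le> 1 / (1 - \<mu>0)" using \<mu>0 by (simp add: field_simps)
    also have "\<dots> \<le> exp cap" unfolding K using \<mu>0 by simp
    finally show ?thesis .
  qed
  moreover have "1 + g * (1 - \<mu>0) \<le> exp cap"
  proof -
    have "g \<le> 1 / \<mu>0" using assms by (auto simp: bet_range_def)
    then have "g * (1 - \<mu>0) \<le> 1 / \<mu>0 * (1 - \<mu>0)" using \<mu>0 by (intro mult_right_mono) auto
    then have "1 + g * (1 - \<mu>0) \<le> 1 / \<mu>0" using \<mu>0 by (simp add: field_simps)
    also have "\<dots> \<le> exp cap" unfolding K using \<mu>0 by simp
    finally show ?thesis .
  qed
  ultimately have "payoff \<mu>0 g x \<le> (1 - x) * exp cap + x * exp cap"
    unfolding e using assms by (intro add_mono mult_left_mono) auto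
  then show "payoff \<mu>0 g x \<le> exp cap" by (simp add: algebra_simps)
qed

lemma ln_payoff_le_cap:
  assumes "g \<in> bet_range \<mu>0" "x \<in> {0..1}" "0 < payoff \<mu>0 g x"
  shows "ln (payoff \<mu>0 g x) \<le> cap"
  using payoff_bounds[OF assms(1,2)] assms(3) by (metis ln_exp ln_le_cancel_iff exp_gt_zero)

lemma zero_bet: "0 \<in> bet_range \<mu>0"
  using \<mu>0 by (auto simp: bet_range_def divide_simps)

lemma bet_range_convex:
  assumes "g \<in> bet_range \<mu>0" "h \<in> bet_range \<mu>0" "0 \<le> t" "t \<le> 1"
  shows "(1 - t) * g + t * h \<in> bet_range \<mu>0"
  using convexD_alt[of "bet_range \<mu>0" g h t] assms by (simp add: bet_range_def)

lemma payoff_X_bounds: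
  assumes "g \<in> bet_range \<mu>0" "1 \<le> n" "\<omega> \<in> space Q"
  shows "0 \<le> payoff \<mu>0 g (X n \<omega>)" "payoff \<mu>0 g (X n \<omega>) \<le> exp cap"
  using payoff_bounds[OF assms(1)] X_range[of n \<omega>] assms space_P by auto

lemma log_growth_eq_loss:
  assumes g: "g \<in> bet_range \<mu>0"
  shows "log_growth Q X \<mu>0 g = ereal cap - enn2ereal (\<integral>\<^sup>+\<omega>. log_loss cap (payoff \<mu>0 g (X 1 \<omega>)) \<partial>Q)"
proof -
  have "(\<lambda>\<omega>. elog (1 + g * (X 1 \<omega> - \<mu>0))) \<in> borel_measurable Q" by measurable
  then show ?thesis
    unfolding log_growth_def log_loss_def payoff_def
  proof (rule eexpectation_bounded_above[OF prob_space_axioms])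
    fix \<omega> assume w: "\<omega> \<in> space Q"
    have "X 1 \<omega> \<in> {0..1}" using w X_range[of 1 \<omega>] by (simp add: space_P)
    then show "elog (1 + g * (X 1 \<omega> - \<mu>0)) \<le> ereal cap"
      using ln_payoff_le_cap[OF g, of "X 1 \<omega>"] by (auto simp: elog_def payoff_def)
  qed (use cap_pos in simp)
qed

lemma nn_integral_log_loss:
  assumes g: "g \<in> bet_range \<mu>0" and pos: "AE \<omega> in Q. 0 < payoff \<mu>0 g (X 1 \<omega>)"
  shows "(\<integral>\<^sup>+\<omega>. log_loss cap (payoff \<mu>0 g (X 1 \<omega>)) \<partial>Q)
       = (\<integral>\<^sup>+\<omega>. ennreal (cap - ln (payoff \<mu>0 g (X 1 \<omega>))) \<partial>Q)"
    and "AE \<omega> in Q. 0 \<le> cap - ln (payoff \<mu>0 g (X 1 \<omega>))"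
proof -
  show "(\<integral>\<^sup>+\<omega>. log_loss cap (payoff \<mu>0 g (X 1 \<omega>)) \<partial>Q)
       = (\<integral>\<^sup>+\<omega>. ennreal (cap - ln (payoff \<mu>0 g (X 1 \<omega>))) \<partial>Q)"
    by (rule nn_integral_cong_AE) (use pos in eventually_elim, simp add: log_loss_pos)
  show "AE \<omega> in Q. 0 \<le> cap - ln (payoff \<mu>0 g (X 1 \<omega>))"
    using pos AE_space
  proof eventually_elim
    case (elim \<omega>)
    then show ?case using ln_payoff_le_cap[OF g, of "X 1 \<omega>"] X_range[of 1 \<omega>] by (simp add: space_P)
  qed
qed

lemma log_growth_eq_integral:
  assumes g: "g \<in> bet_range \<mu>0" and pos: "AE \<omega> in Q. 0 < payoff \<mu>0 g (X 1 \<omega>)"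
    and int: "integrable Q (\<lambda>\<omega>. ln (payoff \<mu>0 g (X 1 \<omega>)))"
  shows "log_growth Q X \<mu>0 g = ereal (\<integral>\<omega>. ln (payoff \<mu>0 g (X 1 \<omega>)) \<partial>Q)"
proof -
  have "(\<integral>\<^sup>+\<omega>. ennreal (cap - ln (payoff \<mu>0 g (X 1 \<omega>))) \<partial>Q) = ennreal (\<integral>\<omega>. cap - ln (payoff \<mu>0 g (X 1 \<omega>)) \<partial>Q)"
    using int nn_integral_log_loss(2)[OF g pos] by (intro nn_integral_eq_integral) auto
  moreover have "0 \<le> (\<integral>\<omega>. cap - ln (payoff \<mu>0 g (X 1 \<omega>)) \<partial>Q)"
    using nn_integral_log_loss(2)[OF g pos] by (rule integral_nonneg_AE)
  moreover have "(\<integral>\<omega>. cap - ln (payoff \<mu>0 g (X 1 \<omega>)) \<partial>Q) = cap - (\<integral>\<omega>. ln (payoff \<mu>0 g (X 1 \<omega>)) \<partial>Q)"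
    using int by (subst Bochner_Integration.integral_diff) (auto simp: prob_space)
  ultimately show ?thesis
    unfolding log_growth_eq_loss[OF g] nn_integral_log_loss(1)[OF g pos]
    by (simp add: enn2ereal_ennreal)
qed

text \<open>
  A finite integral of the loss excludes ruin almost surely, and then the extended expectation is
  an ordinary integral.
\<close>

lemma log_growth_finite:
  assumes g: "g \<in> bet_range \<mu>0" and fin: "log_growth Q X \<mu>0 g \<noteq> -\<infinity>"
  shows "AE \<omega> in Q. 0 < payoff \<mu>0 g (X 1 \<omega>)"
    and "integrable Q (\<lambda>\<omega>. ln (payoff \<mu>0 g (X 1 \<omega>)))"
    and "log_growth Q X \<mu>0 g = ereal (\<integral>\<omega>. ln (payoff \<mu>0 g (X 1 \<omega>)) \<partial>Q)"
proof -
  have H: "(\<integral>\<^sup>+\<omega>. log_loss cap (payoff \<mu>0 g (X 1 \<omega>)) \<partial>Q) \<noteq> \<infinity>"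
    using fin unfolding log_growth_eq_loss[OF g] by auto
  then have "AE \<omega> in Q. log_loss cap (payoff \<mu>0 g (X 1 \<omega>)) \<noteq> \<infinity>"
    by (intro nn_integral_noteq_infinite) auto
  then show pos: "AE \<omega> in Q. 0 < payoff \<mu>0 g (X 1 \<omega>)"
    by eventually_elim (use log_loss_nonpos not_less in blast)
  have "integrable Q (\<lambda>\<omega>. cap - ln (payoff \<mu>0 g (X 1 \<omega>)))"
    using H nn_integral_log_loss[OF g pos] by (intro integrableI_nonneg) (auto simp: less_top)
  from Bochner_Integration.integrable_diff[OF integrable_const[of cap] this]
  show int: "integrable Q (\<lambda>\<omega>. ln (payoff \<mu>0 g (X 1 \<omega>)))"
    by (simp only: diff_diff_eq2 add_diff_cancel_left')
  show "log_growth Q X \<mu>0 g = ereal (\<integral>\<omega>. ln (payoff \<mu>0 g (X 1 \<omega>)) \<partial>Q)"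
    by (rule log_growth_eq_integral[OF g pos int])
qed

lemma log_growth_zero: "log_growth Q X \<mu>0 0 = 0"
  using log_growth_eq_integral[OF zero_bet] by simp

abbreviation log_optimal :: "real \<Rightarrow> bool" where
  "log_optimal \<equiv> is_arg_max (log_growth Q X \<mu>0) (\<lambda>g. g \<in> bet_range \<mu>0)"

text \<open>
  The maximum is attained: a sequence of bets minimising the expected loss has a convergent
  subsequence, and by Fatou's lemma and lower semicontinuity its limit is a minimiser.
\<close>

lemma log_optimal_exists: "\<exists>g. log_optimal g"
proof -
  let ?H = "\<lambda>g. \<integral>\<^sup>+\<omega>. log_loss cap (payoff \<mu>0 g (X 1 \<omega>)) \<partial>Q"
  let ?I = "INF g\<in>bet_range \<mu>0. ?H g"
  have ne: "?H ` bet_range \<mu>0 \<noteq> {}" using zero_bet by auto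
  obtain f where f: "decseq f" "range f \<subseteq> ?H ` bet_range \<mu>0" "?I = (INF k. f k)"
    using ennreal_Inf_countable_INF[OF ne] by metis
  have "\<forall>k. \<exists>g. g \<in> bet_range \<mu>0 \<and> f k = ?H g" using f(2) by blast
  then obtain u where u: "\<And>k. u k \<in> bet_range \<mu>0" "\<And>k. f k = ?H (u k)" by metis
  have "compact (bet_range \<mu>0)" by (simp add: bet_range_def)
  then obtain l r where l: "l \<in> bet_range \<mu>0" and r: "strict_mono r" "(u \<circ> r) \<longlonglongrightarrow> l"
    using u(1) unfolding compact_def by metis
  have "(\<lambda>k. f (r k)) \<longlonglongrightarrow> ?I"
    using LIMSEQ_subseq_LIMSEQ[OF LIMSEQ_INF[OF f(1)] r(1)] f(3) by (simp add: comp_def)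
  then have lim: "liminf (\<lambda>k. f (r k)) = ?I" by (simp add: lim_imp_Liminf)
  have "?H l \<le> (\<integral>\<^sup>+\<omega>. liminf (\<lambda>k. log_loss cap (payoff \<mu>0 (u (r k)) (X 1 \<omega>))) \<partial>Q)"
  proof (intro nn_integral_mono log_loss_lower_semicontinuous)
    fix \<omega> assume "\<omega> \<in> space Q"
    then show "0 \<le> payoff \<mu>0 l (X 1 \<omega>)" using payoff_X_bounds(1)[OF l] by simp
    show "(\<lambda>k. payoff \<mu>0 (u (r k)) (X 1 \<omega>)) \<longlonglongrightarrow> payoff \<mu>0 l (X 1 \<omega>)"
      unfolding payoff_def using r(2) by (intro tendsto_intros) (simp add: comp_def)
  qed
  also have "\<dots> \<le> liminf (\<lambda>k. ?H (u (r k)))"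
    by (rule nn_integral_liminf) measurable
  also have "\<dots> = ?I" using lim u(2) by simp
  finally have min: "?H l \<le> ?H g" if "g \<in> bet_range \<mu>0" for g
    using that by (meson INF_lower order_trans)
  have "log_growth Q X \<mu>0 g \<le> log_growth Q X \<mu>0 l" if "g \<in> bet_range \<mu>0" for g
    unfolding log_growth_eq_loss[OF that] log_growth_eq_loss[OF l]
    using min[OF that] by (intro ereal_minus_mono) (simp_all add: less_eq_ennreal.rep_eq)
  then show ?thesis using l by (intro exI[of _ l]) (auto simp: is_arg_max_def not_less)
qed

lemma log_optimalD:
  assumes "log_optimal gs"
  shows "gs \<in> bet_range \<mu>0" "g \<in> bet_range \<mu>0 \<Longrightarrow> log_growth Q X \<mu>0 g \<le> log_growth Q X \<mu>0 gs"
    and "0 \<le> log_growth Q X \<mu>0 gs"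
    and "(SUP g\<in>bet_range \<mu>0. log_growth Q X \<mu>0 g) = log_growth Q X \<mu>0 gs"
proof -
  show gs: "gs \<in> bet_range \<mu>0" using assms by (simp add: is_arg_max_def)
  show le: "log_growth Q X \<mu>0 g \<le> log_growth Q X \<mu>0 gs" if "g \<in> bet_range \<mu>0" for g
    using assms that by (auto simp: is_arg_max_def not_less)
  show "0 \<le> log_growth Q X \<mu>0 gs" using le[OF zero_bet] by (simp add: log_growth_zero)
  show "(SUP g\<in>bet_range \<mu>0. log_growth Q X \<mu>0 g) = log_growth Q X \<mu>0 gs"
    using gs le by (intro antisym SUP_least SUP_upper) auto
qed

lemma log_optimal_finite:
  assumes "log_optimal gs"
  shows "AE \<omega> in Q. 0 < payoff \<mu>0 gs (X 1 \<omega>)"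
    and "integrable Q (\<lambda>\<omega>. ln (payoff \<mu>0 gs (X 1 \<omega>)))"
    and "log_growth Q X \<mu>0 gs = ereal (\<integral>\<omega>. ln (payoff \<mu>0 gs (X 1 \<omega>)) \<partial>Q)"
proof -
  have "log_growth Q X \<mu>0 gs \<noteq> -\<infinity>" using log_optimalD(3)[OF assms] by auto
  then show "AE \<omega> in Q. 0 < payoff \<mu>0 gs (X 1 \<omega>)"
    "integrable Q (\<lambda>\<omega>. ln (payoff \<mu>0 gs (X 1 \<omega>)))"
    "log_growth Q X \<mu>0 gs = ereal (\<integral>\<omega>. ln (payoff \<mu>0 gs (X 1 \<omega>)) \<partial>Q)"
    using log_growth_finite[OF log_optimalD(1)[OF assms]] by auto
qed

end

section \<open>Duality: the least favourable null law\<close>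

context unit_betting begin

text \<open>
  The first-order condition for the maximiser \<open>gs\<close>. Moving from \<open>gs\<close> a fraction \<open>t\<close> of the way
  towards \<open>g\<close> cannot increase the expected logarithm, and the difference quotients of the
  logarithm converge to the payoff ratio minus \<open>1\<close> as \<open>t\<close> tends to \<open>0\<close>. Fatou's lemma gives the
  inequality for interior and boundary maximisers at once, so no derivative of the growth rate
  is ever taken.
\<close>

lemma numeraire:
  assumes opt: "log_optimal gs" and g: "g \<in> bet_range \<mu>0"
  shows "(\<integral>\<^sup>+\<omega>. ennreal (payoff \<mu>0 g (X 1 \<omega>) / payoff \<mu>0 gs (X 1 \<omega>)) \<partial>Q) \<le> 1"
proof -
  note gs = log_optimalD(1)[OF opt]
  define E where "E \<omega> = payoff \<mu>0 gs (X 1 \<omega>)" for \<omega>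
  define Z where "Z \<omega> = payoff \<mu>0 g (X 1 \<omega>)" for \<omega>
  have [measurable]: "E \<in> borel_measurable Q" "Z \<in> borel_measurable Q" unfolding E_def Z_def by measurable
  have E: "AE \<omega> in Q. 0 < E \<omega>" and intE: "integrable Q (\<lambda>\<omega>. ln (E \<omega>))"
    and gE: "log_growth Q X \<mu>0 gs = ereal (\<integral>\<omega>. ln (E \<omega>) \<partial>Q)"
    using log_optimal_finite[OF opt] by (auto simp: E_def)
  have Z: "0 \<le> Z \<omega>" if "\<omega> \<in> space Q" for \<omega>
    using payoff_X_bounds(1)[OF g _ that, of 1] by (simp add: Z_def)
  define t where "t k = 1 / (real k + 2)" for k
  have t: "0 < t k" "t k < 1" for k by (auto simp: t_def)
  define G where "G k = (1 - t k) * gs + t k * g" for k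
  have G: "G k \<in> bet_range \<mu>0" for k
    unfolding G_def using t[of k] by (intro bet_range_convex gs g) auto
  define p where "p k \<omega> = (1 - t k) * E \<omega> + t k * Z \<omega>" for k \<omega>
  have [measurable]: "p k \<in> borel_measurable Q" for k unfolding p_def by measurable
  have p: "payoff \<mu>0 (G k) (X 1 \<omega>) = p k \<omega>" for k \<omega>
    by (simp add: G_def p_def E_def Z_def payoff_convex)
  have p_ge: "AE \<omega> in Q. 0 < (1 - t k) * E \<omega> \<and> (1 - t k) * E \<omega> \<le> p k \<omega> \<and> p k \<omega> \<le> exp cap" for k
    using E AE_space
  proof eventually_elim
    case (elim \<omega>)
    have "0 \<le> t k * Z \<omega>" using t[of k] Z[OF elim(2)] by simp
    then show ?case
      using elim t[of k] payoff_X_bounds(2)[OF G[of k] _ elim(2), of 1] p[of k \<omega>] by (simp add: p_def)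
  qed
  have ln_p: "AE \<omega> in Q. ln (1 - t k) + ln (E \<omega>) \<le> ln (p k \<omega>) \<and> ln (p k \<omega>) \<le> cap" for k
    using p_ge[of k] E
  proof eventually_elim
    case (elim \<omega>)
    have "ln ((1 - t k) * E \<omega>) \<le> ln (p k \<omega>)" using elim by (subst ln_le_cancel_iff) linarith+
    moreover have "ln ((1 - t k) * E \<omega>) = ln (1 - t k) + ln (E \<omega>)"
      using t[of k] elim by (intro ln_mult_pos) auto
    moreover have "ln (p k \<omega>) \<le> ln (exp cap)" using elim by (subst ln_le_cancel_iff) linarith+
    ultimately show ?case by simp
  qed
  have int_p: "integrable Q (\<lambda>\<omega>. ln (p k \<omega>))" for k
  proof (rule Bochner_Integration.integrable_bound)
    show "integrable Q (\<lambda>\<omega>. \<bar>cap\<bar> + \<bar>ln (1 - t k)\<bar> + \<bar>ln (E \<omega>)\<bar>)" using intE by auto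
    show "AE \<omega> in Q. norm (ln (p k \<omega>)) \<le> norm (\<bar>cap\<bar> + \<bar>ln (1 - t k)\<bar> + \<bar>ln (E \<omega>)\<bar>)"
      using ln_p[of k] by eventually_elim auto
  qed measurable
  have le: "(\<integral>\<omega>. ln (p k \<omega>) \<partial>Q) \<le> (\<integral>\<omega>. ln (E \<omega>) \<partial>Q)" for k
  proof -
    have "AE \<omega> in Q. 0 < payoff \<mu>0 (G k) (X 1 \<omega>)"
      using p_ge[of k] unfolding p by eventually_elim linarith
    then have "log_growth Q X \<mu>0 (G k) = ereal (\<integral>\<omega>. ln (p k \<omega>) \<partial>Q)"
      using log_growth_eq_integral[OF G[of k]] int_p[of k] unfolding p by blast
    then show ?thesis using log_optimalD(2)[OF opt G[of k]] gE by simp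
  qed
  \<comment> \<open>The difference quotient of the logarithm is shifted by \<open>- ln (1 - t) / t\<close>, which makes it
      nonnegative as Fatou requires. The shift tends to 1 and cancels the 1 in the limit of the quotient.\<close>
  define F where "F k \<omega> = (real k + 2) * (ln (p k \<omega>) - ln (E \<omega>) - ln (1 - t k))" for k \<omega>
  have F_int: "(\<integral>\<^sup>+\<omega>. ennreal (F k \<omega>) \<partial>Q) \<le> ennreal ((real k + 2) * - ln (1 - t k))" for k
  proof -
    have "AE \<omega> in Q. 0 \<le> F k \<omega>"
      using ln_p[of k] by eventually_elim (auto simp: F_def intro!: mult_nonneg_nonneg)
    moreover have "integrable Q (F k)" unfolding F_def using int_p intE by auto
    ultimately have "(\<integral>\<^sup>+\<omega>. ennreal (F k \<omega>) \<partial>Q) = ennreal (\<integral>\<omega>. F k \<omega> \<partial>Q)"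
      by (intro nn_integral_eq_integral) auto
    also have "(\<integral>\<omega>. F k \<omega> \<partial>Q) = (real k + 2) * ((\<integral>\<omega>. ln (p k \<omega>) \<partial>Q) - (\<integral>\<omega>. ln (E \<omega>) \<partial>Q) - ln (1 - t k))"
      unfolding F_def using int_p[of k] intE by (simp add: prob_space)
    also have "\<dots> \<le> (real k + 2) * (- ln (1 - t k))"
      using le[of k] by (intro mult_left_mono) auto
    finally show ?thesis by (simp only: ennreal_leI)
  qed
  have F_lim: "AE \<omega> in Q. (\<lambda>k. F k \<omega>) \<longlonglongrightarrow> Z \<omega> / E \<omega>"
    using E AE_space
  proof eventually_elim
    case (elim \<omega>)
    define U where "U = Z \<omega> / E \<omega>"
    have U: "0 \<le> U" using elim Z[of \<omega>] by (simp add: U_def)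
    have "F k \<omega> = (real k + 2) * ln (1 + U / (real k + 1))" for k
    proof -
      have e: "p k \<omega> = ((1 - t k) * E \<omega>) * (1 + U / (real k + 1))"
      proof -
        have 1: "1 - t k = (real k + 1) * t k" by (simp add: t_def field_simps)
        have "E \<omega> * U = Z \<omega>" using elim(1) by (simp add: U_def)
        then have 2: "(real k + 1) * (E \<omega> * (1 + U / (real k + 1))) = (real k + 1) * E \<omega> + Z \<omega>"
          by (simp add: field_simps)
        have "((1 - t k) * E \<omega>) * (1 + U / (real k + 1)) = t k * ((real k + 1) * (E \<omega> * (1 + U / (real k + 1))))"
          unfolding 1 by (simp only: mult_ac)
        then show ?thesis unfolding 2 p_def 1 by (simp add: algebra_simps)
      qed
      have "ln (p k \<omega>) = ln ((1 - t k) * E \<omega>) + ln (1 + U / (real k + 1))"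
        unfolding e using t[of k] elim(1) U by (intro ln_mult_pos) (auto intro!: add_pos_nonneg)
      also have "ln ((1 - t k) * E \<omega>) = ln (1 - t k) + ln (E \<omega>)"
        using t[of k] elim by (intro ln_mult_pos) auto
      finally show ?thesis by (simp add: F_def)
    qed
    moreover have "(\<lambda>k. (real k + 2) * ln (1 + U / (real k + 1))) \<longlonglongrightarrow> U"
    proof (cases "U = 0")
      case False
      then have "0 < U" using U by simp
      then show ?thesis by real_asymp
    qed simp
    ultimately show ?case by (simp add: U_def)
  qed
  have "(\<integral>\<^sup>+\<omega>. ennreal (Z \<omega> / E \<omega>) \<partial>Q) = (\<integral>\<^sup>+\<omega>. liminf (\<lambda>k. ennreal (F k \<omega>)) \<partial>Q)"
  proof (rule nn_integral_cong_AE, use F_lim in eventually_elim)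
    case (elim \<omega>)
    then show ?case using lim_imp_Liminf[OF trivial_limit_sequentially tendsto_ennrealI[OF elim]] by simp
  qed
  also have "\<dots> \<le> liminf (\<lambda>k. \<integral>\<^sup>+\<omega>. ennreal (F k \<omega>) \<partial>Q)"
    unfolding F_def by (rule nn_integral_liminf) measurable
  also have "\<dots> \<le> liminf (\<lambda>k. ennreal ((real k + 2) * - ln (1 - t k)))"
    by (intro Liminf_mono always_eventually allI F_int)
  also have "\<dots> = ennreal 1"
  proof (intro lim_imp_Liminf tendsto_ennrealI)
    show "(\<lambda>k. (real k + 2) * - ln (1 - t k)) \<longlonglongrightarrow> 1"
      unfolding t_def by real_asymp
  qed simp
  finally show ?thesis by (simp add: Z_def E_def)
qed

text \<open>
  If the optimal growth were \<open>0\<close>, then not betting would be optimal. Comparing the payoff \<open>1\<close> of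
  the zero bet with the two extreme bets by means of \<open>numeraire\<close> then forces the mean to be \<open>\<mu>0\<close>.
\<close>

lemma log_optimal_growth_pos:
  assumes opt: "log_optimal gs" and mean: "(\<integral>\<omega>. X 1 \<omega> \<partial>Q) \<noteq> \<mu>0"
  shows "0 < log_growth Q X \<mu>0 gs"
proof (rule ccontr)
  assume "\<not> 0 < log_growth Q X \<mu>0 gs"
  then have opt0: "log_optimal 0"
    using log_optimalD[OF opt] zero_bet log_growth_zero
    by (auto simp: is_arg_max_def not_less)
  have X: "X 1 \<omega> \<in> {0..1}" if "\<omega> \<in> space Q" for \<omega> using that X_range[of 1] by (simp add: space_P)
  have intX: "integrable Q (X 1)"
    by (rule integrable_const_bound[of _ 1]) (use X in auto)
  have half: "0 \<le> g * (\<mu>0 - (\<integral>\<omega>. X 1 \<omega> \<partial>Q))" if g: "g \<in> bet_range \<mu>0" for g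
  proof -
    have "ennreal (\<integral>\<omega>. payoff \<mu>0 g (X 1 \<omega>) \<partial>Q) = (\<integral>\<^sup>+\<omega>. ennreal (payoff \<mu>0 g (X 1 \<omega>)) \<partial>Q)"
      using payoff_X_bounds(1)[OF g, of 1] intX
      by (intro nn_integral_eq_integral[symmetric]) (auto simp: payoff_def)
    also have "\<dots> \<le> 1" using numeraire[OF opt0 g] by simp
    finally have "(\<integral>\<omega>. payoff \<mu>0 g (X 1 \<omega>) \<partial>Q) \<le> 1" by simp
    moreover have "(\<integral>\<omega>. payoff \<mu>0 g (X 1 \<omega>) \<partial>Q) = 1 + g * ((\<integral>\<omega>. X 1 \<omega> \<partial>Q) - \<mu>0)"
      unfolding payoff_def using intX by (simp add: prob_space)
    ultimately show ?thesis by (simp add: algebra_simps)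
  qed
  have "0 \<le> \<mu>0 - (\<integral>\<omega>. X 1 \<omega> \<partial>Q)"
    using half[of "1 / \<mu>0"] \<mu>0 by (auto simp: bet_range_def zero_le_mult_iff divide_simps)
  moreover have "\<mu>0 - (\<integral>\<omega>. X 1 \<omega> \<partial>Q) \<le> 0"
    using half[of "- 1 / (1 - \<mu>0)"] \<mu>0 by (auto simp: bet_range_def zero_le_mult_iff divide_simps)
  ultimately show False using mean by simp
qed

text \<open>
  Dividing the law of \<open>X 1\<close> by the optimal payoff gives a measure of mass \<open>m \<le> 1\<close> and first moment
  \<open>y\<close>. By \<open>numeraire\<close> for the extreme bets, the missing mass can be placed on the points \<open>0\<close> and
  \<open>1\<close> with weights \<open>a\<close> and \<open>b\<close> such that the mean becomes \<open>\<mu>0\<close>. The condition for \<open>gs\<close> itself is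
  an equality, and it says that the optimal payoff vanishes at every point that carries an added
  atom. Multiplying by the payoff therefore deletes the atoms and returns the law of \<open>X 1\<close>.
\<close>

lemma least_favourable_law:
  assumes opt: "log_optimal gs"
  obtains \<nu> :: "real measure" where "prob_space \<nu>" "sets \<nu> = sets borel" "AE x in \<nu>. x \<in> {0..1}"
    "(\<integral>x. x \<partial>\<nu>) = \<mu>0" "distr Q borel (X 1) = density \<nu> (\<lambda>x. ennreal (payoff \<mu>0 gs x))"
proof -
  note gs = log_optimalD(1)[OF opt]
  define Y where "Y = X 1"
  define E where "E \<omega> = payoff \<mu>0 gs (Y \<omega>)" for \<omega>
  have Y_meas[measurable]: "Y \<in> borel_measurable Q" unfolding Y_def by measurable
  have [measurable]: "E \<in> borel_measurable Q" unfolding E_def by measurable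
  have Y: "0 \<le> Y \<omega>" "Y \<omega> \<le> 1" if "\<omega> \<in> space Q" for \<omega>
    using that X_range[of 1 \<omega>] by (auto simp: space_P Y_def)
  have E: "AE \<omega> in Q. 0 < E \<omega>" using log_optimal_finite(1)[OF opt] by (simp add: E_def Y_def)
  have num: "(\<integral>\<^sup>+\<omega>. ennreal (payoff \<mu>0 g (Y \<omega>) / E \<omega>) \<partial>Q) \<le> 1" if "g \<in> bet_range \<mu>0" for g
    using numeraire[OF opt that] by (simp add: E_def Y_def)
  have E0: "0 \<le> E \<omega>" if "\<omega> \<in> space Q" for \<omega>
    using payoff_X_bounds(1)[OF gs _ that, of 1] by (simp add: E_def Y_def)
  have int1: "integrable Q (\<lambda>\<omega>. 1 / E \<omega>)"
    using num[OF zero_bet] E0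
    by (intro integrableI_nonneg) (auto intro: le_less_trans)
  have intY: "integrable Q (\<lambda>\<omega>. Y \<omega> / E \<omega>)"
    by (rule Bochner_Integration.integrable_bound[OF int1])
      (use Y E0 in \<open>auto simp: divide_right_mono\<close>)
  define m where "m = (\<integral>\<omega>. 1 / E \<omega> \<partial>Q)"
  define y where "y = (\<integral>\<omega>. Y \<omega> / E \<omega> \<partial>Q)"
  have lin: "(\<integral>\<omega>. payoff \<mu>0 g (Y \<omega>) / E \<omega> \<partial>Q) = (1 - g * \<mu>0) * m + g * y"
    and lin_int: "integrable Q (\<lambda>\<omega>. payoff \<mu>0 g (Y \<omega>) / E \<omega>)" for g
  proof -
    have e: "payoff \<mu>0 g (Y \<omega>) / E \<omega> = (1 - g * \<mu>0) * (1 / E \<omega>) + g * (Y \<omega> / E \<omega>)" for \<omega>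
      by (simp add: payoff_def divide_inverse algebra_simps)
    show "(\<integral>\<omega>. payoff \<mu>0 g (Y \<omega>) / E \<omega> \<partial>Q) = (1 - g * \<mu>0) * m + g * y"
      unfolding e m_def y_def using int1 intY
      by (subst Bochner_Integration.integral_add) (auto simp del: times_divide_eq_right)
    show "integrable Q (\<lambda>\<omega>. payoff \<mu>0 g (Y \<omega>) / E \<omega>)"
      unfolding e using int1 intY by (intro Bochner_Integration.integrable_add integrable_mult_right) auto
  qed
  have lin_le: "(1 - g * \<mu>0) * m + g * y \<le> 1" if g: "g \<in> bet_range \<mu>0" for g
  proof -
    have "ennreal (\<integral>\<omega>. payoff \<mu>0 g (Y \<omega>) / E \<omega> \<partial>Q) = (\<integral>\<^sup>+\<omega>. ennreal (payoff \<mu>0 g (Y \<omega>) / E \<omega>) \<partial>Q)"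
      using lin_int payoff_X_bounds(1)[OF g, of 1] E0
      by (intro nn_integral_eq_integral[symmetric]) (auto simp: Y_def)
    then have "ennreal ((1 - g * \<mu>0) * m + g * y) \<le> 1" using num[OF g] lin[of g] by simp
    then show ?thesis by simp
  qed
  have lin_gs: "(1 - gs * \<mu>0) * m + gs * y = 1"
  proof -
    have "(\<integral>\<omega>. payoff \<mu>0 gs (Y \<omega>) / E \<omega> \<partial>Q) = (\<integral>\<omega>. 1 \<partial>Q)"
      by (rule integral_cong_AE) (use E in \<open>auto simp: E_def elim!: eventually_mono\<close>)
    then show ?thesis using lin[of gs] by (simp add: prob_space)
  qed
  define b where "b = \<mu>0 - y"
  define a where "a = 1 - m - b"
  have b: "0 \<le> b"
    using lin_le[of "1 / \<mu>0"] \<mu>0 by (simp add: b_def bet_range_def divide_simps)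
  have a: "0 \<le> a"
  proof -
    have "(1 - (- 1 / (1 - \<mu>0)) * \<mu>0) * m + (- 1 / (1 - \<mu>0)) * y \<le> 1"
      using \<mu>0 by (intro lin_le) (auto simp: bet_range_def divide_simps)
    moreover have "(1 - (- 1 / (1 - \<mu>0)) * \<mu>0) * m + (- 1 / (1 - \<mu>0)) * y = (m - y) / (1 - \<mu>0)"
    proof -
      have "1 - (- 1 / (1 - \<mu>0)) * \<mu>0 = 1 / (1 - \<mu>0)" using \<mu>0 by (simp add: divide_simps)
      then show ?thesis by (simp add: diff_divide_distrib)
    qed
    ultimately have "m - y \<le> 1 - \<mu>0" using \<mu>0 by (simp add: divide_simps)
    then show ?thesis by (simp add: a_def b_def)
  qed
  have m: "0 \<le> m" unfolding m_def using E0 by (intro integral_nonneg_AE) auto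
  have y: "0 \<le> y" unfolding y_def using E0 Y by (intro integral_nonneg_AE) auto
  have pay0: "0 \<le> payoff \<mu>0 gs 0" and pay1: "0 \<le> payoff \<mu>0 gs 1"
    using payoff_bounds(1)[OF gs] by auto
  have sum0: "a * payoff \<mu>0 gs 0 + b * payoff \<mu>0 gs 1 = 0"
  proof -
    have "a * payoff \<mu>0 gs 0 + b * payoff \<mu>0 gs 1 = 1 - ((1 - gs * \<mu>0) * m + gs * y)"
      by (simp add: payoff_def a_def b_def algebra_simps)
    then show ?thesis using lin_gs by simp
  qed
  have a0: "a * payoff \<mu>0 gs 0 = 0" and b0: "b * payoff \<mu>0 gs 1 = 0"
    using sum0 mult_nonneg_nonneg[OF a pay0] mult_nonneg_nonneg[OF b pay1] by linarith+
  \<comment> \<open>The mixture is an image of a product: \<open>None\<close> selects the part with density \<open>1 / E\<close>, the other two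
      indices select the atoms at 1 and 0.\<close>
  let ?C = "count_space (UNIV :: bool option set)"
  define w where "w = (\<lambda>(i, \<omega>). case i of None \<Rightarrow> ennreal (1 / E \<omega>) | Some True \<Rightarrow> ennreal b | Some False \<Rightarrow> ennreal a)"
  define f where "f = (\<lambda>(i, \<omega>). case i of None \<Rightarrow> Y \<omega> | Some True \<Rightarrow> 1 | Some False \<Rightarrow> (0::real))"
  have [measurable]: "w \<in> borel_measurable (?C \<Otimes>\<^sub>M Q)"
  proof (rule measurable_pair_measure_countable1)
    fix i show "(\<lambda>\<omega>. w (i, \<omega>)) \<in> borel_measurable Q"
      by (cases i; cases "the i") (auto simp: w_def)
  qed auto
  have [measurable]: "f \<in> borel_measurable (?C \<Otimes>\<^sub>M Q)"
  proof (rule measurable_pair_measure_countable1)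
    fix i show "(\<lambda>\<omega>. f (i, \<omega>)) \<in> borel_measurable Q"
      by (cases i; cases "the i") (auto simp: f_def)
  qed auto
  define \<nu> where "\<nu> = distr (density (?C \<Otimes>\<^sub>M Q) w) borel f"
  have nu: "(\<integral>\<^sup>+x. h x \<partial>\<nu>) = (\<integral>\<^sup>+\<omega>. ennreal (1 / E \<omega>) * h (Y \<omega>) \<partial>Q) + ennreal b * h 1 + ennreal a * h 0"
    if h[measurable]: "h \<in> borel_measurable borel" for h :: "real \<Rightarrow> ennreal"
  proof -
    have "(\<integral>\<^sup>+x. h x \<partial>\<nu>) = (\<integral>\<^sup>+z. w z * h (f z) \<partial>(?C \<Otimes>\<^sub>M Q))"
      unfolding \<nu>_def by (simp add: nn_integral_distr nn_integral_density)
    also have "\<dots> = (\<integral>\<^sup>+i. \<integral>\<^sup>+\<omega>. w (i, \<omega>) * h (f (i, \<omega>)) \<partial>Q \<partial>?C)"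
      by (rule nn_integral_fst[symmetric]) measurable
    also have "\<dots> = (\<Sum>i\<in>UNIV. \<integral>\<^sup>+\<omega>. w (i, \<omega>) * h (f (i, \<omega>)) \<partial>Q)"
      by (rule nn_integral_count_space_finite) simp
    also have "\<dots> = (\<integral>\<^sup>+\<omega>. ennreal (1 / E \<omega>) * h (Y \<omega>) \<partial>Q) + ennreal b * h 1 + ennreal a * h 0"
      by (simp add: UNIV_option_conv UNIV_bool w_def f_def emeasure_space_1 inj_def add_ac)
    finally show ?thesis .
  qed
  have em: "emeasure \<nu> A = (\<integral>\<^sup>+\<omega>. ennreal (1 / E \<omega>) * indicator A (Y \<omega>) \<partial>Q)
      + ennreal b * indicator A 1 + ennreal a * indicator A 0" if "A \<in> sets borel" for A
  proof -
    have "emeasure \<nu> A = (\<integral>\<^sup>+x. indicator A x \<partial>\<nu>)" using that by (simp add: \<nu>_def)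
    then show ?thesis using nu[of "indicator A"] that by simp
  qed
  have nn1: "(\<integral>\<^sup>+\<omega>. ennreal (1 / E \<omega>) \<partial>Q) = ennreal m"
    unfolding m_def using E0 by (intro nn_integral_eq_integral int1) auto
  have sets_nu: "sets \<nu> = sets borel" by (simp add: \<nu>_def)
  have prob: "prob_space \<nu>"
  proof (rule prob_spaceI)
    have "space \<nu> = UNIV" by (simp add: \<nu>_def)
    then have "emeasure \<nu> (space \<nu>) = ennreal m + ennreal b + ennreal a"
      using em[of UNIV] nn1 by simp
    also have "\<dots> = ennreal (m + b + a)" using m a b by simp
    finally show "emeasure \<nu> (space \<nu>) = 1" by (simp add: a_def)
  qed
  have supp: "AE x in \<nu>. x \<in> {0..1}"
  proof (rule AE_I)
    show "{x \<in> space \<nu>. x \<notin> {0..1}} \<subseteq> - {0..1}" by auto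
    show "- {0..1} \<in> sets \<nu>" by (simp add: sets_nu)
    have "(\<integral>\<^sup>+\<omega>. ennreal (1 / E \<omega>) * indicator (- {0..1}) (Y \<omega>) \<partial>Q) = (\<integral>\<^sup>+\<omega>. 0 \<partial>Q)"
      by (rule nn_integral_cong) (use Y in \<open>auto simp: indicator_def\<close>)
    then show "emeasure \<nu> (- {0..1}) = 0" by (simp add: em)
  qed
  have mean: "(\<integral>x. x \<partial>\<nu>) = \<mu>0"
  proof -
    have "(\<integral>x. x \<partial>\<nu>) = enn2real (\<integral>\<^sup>+x. ennreal x \<partial>\<nu>)"
      by (rule integral_eq_nn_integral) (use supp in \<open>auto simp: \<nu>_def elim!: eventually_mono\<close>)
    also have "(\<integral>\<^sup>+x. ennreal x \<partial>\<nu>) = (\<integral>\<^sup>+\<omega>. ennreal (1 / E \<omega>) * ennreal (Y \<omega>) \<partial>Q) + ennreal b"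
      by (simp add: nu)
    also have "(\<integral>\<^sup>+\<omega>. ennreal (1 / E \<omega>) * ennreal (Y \<omega>) \<partial>Q) = (\<integral>\<^sup>+\<omega>. ennreal (Y \<omega> / E \<omega>) \<partial>Q)"
      by (rule nn_integral_cong) (use Y E0 in \<open>simp flip: ennreal_mult\<close>)
    also have "\<dots> = ennreal y"
      unfolding y_def using E0 Y by (intro nn_integral_eq_integral intY) auto
    also have "ennreal y + ennreal b = ennreal \<mu>0" using y b by (simp add: b_def flip: ennreal_plus)
    finally show ?thesis using \<mu>0 by simp
  qed
  have dens: "distr Q borel (X 1) = density \<nu> (\<lambda>x. ennreal (payoff \<mu>0 gs x))"
  proof (rule measure_eqI)
    fix A assume "A \<in> sets (distr Q borel (X 1))"
    then have A[measurable]: "A \<in> sets borel" by simp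
    have "emeasure (density \<nu> (\<lambda>x. ennreal (payoff \<mu>0 gs x))) A = (\<integral>\<^sup>+x. ennreal (payoff \<mu>0 gs x) * indicator A x \<partial>\<nu>)"
      by (rule emeasure_density) (auto simp: \<nu>_def)
    also have "\<dots> = (\<integral>\<^sup>+\<omega>. ennreal (1 / E \<omega>) * (ennreal (E \<omega>) * indicator A (Y \<omega>)) \<partial>Q)
        + ennreal b * (ennreal (payoff \<mu>0 gs 1) * indicator A 1) + ennreal a * (ennreal (payoff \<mu>0 gs 0) * indicator A 0)"
      by (subst nu) (auto simp: E_def)
    also have "ennreal b * (ennreal (payoff \<mu>0 gs 1) * indicator A 1) = 0"
      using b pay1 b0 by (simp add: mult.assoc[symmetric] flip: ennreal_mult)
    also have "ennreal a * (ennreal (payoff \<mu>0 gs 0) * indicator A 0) = 0"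
      using a pay0 a0 by (simp add: mult.assoc[symmetric] flip: ennreal_mult)
    also have "(\<integral>\<^sup>+\<omega>. ennreal (1 / E \<omega>) * (ennreal (E \<omega>) * indicator A (Y \<omega>)) \<partial>Q) = (\<integral>\<^sup>+\<omega>. indicator A (Y \<omega>) \<partial>Q)"
      by (rule nn_integral_cong_AE) (use E in \<open>auto simp: mult.assoc[symmetric] elim!: eventually_mono simp flip: ennreal_mult\<close>)
    also have "\<dots> = emeasure (distr Q borel Y) A"
    proof -
      have "(\<integral>\<^sup>+\<omega>. indicator A (Y \<omega>) \<partial>Q) = (\<integral>\<^sup>+x. indicator A x \<partial>distr Q borel Y)"
        by (subst nn_integral_distr) auto
      then show ?thesis by simp
    qed
    finally show "emeasure (distr Q borel (X 1)) A = emeasure (density \<nu> (\<lambda>x. ennreal (payoff \<mu>0 gs x))) A"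
      by (simp add: Y_def)
  qed (simp add: sets_nu)
  show ?thesis by (rule that[OF prob sets_nu supp mean dens])
qed

text \<open>
  The payoff of a shrunken bet is a convex combination of the payoff \<open>1\<close> of the zero bet and the
  payoff of \<open>gs\<close>. This bounds it away from \<open>0\<close>, while concavity of the logarithm keeps the
  fraction \<open>s\<close> of the growth.
\<close>

lemma shrunk_payoff:
  assumes gs: "gs \<in> bet_range \<mu>0" and x: "x \<in> {0..1}" and l: "0 < s" "s < 1"
  shows "1 - s \<le> payoff \<mu>0 (s * gs) x"
    and "0 < payoff \<mu>0 gs x \<Longrightarrow> s * ln (payoff \<mu>0 gs x) \<le> ln (payoff \<mu>0 (s * gs) x)"
proof -
  have e: "payoff \<mu>0 (s * gs) x = (1 - s) + s * payoff \<mu>0 gs x"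
    by (simp add: payoff_def algebra_simps)
  show "1 - s \<le> payoff \<mu>0 (s * gs) x"
    unfolding e using payoff_bounds(1)[OF gs x] l by simp
  assume p: "0 < payoff \<mu>0 gs x"
  have "(1 - s) * ln 1 + s * ln (payoff \<mu>0 gs x) \<le> ln ((1 - s) *\<^sub>R 1 + s *\<^sub>R payoff \<mu>0 gs x)"
    using concave_onD[OF ln_concave, of s 1 "payoff \<mu>0 gs x"] p l by simp
  then show "s * ln (payoff \<mu>0 gs x) \<le> ln (payoff \<mu>0 (s * gs) x)" by (simp add: e)
qed

end

section \<open>Supermartingales, stopping and the wealth process\<close>

context unit_iid begin

text \<open>
  The supermartingale inequality integrated over the events of the past. In this form it is
  transported by a change of measure and by stopping without conditional expectations. Time
  starts at \<open>0\<close>.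
\<close>

definition set_supermartingale :: "(nat \<Rightarrow> 'a \<Rightarrow> ennreal) \<Rightarrow> bool" where
  "set_supermartingale V \<longleftrightarrow> (\<forall>n. V n \<in> borel_measurable (nat_filtration M X n)) \<and>
     (\<forall>n. \<forall>A\<in>sets (nat_filtration M X n).
        (\<integral>\<^sup>+\<omega>. V (Suc n) \<omega> * indicator A \<omega> \<partial>P) \<le> (\<integral>\<^sup>+\<omega>. V n \<omega> * indicator A \<omega> \<partial>P))"

lemma set_supermartingaleD:
  assumes "set_supermartingale V"
  shows "V n \<in> borel_measurable (nat_filtration M X n)" "V n \<in> borel_measurable P"
    and "A \<in> sets (nat_filtration M X n) \<Longrightarrow>
      (\<integral>\<^sup>+\<omega>. V (Suc n) \<omega> * indicator A \<omega> \<partial>P) \<le> (\<integral>\<^sup>+\<omega>. V n \<omega> * indicator A \<omega> \<partial>P)"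
  using assms measurable_filtration_P[of "V n" n borel] by (auto simp: set_supermartingale_def)

lemma sets_filtration_0: "sets (nat_filtration M X 0) = {{}, space M}"
  unfolding sets_filtration by (simp add: sigma_sets_empty_eq)

lemma finite_measure_subalgebra_filtration: "finite_measure_subalgebra P (nat_filtration M X n)"
  by unfold_locales (rule subalgebra_filtration)

text \<open>
  With value \<open>1\<close> at time \<open>0\<close>, the bound on the first expectation becomes the supermartingale
  inequality over the trivial sigma-algebra.
\<close>

lemma test_supermartingale_imp_set:
  assumes "test_supermartingale M X P S"
  shows "set_supermartingale (\<lambda>n \<omega>. if n = 0 then 1 else ennreal (S n \<omega>))"
  unfolding set_supermartingale_def
proof (intro conjI allI ballI)
  have adapted: "S n \<in> borel_measurable (nat_filtration M X n)" if "1 \<le> n" for n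
    using assms that by (auto simp: test_supermartingale_def nonneg_adapted_def)
  show "(\<lambda>\<omega>. if n = 0 then 1 else ennreal (S n \<omega>)) \<in> borel_measurable (nat_filtration M X n)" for n
    using adapted[of n] by (cases "n = 0") auto
  fix n A assume A: "A \<in> sets (nat_filtration M X n)"
  show "(\<integral>\<^sup>+\<omega>. (if Suc n = 0 then 1 else ennreal (S (Suc n) \<omega>)) * indicator A \<omega> \<partial>P)
    \<le> (\<integral>\<^sup>+\<omega>. (if n = 0 then 1 else ennreal (S n \<omega>)) * indicator A \<omega> \<partial>P)"
  proof (cases "n = 0")
    case True
    then consider "A = {}" | "A = space P" using A sets_filtration_0 by (auto simp: space_P)
    then show ?thesis
    proof cases
      case 2
      have "(\<integral>\<^sup>+\<omega>. ennreal (S (Suc 0) \<omega>) * indicator A \<omega> \<partial>P) = (\<integral>\<^sup>+\<omega>. ennreal (S 1 \<omega>) \<partial>P)"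
        by (intro nn_integral_cong) (simp add: 2)
      also have "\<dots> \<le> 1" using assms by (simp add: test_supermartingale_def)
      finally show ?thesis using 2 True by (simp add: emeasure_space_1)
    qed simp
  next
    case False
    interpret F: finite_measure_subalgebra P "nat_filtration M X n"
      by (rule finite_measure_subalgebra_filtration)
    have S: "(\<lambda>\<omega>. ennreal (S (Suc n) \<omega>)) \<in> borel_measurable P"
      using measurable_filtration_P[OF adapted[of "Suc n"]] by simp
    have le: "AE \<omega> in P. nn_cond_exp P (nat_filtration M X n) (\<lambda>\<omega>'. ennreal (S (Suc n) \<omega>')) \<omega> \<le> ennreal (S n \<omega>)"
      using assms False unfolding test_supermartingale_def
      by (auto dest!: spec[of _ "Suc n"])
    have "(\<integral>\<^sup>+\<omega>. ennreal (S (Suc n) \<omega>) * indicator A \<omega> \<partial>P)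
        = (\<integral>\<^sup>+\<omega>. indicator A \<omega> * ennreal (S (Suc n) \<omega>) \<partial>P)" by (simp add: mult.commute)
    also have "\<dots> = (\<integral>\<^sup>+\<omega>. indicator A \<omega> * nn_cond_exp P (nat_filtration M X n) (\<lambda>\<omega>'. ennreal (S (Suc n) \<omega>')) \<omega> \<partial>P)"
      using A S by (intro F.nn_cond_exp_intg[symmetric]) auto
    also have "\<dots> \<le> (\<integral>\<^sup>+\<omega>. ennreal (S n \<omega>) * indicator A \<omega> \<partial>P)"
      by (rule nn_integral_mono_AE) (use le in \<open>auto elim!: eventually_mono simp: indicator_def\<close>)
    finally show ?thesis using False by simp
  qed
qed

lemma set_supermartingale_decreasing:
  assumes "set_supermartingale V"
  shows "(\<integral>\<^sup>+\<omega>. V n \<omega> \<partial>P) \<le> (\<integral>\<^sup>+\<omega>. V 0 \<omega> \<partial>P)"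
proof (induction n)
  case (Suc n)
  have "(\<integral>\<^sup>+\<omega>. V (Suc n) \<omega> * indicator (space M) \<omega> \<partial>P) \<le> (\<integral>\<^sup>+\<omega>. V n \<omega> * indicator (space M) \<omega> \<partial>P)"
    using set_supermartingaleD(3)[OF assms] sets.top[of "nat_filtration M X n"] by simp
  moreover have "(\<integral>\<^sup>+\<omega>. V k \<omega> * indicator (space M) \<omega> \<partial>P) = (\<integral>\<^sup>+\<omega>. V k \<omega> \<partial>P)" for k
    by (intro nn_integral_cong) (simp add: space_P)
  ultimately show ?case using Suc by simp
qed simp

text \<open>
  Mixing a supermartingale with a constant keeps it away from \<open>0\<close>, so that its logarithm is
  bounded below.
\<close>

lemma mixture_supermartingale:
  assumes "set_supermartingale V" "0 \<le> a" "0 \<le> b"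
  shows "set_supermartingale (\<lambda>n \<omega>. ennreal a * V n \<omega> + ennreal b)"
  unfolding set_supermartingale_def
proof (intro conjI allI ballI)
  note V = set_supermartingaleD[OF assms(1)]
  show "(\<lambda>\<omega>. ennreal a * V n \<omega> + ennreal b) \<in> borel_measurable (nat_filtration M X n)" for n
    using V(1)[of n] by measurable
  fix n A assume A: "A \<in> sets (nat_filtration M X n)"
  note [measurable] = V(2) sets_filtration_P[OF A]
  have eq: "(\<integral>\<^sup>+\<omega>. (ennreal a * V k \<omega> + ennreal b) * indicator A \<omega> \<partial>P)
      = ennreal a * (\<integral>\<^sup>+\<omega>. V k \<omega> * indicator A \<omega> \<partial>P) + ennreal b * emeasure P A" for k
  proof -
    have "(\<integral>\<^sup>+\<omega>. (ennreal a * V k \<omega> + ennreal b) * indicator A \<omega> \<partial>P)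
      = (\<integral>\<^sup>+\<omega>. ennreal a * (V k \<omega> * indicator A \<omega>) + ennreal b * indicator A \<omega> \<partial>P)"
      by (intro nn_integral_cong) (simp add: algebra_simps)
    then show ?thesis by (simp add: nn_integral_add nn_integral_cmult)
  qed
  show "(\<integral>\<^sup>+\<omega>. (ennreal a * V (Suc n) \<omega> + ennreal b) * indicator A \<omega> \<partial>P)
      \<le> (\<integral>\<^sup>+\<omega>. (ennreal a * V n \<omega> + ennreal b) * indicator A \<omega> \<partial>P)"
    unfolding eq using V(3)[OF A] by (intro add_right_mono mult_left_mono) auto
qed

text \<open>
  For a decreasing sequence of events this is the minimum of \<open>n\<close> and the first \<open>k\<close> with
  \<open>\<omega> \<notin> B k\<close>.
\<close>

fun stopped_index :: "(nat \<Rightarrow> 'a set) \<Rightarrow> nat \<Rightarrow> 'a \<Rightarrow> nat" where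
  "stopped_index B 0 \<omega> = 0"
| "stopped_index B (Suc n) \<omega> = (if \<omega> \<in> B n then Suc n else stopped_index B n \<omega>)"

lemma stopped_index_eq:
  assumes "\<And>n. B (Suc n) \<subseteq> B n" "\<omega> \<in> B n"
  shows "stopped_index B n \<omega> = n"
  using assms by (cases n) auto

text \<open>
  Between the times \<open>n\<close> and \<open>n + 1\<close> the stopped process changes only on \<open>B n\<close>, an event of the
  past, where the supermartingale inequality applies.
\<close>

lemma optional_stopping:
  assumes V: "set_supermartingale V"
    and B: "\<And>n. B n \<in> sets (nat_filtration M X n)" and dec: "\<And>n. B (Suc n) \<subseteq> B n"
  shows "(\<integral>\<^sup>+\<omega>. V (stopped_index B n \<omega>) \<omega> \<partial>P) \<le> (\<integral>\<^sup>+\<omega>. V 0 \<omega> \<partial>P)"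
proof -
  have [measurable]: "V k \<in> borel_measurable P" "B k \<in> sets P" for k
    using set_supermartingaleD(2)[OF V] sets_filtration_P[OF B] by auto
  have meas: "(\<lambda>\<omega>. V (stopped_index B n \<omega>) \<omega>) \<in> borel_measurable P" for n
  proof (induction n)
    case (Suc n)
    note Suc[measurable]
    have "(\<lambda>\<omega>. V (stopped_index B (Suc n) \<omega>) \<omega>) =
        (\<lambda>\<omega>. if \<omega> \<in> B n then V (Suc n) \<omega> else V (stopped_index B n \<omega>) \<omega>)" by auto
    also have "\<dots> \<in> borel_measurable P" by measurable
    finally show ?case .
  qed simp
  note meas[measurable]
  show "(\<integral>\<^sup>+\<omega>. V (stopped_index B n \<omega>) \<omega> \<partial>P) \<le> (\<integral>\<^sup>+\<omega>. V 0 \<omega> \<partial>P)"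
  proof (induction n)
    case (Suc n)
    \<comment> \<open>Since \<open>B\<close> decreases, the process has not been stopped yet on \<open>B n\<close>.\<close>
    let ?C = "space P - B n"
    have "(\<integral>\<^sup>+\<omega>. V (stopped_index B (Suc n) \<omega>) \<omega> \<partial>P)
        = (\<integral>\<^sup>+\<omega>. V (Suc n) \<omega> * indicator (B n) \<omega> + V (stopped_index B n \<omega>) \<omega> * indicator ?C \<omega> \<partial>P)"
      by (intro nn_integral_cong) (auto simp: indicator_def)
    also have "\<dots> = (\<integral>\<^sup>+\<omega>. V (Suc n) \<omega> * indicator (B n) \<omega> \<partial>P) + (\<integral>\<^sup>+\<omega>. V (stopped_index B n \<omega>) \<omega> * indicator ?C \<omega> \<partial>P)"
      by (rule nn_integral_add) auto
    also have "\<dots> \<le> (\<integral>\<^sup>+\<omega>. V n \<omega> * indicator (B n) \<omega> \<partial>P) + (\<integral>\<^sup>+\<omega>. V (stopped_index B n \<omega>) \<omega> * indicator ?C \<omega> \<partial>P)"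
      by (intro add_right_mono set_supermartingaleD(3)[OF V] B)
    also have "\<dots> = (\<integral>\<^sup>+\<omega>. V n \<omega> * indicator (B n) \<omega> + V (stopped_index B n \<omega>) \<omega> * indicator ?C \<omega> \<partial>P)"
      by (rule nn_integral_add[symmetric]) auto
    also have "\<dots> = (\<integral>\<^sup>+\<omega>. V (stopped_index B n \<omega>) \<omega> \<partial>P)"
      by (intro nn_integral_cong) (auto simp: indicator_def stopped_index_eq[of B, OF dec])
    also note Suc
    finally show ?case .
  qed simp
qed

end

lemma wealth_0: "wealth X \<mu>0 \<gamma> 0 \<omega> = 1"
  by (simp add: wealth_def)

lemma wealth_Suc: "wealth X \<mu>0 \<gamma> (Suc n) \<omega> = wealth X \<mu>0 \<gamma> n \<omega> * payoff \<mu>0 (\<gamma> (Suc n) \<omega>) (X (Suc n) \<omega>)"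
  by (simp add: wealth_def payoff_def)

context unit_betting begin

lemma wealth_bounds:
  assumes range: "\<forall>n\<ge>1. \<forall>\<omega>\<in>space M. \<gamma> n \<omega> \<in> bet_range \<mu>0" and w: "\<omega> \<in> space M"
  shows "0 \<le> wealth X \<mu>0 \<gamma> n \<omega> \<and> wealth X \<mu>0 \<gamma> n \<omega> \<le> exp cap ^ n"
proof (induction n)
  case (Suc n)
  have "0 \<le> payoff \<mu>0 (\<gamma> (Suc n) \<omega>) (X (Suc n) \<omega>)" "payoff \<mu>0 (\<gamma> (Suc n) \<omega>) (X (Suc n) \<omega>) \<le> exp cap"
    using payoff_bounds[of "\<gamma> (Suc n) \<omega>" "X (Suc n) \<omega>"] range X_range[of "Suc n" \<omega>] w by auto
  then show ?case using Suc mult_mono[of "wealth X \<mu>0 \<gamma> n \<omega>" "exp cap ^ n" "payoff \<mu>0 (\<gamma> (Suc n) \<omega>) (X (Suc n) \<omega>)" "exp cap"]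
    by (auto simp: wealth_Suc mult_ac)
qed (simp add: wealth_0)

lemma wealth_adapted:
  assumes pred: "predictable M X \<gamma>"
  shows "wealth X \<mu>0 \<gamma> n \<in> borel_measurable (nat_filtration M X n)"
proof (induction n)
  case 0
  have "wealth X \<mu>0 \<gamma> 0 = (\<lambda>_. 1)" by (rule ext) (rule wealth_0)
  then show ?case by simp
next
  case (Suc n)
  have "wealth X \<mu>0 \<gamma> n \<in> borel_measurable (nat_filtration M X (Suc n))"
    using Suc by (rule measurable_filtration_mono) simp
  moreover have "\<gamma> (Suc n) \<in> borel_measurable (nat_filtration M X (Suc n))"
    using pred by (rule_tac measurable_filtration_mono[of _ n]) (auto simp: predictable_def)
  moreover have "X (Suc n) \<in> borel_measurable (nat_filtration M X (Suc n))"
    by (rule X_adapted) auto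
  ultimately have "(\<lambda>\<omega>. wealth X \<mu>0 \<gamma> n \<omega> * payoff \<mu>0 (\<gamma> (Suc n) \<omega>) (X (Suc n) \<omega>))
      \<in> borel_measurable (nat_filtration M X (Suc n))"
    unfolding payoff_def by measurable
  moreover have "wealth X \<mu>0 \<gamma> (Suc n) = (\<lambda>\<omega>. wealth X \<mu>0 \<gamma> n \<omega> * payoff \<mu>0 (\<gamma> (Suc n) \<omega>) (X (Suc n) \<omega>))"
    by (rule ext) (rule wealth_Suc)
  ultimately show ?case by simp
qed

text \<open>
  The gain of a round is a product of \<open>X (Suc n) - \<mu>0\<close>, which is centred under the null, and a
  bounded stake that is known at time \<open>n\<close>.
\<close>

lemma wealth_fair:
  assumes pred: "predictable M X \<gamma>"
    and range: "\<forall>n\<ge>1. \<forall>\<omega>\<in>space M. \<gamma> n \<omega> \<in> bet_range \<mu>0"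
    and mean: "(\<integral>\<omega>. X 1 \<omega> \<partial>Q) = \<mu>0"
    and A: "A \<in> sets (nat_filtration M X n)"
  shows "(\<integral>\<^sup>+\<omega>. ennreal (wealth X \<mu>0 \<gamma> (Suc n) \<omega>) * indicator A \<omega> \<partial>Q)
       = (\<integral>\<^sup>+\<omega>. ennreal (wealth X \<mu>0 \<gamma> n \<omega>) * indicator A \<omega> \<partial>Q)"
proof -
  let ?W = "wealth X \<mu>0 \<gamma>"
  have W[measurable]: "?W k \<in> borel_measurable Q" for k
    by (rule measurable_filtration_P[OF wealth_adapted[OF pred]])
  have A'[measurable]: "A \<in> sets Q" using A by (rule sets_filtration_P)
  have int_W: "integrable Q (\<lambda>\<omega>. ?W k \<omega> * indicator A \<omega>)" for k
    by (rule integrable_const_bound[where B = "exp cap ^ k"])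
      (use wealth_bounds[OF range, of _ k] in \<open>auto simp: space_P indicator_def\<close>)
  have nn: "(\<integral>\<^sup>+\<omega>. ennreal (?W k \<omega>) * indicator A \<omega> \<partial>Q) = ennreal (\<integral>\<omega>. ?W k \<omega> * indicator A \<omega> \<partial>Q)" for k
  proof -
    have "(\<integral>\<^sup>+\<omega>. ennreal (?W k \<omega>) * indicator A \<omega> \<partial>Q) = (\<integral>\<^sup>+\<omega>. ennreal (?W k \<omega> * indicator A \<omega>) \<partial>Q)"
      by (intro nn_integral_cong) (auto simp: indicator_def)
    also have "\<dots> = ennreal (\<integral>\<omega>. ?W k \<omega> * indicator A \<omega> \<partial>Q)"
      using wealth_bounds[OF range, of _ k] by (intro nn_integral_eq_integral int_W) (auto simp: space_P)
    finally show ?thesis .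
  qed
  let ?Z = "\<lambda>\<omega>. ?W n \<omega> * indicator A \<omega> * \<gamma> (Suc n) \<omega>"
  have \<gamma>: "\<gamma> (Suc n) \<in> borel_measurable (nat_filtration M X n)"
    using pred by (auto simp: predictable_def)
  have Z: "?Z \<in> borel_measurable (nat_filtration M X n)"
    using wealth_adapted[OF pred, of n] \<gamma> A by measurable
  have int_Z: "integrable Q ?Z"
  proof (rule Bochner_Integration.integrable_bound)
    let ?K = "1 / \<mu>0 + 1 / (1 - \<mu>0)"
    show "integrable Q (\<lambda>\<omega>. ?K * (?W n \<omega> * indicator A \<omega>))" using int_W by auto
    show "?Z \<in> borel_measurable Q" using Z by (rule measurable_filtration_P)
    show "AE \<omega> in Q. norm (?Z \<omega>) \<le> norm (?K * (?W n \<omega> * indicator A \<omega>))"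
    proof (rule AE_I2)
      fix \<omega> assume "\<omega> \<in> space Q"
      then have "\<gamma> (Suc n) \<omega> \<in> bet_range \<mu>0" using range by (auto simp: space_P)
      then have "- (1 / (1 - \<mu>0)) \<le> \<gamma> (Suc n) \<omega>" "\<gamma> (Suc n) \<omega> \<le> 1 / \<mu>0"
        by (auto simp: bet_range_def)
      moreover have "0 < 1 / \<mu>0" "0 < 1 / (1 - \<mu>0)" using \<mu>0 by auto
      ultimately have "\<bar>\<gamma> (Suc n) \<omega>\<bar> \<le> \<bar>?K\<bar>" by linarith
      then have "\<bar>\<gamma> (Suc n) \<omega>\<bar> * \<bar>?W n \<omega> * indicator A \<omega>\<bar> \<le> \<bar>?K\<bar> * \<bar>?W n \<omega> * indicator A \<omega>\<bar>"
        by (rule mult_right_mono) simp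
      then show "norm (?Z \<omega>) \<le> norm (?K * (?W n \<omega> * indicator A \<omega>))"
        unfolding real_norm_def abs_mult by (simp only: mult_ac)
    qed
  qed
  have X: "X 1 \<omega> \<in> {0..1}" if "\<omega> \<in> space Q" for \<omega> using that X_range[of 1] by (simp add: space_P)
  have intX: "integrable Q (X 1)" by (rule integrable_const_bound[of _ 1]) (use X in auto)
  have "(\<integral>\<omega>. ?Z \<omega> * (X (Suc n) \<omega> - \<mu>0) \<partial>Q) = (\<integral>\<omega>. ?Z \<omega> \<partial>Q) * (\<integral>\<omega>. X 1 \<omega> - \<mu>0 \<partial>Q)"
    by (rule integral_mult_next(1)[OF Z int_Z, where f = "\<lambda>x. x - \<mu>0"]) (use intX in auto)
  also have "(\<integral>\<omega>. X 1 \<omega> - \<mu>0 \<partial>Q) = 0" using intX mean by (simp add: prob_space)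
  finally have zero: "(\<integral>\<omega>. ?Z \<omega> * (X (Suc n) \<omega> - \<mu>0) \<partial>Q) = 0" by simp
  have int_ZX: "integrable Q (\<lambda>\<omega>. ?Z \<omega> * (X (Suc n) \<omega> - \<mu>0))"
    by (rule integral_mult_next(2)[OF Z int_Z, where f = "\<lambda>x. x - \<mu>0"]) (use intX in auto)
  have "(\<integral>\<omega>. ?W (Suc n) \<omega> * indicator A \<omega> \<partial>Q)
      = (\<integral>\<omega>. ?W n \<omega> * indicator A \<omega> + ?Z \<omega> * (X (Suc n) \<omega> - \<mu>0) \<partial>Q)"
    by (rule Bochner_Integration.integral_cong) (auto simp: wealth_Suc payoff_def algebra_simps)
  also have "\<dots> = (\<integral>\<omega>. ?W n \<omega> * indicator A \<omega> \<partial>Q)"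
    using zero by (subst Bochner_Integration.integral_add[OF int_W int_ZX]) simp
  finally show ?thesis unfolding nn by simp
qed

lemma wealth_test_supermartingale:
  assumes pred: "predictable M X \<gamma>"
    and range: "\<forall>n\<ge>1. \<forall>\<omega>\<in>space M. \<gamma> n \<omega> \<in> bet_range \<mu>0"
    and mean: "(\<integral>\<omega>. X 1 \<omega> \<partial>Q) = \<mu>0"
  shows "test_supermartingale M X Q (wealth X \<mu>0 \<gamma>)"
  unfolding test_supermartingale_def
proof (intro conjI allI impI)
  show "nonneg_adapted M X (wealth X \<mu>0 \<gamma>)"
    using wealth_adapted[OF pred] wealth_bounds[OF range] by (auto simp: nonneg_adapted_def)
  have "(\<integral>\<^sup>+\<omega>. ennreal (wealth X \<mu>0 \<gamma> 1 \<omega>) \<partial>Q) = (\<integral>\<^sup>+\<omega>. ennreal (wealth X \<mu>0 \<gamma> (Suc 0) \<omega>) * indicator (space M) \<omega> \<partial>Q)"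
    by (intro nn_integral_cong) (simp add: space_P)
  also have "\<dots> = (\<integral>\<^sup>+\<omega>. ennreal (wealth X \<mu>0 \<gamma> 0 \<omega>) * indicator (space M) \<omega> \<partial>Q)"
    by (rule wealth_fair[OF assms]) (use sets.top[of "nat_filtration M X 0"] in simp)
  also have "\<dots> = 1" by (simp add: wealth_0 space_P[symmetric] emeasure_space_1)
  finally show "(\<integral>\<^sup>+\<omega>. ennreal (wealth X \<mu>0 \<gamma> 1 \<omega>) \<partial>Q) \<le> 1" by simp
  fix n :: nat assume "2 \<le> n"
  then obtain k where k: "n = Suc k" by (cases n) auto
  interpret F: finite_measure_subalgebra Q "nat_filtration M X k"
    by (rule finite_measure_subalgebra_filtration)
  have "AE \<omega> in Q. ennreal (wealth X \<mu>0 \<gamma> k \<omega>) = nn_cond_exp Q (nat_filtration M X k) (\<lambda>\<omega>'. ennreal (wealth X \<mu>0 \<gamma> (Suc k) \<omega>')) \<omega>"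
  proof (rule F.nn_cond_exp_charact)
    show "(\<lambda>\<omega>'. ennreal (wealth X \<mu>0 \<gamma> (Suc k) \<omega>')) \<in> borel_measurable Q"
      using measurable_filtration_P[OF wealth_adapted[OF pred]] by simp
    show "(\<lambda>\<omega>'. ennreal (wealth X \<mu>0 \<gamma> k \<omega>')) \<in> borel_measurable (nat_filtration M X k)"
      using wealth_adapted[OF pred] by simp
  qed (rule wealth_fair[OF assms])
  then show "AE \<omega> in Q. nn_cond_exp Q (nat_filtration M X (n - 1)) (\<lambda>\<omega>'. ennreal (wealth X \<mu>0 \<gamma> n \<omega>')) \<omega>
      \<le> ennreal (wealth X \<mu>0 \<gamma> (n - 1) \<omega>)"
    unfolding k by (auto elim!: eventually_mono)
qed

end

section \<open>Crossing times\<close>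

text \<open>
  The event that the crossing time exceeds \<open>n\<close>, see \<open>less_crossing_time_iff\<close>.
\<close>

definition uncrossed :: "'a measure \<Rightarrow> (nat \<Rightarrow> 'a \<Rightarrow> real) \<Rightarrow> real \<Rightarrow> nat \<Rightarrow> 'a set" where
  "uncrossed M W \<alpha> n = {\<omega> \<in> space M. \<forall>k\<in>{1..n}. W k \<omega> < 1 / \<alpha>}"

lemma uncrossed_0 [simp]: "uncrossed M W \<alpha> 0 = space M"
  by (auto simp: uncrossed_def)

lemma uncrossed_Suc: "\<omega> \<in> uncrossed M W \<alpha> (Suc n) \<longleftrightarrow> \<omega> \<in> uncrossed M W \<alpha> n \<and> W (Suc n) \<omega> < 1 / \<alpha>"
  by (auto simp: uncrossed_def atLeastAtMostSuc_conv)

lemma uncrossed_decreasing: "uncrossed M W \<alpha> (Suc n) \<subseteq> uncrossed M W \<alpha> n"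
  by (auto simp: uncrossed_Suc)

lemma less_crossing_time_iff: "enat n < crossing_time W \<alpha> \<omega> \<longleftrightarrow> (\<forall>k\<in>{1..n}. W k \<omega> < 1 / \<alpha>)"
proof -
  have "crossing_time W \<alpha> \<omega> \<le> enat n \<longleftrightarrow> (\<exists>k\<in>{1..n}. 1 / \<alpha> \<le> W k \<omega>)"
  proof
    assume "crossing_time W \<alpha> \<omega> \<le> enat n"
    then have "crossing_time W \<alpha> \<omega> < enat (Suc n)" by (simp add: order_le_less_trans)
    then show "\<exists>k\<in>{1..n}. 1 / \<alpha> \<le> W k \<omega>"
      unfolding crossing_time_def by (auto simp: INF_less_iff)
  next
    assume "\<exists>k\<in>{1..n}. 1 / \<alpha> \<le> W k \<omega>"
    then obtain k where k: "1 \<le> k" "k \<le> n" "1 / \<alpha> \<le> W k \<omega>" by auto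
    then have "crossing_time W \<alpha> \<omega> \<le> enat k"
      unfolding crossing_time_def by (intro INF_lower) auto
    also have "\<dots> \<le> enat n" using k by simp
    finally show "crossing_time W \<alpha> \<omega> \<le> enat n" .
  qed
  then show ?thesis by (auto simp flip: not_le)
qed

context unit_iid begin

lemma uncrossed_sets:
  assumes "\<And>k. 1 \<le> k \<Longrightarrow> W k \<in> borel_measurable (nat_filtration M X k)"
  shows "uncrossed M W \<alpha> n \<in> sets (nat_filtration M X n)"
proof -
  have "uncrossed M W \<alpha> n = {\<omega> \<in> space (nat_filtration M X n). \<forall>k\<in>{1..n}. W k \<omega> < 1 / \<alpha>}"
    by (simp add: uncrossed_def)
  also have "\<dots> \<in> sets (nat_filtration M X n)"
  proof (rule sets.sets_Collect_finite_All)
    fix k assume "k \<in> {1..n}"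
    then have "W k \<in> borel_measurable (nat_filtration M X n)"
      using assms measurable_filtration_mono[of "W k" k borel n] by auto
    then show "{\<omega> \<in> space (nat_filtration M X n). W k \<omega> < 1 / \<alpha>} \<in> sets (nat_filtration M X n)"
      by measurable
  qed simp
  finally show ?thesis .
qed

text \<open>
  The expectation of a random time with values in the extended natural numbers is the sum of its
  tail probabilities.
\<close>

lemma expected_crossing_time_eq:
  assumes W: "\<And>k. 1 \<le> k \<Longrightarrow> W k \<in> borel_measurable (nat_filtration M X k)"
  shows "expected_crossing_time P W \<alpha> = enn2ereal (\<Sum>n. emeasure P (uncrossed M W \<alpha> n))"
proof -
  have un: "{\<omega> \<in> space P. enat n < crossing_time W \<alpha> \<omega>} = uncrossed M W \<alpha> n" for n
    by (auto simp: less_crossing_time_iff uncrossed_def space_P)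
  have [measurable]: "uncrossed M W \<alpha> n \<in> sets P" for n
    by (rule sets_filtration_P[OF uncrossed_sets[OF W]])
  have "ennreal_of_enat (crossing_time W \<alpha> \<omega>) = (\<Sum>n. indicator (uncrossed M W \<alpha> n) \<omega>)"
    if \<omega>: "\<omega> \<in> space P" for \<omega>
  proof -
    have ind: "indicator (uncrossed M W \<alpha> n) \<omega> = (if enat n < crossing_time W \<alpha> \<omega> then 1 else 0 :: ennreal)" for n
      using un[of n] \<omega> by (auto simp: indicator_def)
    show ?thesis
    proof (cases "crossing_time W \<alpha> \<omega>")
      case (enat m)
      have "(\<Sum>n. indicator (uncrossed M W \<alpha> n) \<omega>) = (\<Sum>n<m. indicator (uncrossed M W \<alpha> n) \<omega> :: ennreal)"
        by (rule suminf_finite) (auto simp: ind enat)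
      then show ?thesis by (simp add: ind enat)
    next
      case infinity
      have "(\<Sum>n. indicator (uncrossed M W \<alpha> n) \<omega>) = (\<Sum>n. ennreal 1)" by (simp add: ind infinity)
      also have "\<dots> = top" by (rule summable_iff_suminf_neq_top) (auto simp: summable_const_iff)
      finally show ?thesis by (simp add: infinity)
    qed
  qed
  then have "(\<integral>\<^sup>+\<omega>. ennreal_of_enat (crossing_time W \<alpha> \<omega>) \<partial>P) = (\<integral>\<^sup>+\<omega>. (\<Sum>n. indicator (uncrossed M W \<alpha> n) \<omega>) \<partial>P)"
    by (intro nn_integral_cong) simp
  also have "\<dots> = (\<Sum>n. emeasure P (uncrossed M W \<alpha> n))"
    by (subst nn_integral_suminf) auto
  finally show ?thesis by (simp add: expected_crossing_time_def)
qed

text \<open>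
  For the events \<open>B i\<close> that a stopping time exceeds \<open>i\<close>, the integrand on the left is the random walk at
  the stopping time truncated at \<open>N\<close>, and the sum of probabilities is the expected truncated time.
\<close>

lemma wald_identity:
  fixes f :: "real \<Rightarrow> real"
  assumes f: "f \<in> borel_measurable borel" "integrable P (\<lambda>\<omega>. f (X 1 \<omega>))"
    and B: "\<And>i. B i \<in> sets (nat_filtration M X i)"
  shows "(\<integral>\<omega>. (\<Sum>i<N. indicator (B i) \<omega> * f (X (Suc i) \<omega>)) \<partial>P) = (\<integral>\<omega>. f (X 1 \<omega>) \<partial>P) * (\<Sum>i<N. prob (B i))"
    and "integrable P (\<lambda>\<omega>. \<Sum>i<N. indicator (B i) \<omega> * f (X (Suc i) \<omega>))"
proof -
  have Z: "indicator (B i) \<in> borel_measurable (nat_filtration M X i)" "integrable P (indicator (B i) :: _ \<Rightarrow> real)" for i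
    using B[of i] sets_filtration_P[OF B[of i]] by (auto simp: emeasure_eq_measure)
  have int: "integrable P (\<lambda>\<omega>. indicator (B i) \<omega> * f (X (Suc i) \<omega>))" for i
    by (rule integral_mult_next(2)[OF Z f])
  then show "integrable P (\<lambda>\<omega>. \<Sum>i<N. indicator (B i) \<omega> * f (X (Suc i) \<omega>))" by (intro Bochner_Integration.integrable_sum)
  have "(\<integral>\<omega>. (\<Sum>i<N. indicator (B i) \<omega> * f (X (Suc i) \<omega>)) \<partial>P) = (\<Sum>i<N. \<integral>\<omega>. indicator (B i) \<omega> * f (X (Suc i) \<omega>) \<partial>P)"
    using int by (intro Bochner_Integration.integral_sum)
  also have "\<dots> = (\<Sum>i<N. prob (B i) * (\<integral>\<omega>. f (X 1 \<omega>) \<partial>P))"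
  proof (rule sum.cong[OF refl])
    fix i
    have "B i \<inter> space P = B i" using sets.sets_into_space[OF sets_filtration_P[OF B[of i]]] by auto
    then have "(\<integral>\<omega>. indicator (B i) \<omega> \<partial>P) = prob (B i)" by simp
    then show "(\<integral>\<omega>. indicator (B i) \<omega> * f (X (Suc i) \<omega>) \<partial>P) = prob (B i) * (\<integral>\<omega>. f (X 1 \<omega>) \<partial>P)"
      using integral_mult_next(1)[OF Z f, of i] by simp
  qed
  finally show "(\<integral>\<omega>. (\<Sum>i<N. indicator (B i) \<omega> * f (X (Suc i) \<omega>)) \<partial>P) = (\<integral>\<omega>. f (X 1 \<omega>) \<partial>P) * (\<Sum>i<N. prob (B i))"
    by (simp add: sum_distrib_left mult.commute)
qed

text \<open>
  As long as the walk has not been stopped it is at most \<open>b\<close>, and the step at which it stops adds at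
  most \<open>C\<close>. Wald's identity turns this bound on the stopped walk into one on the expected time.
\<close>

lemma random_walk_exit_bound:
  fixes f :: "real \<Rightarrow> real"
  assumes f: "f \<in> borel_measurable borel" and C: "\<And>x. x \<in> {0..1} \<Longrightarrow> \<bar>f x\<bar> \<le> C"
    and B: "\<And>i. B i \<in> sets (nat_filtration M X i)" and dec: "\<And>i. B (Suc i) \<subseteq> B i" and b: "0 \<le> b"
    and stay: "\<And>n \<omega>. 1 \<le> n \<Longrightarrow> \<omega> \<in> B n \<Longrightarrow> (\<Sum>i=1..n. f (X i \<omega>)) \<le> b"
  shows "(\<integral>\<omega>. f (X 1 \<omega>) \<partial>P) * (\<Sum>i<N. prob (B i)) \<le> b + C"
proof -
  have X: "X (Suc i) \<omega> \<in> {0..1}" if "\<omega> \<in> space P" for i \<omega> using that X_range[of "Suc i"] by (simp add: space_P)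
  have C0: "0 \<le> C" using C[of 0] by auto
  have int: "integrable P (\<lambda>\<omega>. f (X 1 \<omega>))"
    using X[of _ 0] C f by (intro integrable_const_bound[of _ C]) auto
  let ?T = "\<lambda>N \<omega>. \<Sum>i<N. indicator (B i) \<omega> * f (X (Suc i) \<omega>)"
  have walk: "?T N \<omega> = (\<Sum>i=1..N. f (X i \<omega>))" if "\<omega> \<in> B N" for N \<omega>
    using that
  proof (induction N)
    case (Suc N)
    then have "\<omega> \<in> B N" using dec by auto
    then show ?case using Suc.IH by simp
  qed simp
  have "?T N \<omega> \<le> b + C" if \<omega>: "\<omega> \<in> space P" for N \<omega>
  proof (induction N)
    case (Suc N)
    show ?case
    proof (cases "\<omega> \<in> B N")
      case True
      have "?T N \<omega> \<le> b" using walk[OF True] stay[OF _ True] b by (cases "N = 0") auto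
      moreover have "f (X (Suc N) \<omega>) \<le> C" using C[OF X[OF \<omega>, of N]] by auto
      ultimately show ?thesis using True by simp
    qed (use Suc in simp)
  qed (use b C0 in simp)
  then have "(\<integral>\<omega>. ?T N \<omega> \<partial>P) \<le> (\<integral>\<omega>. b + C \<partial>P)"
    using wald_identity(2)[OF f int B] by (intro integral_mono) auto
  then show ?thesis using wald_identity(1)[OF f int B] by (simp add: prob_space)
qed

lemma stopped_index_uncrossed:
  assumes "\<omega> \<in> space M" "\<omega> \<notin> uncrossed M W \<alpha> N"
  shows "1 \<le> stopped_index (uncrossed M W \<alpha>) N \<omega>"
    and "1 / \<alpha> \<le> W (stopped_index (uncrossed M W \<alpha>) N \<omega>) \<omega>"
  using assms(2)
proof (induction N)
  case (Suc N)
  { case 1 then show ?case using Suc.IH(1) by auto }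
  { case 2 then show ?case using Suc.IH(2) by (auto simp: uncrossed_Suc) }
qed (use assms(1) in auto)

end

section \<open>The likelihood ratio bounds every e-process\<close>

text \<open>
  An alternative \<open>Q\<close> with an optimal bet \<open>gs\<close>, and a null distribution \<open>P\<close> of least favourable form:
  the likelihood ratio of a single observation is the optimal payoff.
\<close>

locale dual_pair = unit_betting Q M X \<mu>0 + null: unit_iid P M X
  for Q :: "'a measure" and M X \<mu>0 and P :: "'a measure" +
  fixes gs :: real
  assumes opt: "log_optimal gs"
    and law: "distr Q borel (X 1) = density (distr P borel (X 1)) (\<lambda>x. ennreal (payoff \<mu>0 gs x))"
begin

text \<open>
  The wealth of the constant bet \<open>gs\<close>, which is also the density of \<open>Q\<close> with respect to \<open>P\<close> on the
  first \<open>n\<close> observations, see \<open>nn_integral_Q\<close>.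
\<close>

definition L :: "nat \<Rightarrow> 'a \<Rightarrow> real" where
  "L n \<omega> = (\<Prod>i=1..n. payoff \<mu>0 gs (X i \<omega>))"

abbreviation growth :: real where
  "growth \<equiv> (\<integral>\<omega>. ln (payoff \<mu>0 gs (X 1 \<omega>)) \<partial>Q)"

lemma L_0 [simp]: "L 0 \<omega> = 1" by (simp add: L_def)

lemma L_Suc: "L (Suc n) \<omega> = L n \<omega> * payoff \<mu>0 gs (X (Suc n) \<omega>)" by (simp add: L_def)

lemma L_nonneg: "\<omega> \<in> space M \<Longrightarrow> 0 \<le> L n \<omega>"
  unfolding L_def using payoff_X_bounds(1)[OF log_optimalD(1)[OF opt]]
  by (intro prod_nonneg) (auto simp: space_P)

lemma L_adapted: "L n \<in> borel_measurable (nat_filtration M X n)"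
  unfolding L_def using X_adapted
  by (auto intro!: borel_measurable_prod measurable_compose[of _ _ borel "payoff \<mu>0 gs"])

lemma payoff_pos: "AE \<omega> in Q. \<forall>n. 0 < payoff \<mu>0 gs (X (Suc n) \<omega>)"
proof -
  have "{x. 0 < payoff \<mu>0 gs x} \<in> sets borel" by measurable
  then have "AE \<omega> in Q. 0 < payoff \<mu>0 gs (X (Suc n) \<omega>)" for n
    using AE_X[of "Suc n" "\<lambda>x. 0 < payoff \<mu>0 gs x"] log_optimal_finite(1)[OF opt] by simp
  then show ?thesis by (simp add: AE_all_countable)
qed

lemma L_pos:
  assumes "\<forall>n. 0 < payoff \<mu>0 gs (X (Suc n) \<omega>)"
  shows "0 < L n \<omega>"
  using assms by (induction n) (auto simp: L_Suc)

lemma ln_L: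
  assumes "\<forall>n. 0 < payoff \<mu>0 gs (X (Suc n) \<omega>)"
  shows "ln (L (Suc n) \<omega>) = ln (L n \<omega>) + ln (payoff \<mu>0 gs (X (Suc n) \<omega>))"
  using L_pos[OF assms, of n] assms by (simp add: L_Suc ln_mult_pos)

lemma nn_integral_Q:
  assumes Z: "Z \<in> borel_measurable (nat_filtration M X n)"
  shows "(\<integral>\<^sup>+\<omega>. Z \<omega> \<partial>Q) = (\<integral>\<^sup>+\<omega>. ennreal (L n \<omega>) * Z \<omega> \<partial>P)"
proof -
  have "(\<integral>\<^sup>+\<omega>. Z \<omega> \<partial>Q) = (\<integral>\<^sup>+\<omega>. (\<Prod>i=1..n. ennreal (payoff \<mu>0 gs (X i \<omega>))) * Z \<omega> \<partial>P)"
    by (rule change_of_measure[OF null.unit_iid_axioms unit_iid_axioms _ law Z]) measurable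
  also have "\<dots> = (\<integral>\<^sup>+\<omega>. ennreal (L n \<omega>) * Z \<omega> \<partial>P)"
  proof (rule nn_integral_cong)
    fix \<omega> assume "\<omega> \<in> space P"
    then have "(\<Prod>i=1..n. ennreal (payoff \<mu>0 gs (X i \<omega>))) = ennreal (L n \<omega>)"
      unfolding L_def using payoff_X_bounds(1)[OF log_optimalD(1)[OF opt]]
      by (intro prod_ennreal) (auto simp: space_P null.space_P)
    then show "(\<Prod>i=1..n. ennreal (payoff \<mu>0 gs (X i \<omega>))) * Z \<omega> = ennreal (L n \<omega>) * Z \<omega>" by simp
  qed
  finally show ?thesis .
qed

text \<open>
  Almost sure statements pass from the null to the alternative, provided that they concern only
  finitely many observations.
\<close>

lemma AE_Q_if_AE_P:
  assumes R: "{\<omega> \<in> space M. \<not> R \<omega>} \<in> sets (nat_filtration M X n)" and AE: "AE \<omega> in P. R \<omega>"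
  shows "AE \<omega> in Q. R \<omega>"
proof (rule AE_I)
  let ?N = "{\<omega> \<in> space M. \<not> R \<omega>}"
  show "{\<omega> \<in> space Q. \<not> R \<omega>} \<subseteq> ?N" by (auto simp: space_P)
  show "?N \<in> sets Q" by (rule sets_filtration_P[OF R])
  have "emeasure Q ?N = (\<integral>\<^sup>+\<omega>. indicator ?N \<omega> \<partial>Q)" using sets_filtration_P[OF R] by simp
  also have "\<dots> = (\<integral>\<^sup>+\<omega>. ennreal (L n \<omega>) * indicator ?N \<omega> \<partial>P)"
    using R by (intro nn_integral_Q) simp
  also have "\<dots> = (\<integral>\<^sup>+\<omega>. 0 \<partial>P)"
    by (rule nn_integral_cong_AE) (use AE in \<open>auto elim!: eventually_mono\<close>)
  finally show "emeasure Q ?N = 0" by simp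
qed

text \<open>
  Integrating \<open>V n / L n\<close> under \<open>Q\<close> amounts to integrating \<open>V n\<close> under \<open>P\<close> over the event that \<open>L n\<close> is
  positive. These events decrease in \<open>n\<close>, so the inequality under \<open>P\<close> carries over.
\<close>

lemma likelihood_ratio_supermartingale:
  assumes V: "null.set_supermartingale V"
  shows "set_supermartingale (\<lambda>n \<omega>. V n \<omega> / ennreal (L n \<omega>))"
  unfolding set_supermartingale_def
proof (intro conjI allI ballI)
  note V_meas = null.set_supermartingaleD(1)[OF V]
  show meas: "(\<lambda>\<omega>. V n \<omega> / ennreal (L n \<omega>)) \<in> borel_measurable (nat_filtration M X n)" for n
    using V_meas[of n] L_adapted[of n] by measurable
  have pos_set: "{\<omega> \<in> space M. 0 < L n \<omega>} \<in> sets (nat_filtration M X n)" for n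
  proof -
    have "{\<omega> \<in> space (nat_filtration M X n). 0 < L n \<omega>} \<in> sets (nat_filtration M X n)"
      using L_adapted[of n] by measurable
    then show ?thesis by simp
  qed
  have eq: "(\<integral>\<^sup>+\<omega>. V n \<omega> / ennreal (L n \<omega>) * indicator A \<omega> \<partial>Q)
      = (\<integral>\<^sup>+\<omega>. V n \<omega> * indicator (A \<inter> {\<omega> \<in> space M. 0 < L n \<omega>}) \<omega> \<partial>P)"
    if A: "A \<in> sets (nat_filtration M X n)" for A n
  proof -
    have "(\<integral>\<^sup>+\<omega>. V n \<omega> / ennreal (L n \<omega>) * indicator A \<omega> \<partial>Q)
      = (\<integral>\<^sup>+\<omega>. ennreal (L n \<omega>) * (V n \<omega> / ennreal (L n \<omega>) * indicator A \<omega>) \<partial>P)"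
    proof (rule nn_integral_Q)
      note [measurable] = V_meas[of n] L_adapted[of n] A
      show "(\<lambda>\<omega>. V n \<omega> / ennreal (L n \<omega>) * indicator A \<omega>) \<in> borel_measurable (nat_filtration M X n)"
        by measurable
    qed
    also have "\<dots> = (\<integral>\<^sup>+\<omega>. V n \<omega> * indicator (A \<inter> {\<omega> \<in> space M. 0 < L n \<omega>}) \<omega> \<partial>P)"
    proof (rule nn_integral_cong)
      fix \<omega> assume "\<omega> \<in> space P"
      then have w: "\<omega> \<in> space M" by (simp add: null.space_P)
      show "ennreal (L n \<omega>) * (V n \<omega> / ennreal (L n \<omega>) * indicator A \<omega>)
          = V n \<omega> * indicator (A \<inter> {\<omega> \<in> space M. 0 < L n \<omega>}) \<omega>"
      proof (cases "0 < L n \<omega>")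
        case True
        then have "V n \<omega> * ennreal (L n \<omega>) / ennreal (L n \<omega>) = V n \<omega>"
          by (intro mult_divide_eq_ennreal) auto
        then show ?thesis using True w
          by (simp add: indicator_def ennreal_times_divide mult.commute)
      qed (use L_nonneg[OF w, of n] in \<open>simp add: ennreal_neg\<close>)
    qed
    finally show ?thesis .
  qed
  fix n A assume A: "A \<in> sets (nat_filtration M X n)"
  let ?A = "A \<inter> {\<omega> \<in> space M. 0 < L n \<omega>}"
  have "(\<integral>\<^sup>+\<omega>. V (Suc n) \<omega> / ennreal (L (Suc n) \<omega>) * indicator A \<omega> \<partial>Q)
      = (\<integral>\<^sup>+\<omega>. V (Suc n) \<omega> * indicator (A \<inter> {\<omega> \<in> space M. 0 < L (Suc n) \<omega>}) \<omega> \<partial>P)"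
    by (rule eq) (rule sets_filtration_mono[OF A], simp)
  also have "\<dots> \<le> (\<integral>\<^sup>+\<omega>. V (Suc n) \<omega> * indicator ?A \<omega> \<partial>P)"
  proof (intro nn_integral_mono mult_left_mono)
    fix \<omega>
    have "0 < L n \<omega>" if "\<omega> \<in> space M" "0 < L (Suc n) \<omega>"
      using that L_nonneg[of \<omega> n] by (cases "L n \<omega> = 0") (auto simp: L_Suc)
    then show "indicator (A \<inter> {\<omega> \<in> space M. 0 < L (Suc n) \<omega>}) \<omega> \<le> (indicator ?A \<omega> :: ennreal)"
      by (auto simp: indicator_def)
  qed simp
  also have "\<dots> \<le> (\<integral>\<^sup>+\<omega>. V n \<omega> * indicator ?A \<omega> \<partial>P)"
    using A pos_set by (intro null.set_supermartingaleD(3)[OF V]) auto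
  also have "\<dots> = (\<integral>\<^sup>+\<omega>. V n \<omega> / ennreal (L n \<omega>) * indicator A \<omega> \<partial>Q)"
    by (rule eq[OF A, symmetric])
  finally show "(\<integral>\<^sup>+\<omega>. V (Suc n) \<omega> / ennreal (L (Suc n) \<omega>) * indicator A \<omega> \<partial>Q)
      \<le> (\<integral>\<^sup>+\<omega>. V n \<omega> / ennreal (L n \<omega>) * indicator A \<omega> \<partial>Q)" .
qed

text \<open>
  The domination holds at each time on an event of the observed past, so it survives the passage
  to \<open>Q\<close>, and countably many times can be combined.
\<close>

lemma e_process_dominated:
  assumes W: "e_process M X \<P> W" and P: "P \<in> \<P>"
  obtains S where "test_supermartingale M X P S" "AE \<omega> in Q. \<forall>n. W (Suc n) \<omega> \<le> S (Suc n) \<omega>"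
proof -
  obtain S where S: "test_supermartingale M X P S" "AE \<omega> in P. \<forall>n\<ge>1. W n \<omega> \<le> S n \<omega>"
    using assms by (auto simp: e_process_def)
  have "AE \<omega> in Q. W (Suc n) \<omega> \<le> S (Suc n) \<omega>" for n
  proof (rule AE_Q_if_AE_P)
    have "W (Suc n) \<in> borel_measurable (nat_filtration M X (Suc n))"
      using W by (auto simp: e_process_def nonneg_adapted_def)
    moreover have "S (Suc n) \<in> borel_measurable (nat_filtration M X (Suc n))"
      using S by (auto simp: test_supermartingale_def nonneg_adapted_def)
    ultimately have "{\<omega> \<in> space (nat_filtration M X (Suc n)). \<not> W (Suc n) \<omega> \<le> S (Suc n) \<omega>} \<in> sets (nat_filtration M X (Suc n))"
      by measurable
    then show "{\<omega> \<in> space M. \<not> W (Suc n) \<omega> \<le> S (Suc n) \<omega>} \<in> sets (nat_filtration M X (Suc n))" by simp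
    show "AE \<omega> in P. W (Suc n) \<omega> \<le> S (Suc n) \<omega>"
      using S(2) by (auto elim!: eventually_mono)
  qed
  then show ?thesis using S(1) by (intro that[of S]) (simp_all add: AE_all_countable)
qed

lemma growth_eq: "log_growth Q X \<mu>0 gs = ereal growth"
  using log_optimal_finite(3)[OF opt] .

text \<open>
  The optimal payoff may come arbitrarily close to \<open>0\<close>, so its logarithm is only integrable.
  Truncation makes it bounded, within reach of \<open>bounded_strong_law\<close>, at a vanishing cost.
\<close>

lemma truncated_growth_tendsto:
  "(\<lambda>K. \<integral>\<omega>. ln (max (payoff \<mu>0 gs (X 1 \<omega>)) (exp (- real K))) \<partial>Q) \<longlonglongrightarrow> growth"
proof (rule integral_dominated_convergence)
  show "integrable Q (\<lambda>\<omega>. \<bar>ln (payoff \<mu>0 gs (X 1 \<omega>))\<bar>)"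
    using log_optimal_finite(2)[OF opt] by simp
  show "AE \<omega> in Q. (\<lambda>K. ln (max (payoff \<mu>0 gs (X 1 \<omega>)) (exp (- real K)))) \<longlonglongrightarrow> ln (payoff \<mu>0 gs (X 1 \<omega>))"
    using log_optimal_finite(1)[OF opt]
  proof eventually_elim
    case (elim \<omega>)
    have "(\<lambda>K. exp (- real K)) \<longlonglongrightarrow> 0" by real_asymp
    then have "(\<lambda>K. max (payoff \<mu>0 gs (X 1 \<omega>)) (exp (- real K))) \<longlonglongrightarrow> max (payoff \<mu>0 gs (X 1 \<omega>)) 0"
      by (intro tendsto_max tendsto_const)
    then show ?case using elim by (intro tendsto_ln) (auto simp: max_def)
  qed
  show "AE \<omega> in Q. norm (ln (max (payoff \<mu>0 gs (X 1 \<omega>)) (exp (- real K)))) \<le> \<bar>ln (payoff \<mu>0 gs (X 1 \<omega>))\<bar>" for K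
    using log_optimal_finite(1)[OF opt]
  proof eventually_elim
    case (elim \<omega>)
    show ?case
    proof (cases "payoff \<mu>0 gs (X 1 \<omega>) \<le> exp (- real K)")
      case True
      then have "ln (payoff \<mu>0 gs (X 1 \<omega>)) \<le> - real K" using elim by (metis ln_exp ln_le_cancel_iff exp_gt_zero)
      then show ?thesis using True by (simp add: max_def)
    qed (simp add: max_def)
  qed
qed measurable

text \<open>
  The ratio of \<open>S n\<close> to \<open>L n\<close> has expectation at most \<open>1\<close> under \<open>Q\<close>, so by Markov's inequality and
  Borel-Cantelli it is eventually below \<open>n\<^sup>2\<close>, which is negligible on the logarithmic scale. The
  logarithm of \<open>L n\<close> lies below sums of truncated variables that obey the law of large numbers.
\<close>

lemma log_growth_rate_le:
  assumes S: "test_supermartingale M X P S"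
  shows "AE \<omega> in Q. limsup (\<lambda>n. ereal (1 / real n) * elog (S n \<omega>)) \<le> ereal growth"
proof -
  define V where "V n \<omega> = (if n = 0 then 1 else ennreal (S n \<omega>))" for n \<omega>
  have V: "null.set_supermartingale V"
    unfolding V_def by (rule null.test_supermartingale_imp_set[OF S])
  define R where "R n \<omega> = V n \<omega> / ennreal (L n \<omega>)" for n \<omega>
  have R: "set_supermartingale R" unfolding R_def by (rule likelihood_ratio_supermartingale[OF V])
  have [measurable]: "R n \<in> borel_measurable Q" for n by (rule set_supermartingaleD(2)[OF R])
  have S0: "0 \<le> S n \<omega>" if "1 \<le> n" "\<omega> \<in> space Q" for n \<omega>
    using S that by (auto simp: test_supermartingale_def nonneg_adapted_def space_P)
  have "(\<integral>\<^sup>+\<omega>. R 0 \<omega> \<partial>Q) = 1" by (simp add: R_def V_def emeasure_space_1)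
  then have ER: "(\<integral>\<^sup>+\<omega>. R n \<omega> \<partial>Q) \<le> 1" for n using set_supermartingale_decreasing[OF R, of n] by simp
  define A where "A n = {\<omega> \<in> space Q. 1 \<le> ennreal (1 / (real n)\<^sup>2) * R n \<omega>}" for n
  have A_sets [measurable]: "A n \<in> sets Q" for n unfolding A_def by measurable
  have A_prob: "prob (A n) \<le> 1 / (real n)\<^sup>2" for n
  proof -
    have "emeasure Q (A n) \<le> ennreal (1 / (real n)\<^sup>2) * (\<integral>\<^sup>+\<omega>. R n \<omega> * indicator (space Q) \<omega> \<partial>Q)"
      unfolding A_def by (rule nn_integral_Markov_inequality) auto
    also have "(\<integral>\<^sup>+\<omega>. R n \<omega> * indicator (space Q) \<omega> \<partial>Q) = (\<integral>\<^sup>+\<omega>. R n \<omega> \<partial>Q)" by (intro nn_integral_cong) simp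
    also have "ennreal (1 / (real n)\<^sup>2) * \<dots> \<le> ennreal (1 / (real n)\<^sup>2) * 1"
      by (intro mult_left_mono ER) simp
    finally show ?thesis by (simp add: emeasure_eq_measure)
  qed
  have bc: "AE \<omega> in Q. eventually (\<lambda>n. \<omega> \<in> space Q - A n) sequentially"
  proof (rule borel_cantelli_AE1)
    have "summable (\<lambda>n. 1 / (real n)\<^sup>2)"
      using inverse_power_summable[of 2, where 'a = real] by (simp add: inverse_eq_divide)
    then show "summable (\<lambda>n. prob (A n))"
      by (rule summable_comparison_test') (use A_prob in auto)
  qed (auto simp: emeasure_eq_measure)
  define f where "f K x = ln (max (payoff \<mu>0 gs x) (exp (- real K)))" for K x
  have "AE \<omega> in Q. (\<lambda>n. (\<Sum>i=1..n. f K (X i \<omega>)) / real n) \<longlonglongrightarrow> (\<integral>\<omega>. f K (X 1 \<omega>) \<partial>Q)" for K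
  proof (rule bounded_strong_law)
    show "f K \<in> borel_measurable borel" unfolding f_def by measurable
    fix x :: real assume "x \<in> {0..1}"
    then have "payoff \<mu>0 gs x \<le> exp cap" by (rule payoff_bounds(2)[OF log_optimalD(1)[OF opt]])
    moreover have "exp (- real K) \<le> exp cap" using cap_pos by simp
    ultimately have m: "max (payoff \<mu>0 gs x) (exp (- real K)) \<le> exp cap" by simp
    have p: "0 < max (payoff \<mu>0 gs x) (exp (- real K))" by (simp add: less_max_iff_disj)
    have "f K x \<le> ln (exp cap)"
      unfolding f_def using m p by (subst ln_le_cancel_iff) auto
    moreover have "ln (exp (- real K)) \<le> f K x"
      unfolding f_def using p by (subst ln_le_cancel_iff) auto
    ultimately show "\<bar>f K x\<bar> \<le> cap + real K" using cap_pos by auto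
  qed
  then have lln: "AE \<omega> in Q. \<forall>K. (\<lambda>n. (\<Sum>i=1..n. f K (X i \<omega>)) / real n) \<longlonglongrightarrow> (\<integral>\<omega>. f K (X 1 \<omega>) \<partial>Q)"
    by (simp add: AE_all_countable)
  show ?thesis
    using bc lln payoff_pos
  proof eventually_elim
    case (elim \<omega>)
    have lnL: "ln (L n \<omega>) \<le> (\<Sum>i=1..n. f K (X i \<omega>))" for n K
    proof (induction n)
      case (Suc n)
      have "ln (payoff \<mu>0 gs (X (Suc n) \<omega>)) \<le> f K (X (Suc n) \<omega>)"
        unfolding f_def using elim(3) by (subst ln_le_cancel_iff) (auto simp: less_max_iff_disj)
      then show ?case using Suc ln_L[OF elim(3), of n] by simp
    qed simp
    have le: "limsup (\<lambda>n. ereal (1 / real n) * elog (S n \<omega>)) \<le> ereal (\<integral>\<omega>. f K (X 1 \<omega>) \<partial>Q)" for K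
    proof -
      have "eventually (\<lambda>n. ereal (1 / real n) * elog (S n \<omega>) \<le> ereal (2 * ln (real n) / real n + (\<Sum>i=1..n. f K (X i \<omega>)) / real n)) sequentially"
        using elim(1) eventually_ge_at_top[of 1]
      proof eventually_elim
        case (elim n)
        have Lp: "0 < L n \<omega>" by (rule L_pos) fact
        show ?case
        proof (cases "S n \<omega> \<le> 0")
          case True
          then show ?thesis using elim by (simp add: elog_def)
        next
          case False
          have "R n \<omega> = ennreal (S n \<omega> / L n \<omega>)"
            using False Lp elim by (simp add: R_def V_def divide_ennreal)
          moreover have "\<not> 1 \<le> ennreal (1 / (real n)\<^sup>2) * R n \<omega>" using elim by (auto simp: A_def)
          ultimately have "ennreal (1 / (real n)\<^sup>2 * (S n \<omega> / L n \<omega>)) < 1"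
            using False Lp by (subst ennreal_mult) (auto simp: not_le)
          then have "1 / (real n)\<^sup>2 * (S n \<omega> / L n \<omega>) < 1" by simp
          then have "S n \<omega> \<le> (real n)\<^sup>2 * L n \<omega>" using Lp elim by (simp add: field_simps)
          then have "ln (S n \<omega>) \<le> ln ((real n)\<^sup>2 * L n \<omega>)" using False Lp elim by (subst ln_le_cancel_iff) auto
          also have "\<dots> = 2 * ln (real n) + ln (L n \<omega>)" using Lp elim by (simp add: ln_mult_pos ln_realpow)
          also have "\<dots> \<le> 2 * ln (real n) + (\<Sum>i=1..n. f K (X i \<omega>))" using lnL by simp
          finally have "ln (S n \<omega>) / real n \<le> (2 * ln (real n) + (\<Sum>i=1..n. f K (X i \<omega>))) / real n"
            by (rule divide_right_mono) simp
          then show ?thesis using False by (simp add: elog_def add_divide_distrib)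
        qed
      qed
      then have "limsup (\<lambda>n. ereal (1 / real n) * elog (S n \<omega>))
          \<le> limsup (\<lambda>n. ereal (2 * ln (real n) / real n + (\<Sum>i=1..n. f K (X i \<omega>)) / real n))"
        by (rule Limsup_mono)
      also have "\<dots> = ereal (0 + (\<integral>\<omega>. f K (X 1 \<omega>) \<partial>Q))"
      proof (intro lim_imp_Limsup tendsto_ereal tendsto_add)
        show "(\<lambda>n. 2 * ln (real n) / real n) \<longlonglongrightarrow> 0" by real_asymp
      qed (use elim(2) in auto)
      finally show ?thesis by simp
    qed
    have "(\<lambda>K. ereal (\<integral>\<omega>. f K (X 1 \<omega>) \<partial>Q)) \<longlonglongrightarrow> ereal growth"
      unfolding f_def by (intro tendsto_ereal truncated_growth_tendsto)
    then show ?case by (rule LIMSEQ_le_const) (use le in blast)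
  qed
qed

lemma e_process_growth_rate_le:
  assumes W: "e_process M X \<P> W" and P: "P \<in> \<P>"
  shows "AE \<omega> in Q. limsup (\<lambda>n. ereal (1 / real n) * elog (W n \<omega>)) \<le> ereal growth"
proof -
  obtain S where S: "test_supermartingale M X P S" "AE \<omega> in Q. \<forall>n. W (Suc n) \<omega> \<le> S (Suc n) \<omega>"
    using e_process_dominated[OF assms] .
  show ?thesis
    using S(2) log_growth_rate_le[OF S(1)]
  proof eventually_elim
    case (elim \<omega>)
    have "elog (W n \<omega>) \<le> elog (S n \<omega>)" if "1 \<le> n" for n
      using elim(1)[rule_format, of "n - 1"] that by (auto simp: elog_def)
    then have "eventually (\<lambda>n. ereal (1 / real n) * elog (W n \<omega>) \<le> ereal (1 / real n) * elog (S n \<omega>)) sequentially"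
      by (intro eventually_mono[OF eventually_ge_at_top[of 1]] ereal_mult_left_mono) auto
    then have "limsup (\<lambda>n. ereal (1 / real n) * elog (W n \<omega>)) \<le> limsup (\<lambda>n. ereal (1 / real n) * elog (S n \<omega>))"
      by (rule Limsup_mono)
    then show ?case using elim(2) by simp
  qed
qed

text \<open>
  Let \<open>\<tau>\<close> be the crossing time, let \<open>S\<close> dominate \<open>W\<close> and put \<open>S' = (1 - \<epsilon>) S + \<epsilon>\<close>. The ratio \<open>S' / L\<close>
  stopped at \<open>min \<tau> N\<close> has expectation at most \<open>1\<close> under \<open>Q\<close>, hence its logarithm has expectation
  at most \<open>0\<close>. The expected logarithm of the stopped \<open>L\<close> is the right-hand side by Wald's identity,
  and the logarithm of the stopped \<open>S'\<close> is at least \<open>ln ((1 - \<epsilon>) / \<alpha>)\<close> if the level was crossed by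
  time \<open>N\<close>, and at least \<open>ln \<epsilon>\<close> otherwise. The latter bound is the reason for mixing in \<open>\<epsilon>\<close>: \<open>S\<close>
  alone could be arbitrarily small on paths that have not crossed.
\<close>

lemma truncated_crossing_bound:
  assumes W: "e_process M X \<P> W" and P: "P \<in> \<P>" and \<alpha>: "0 < \<alpha>" and \<epsilon>: "0 < \<epsilon>" "\<epsilon> < 1"
  defines "q n \<equiv> prob (uncrossed M W \<alpha> n)"
  shows "ln ((1 - \<epsilon>) / \<alpha>) * (1 - q N) + ln \<epsilon> * q N \<le> growth * (\<Sum>i<N. q i)"
proof -
  obtain S where S: "test_supermartingale M X P S" and dom: "AE \<omega> in Q. \<forall>n. W (Suc n) \<omega> \<le> S (Suc n) \<omega>"
    using e_process_dominated[OF W P] .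
  let ?S = "\<lambda>n \<omega>. if n = 0 then 1 else S n \<omega>"
  define S' where "S' n \<omega> = (1 - \<epsilon>) * ?S n \<omega> + \<epsilon>" for n \<omega>
  let ?V = "\<lambda>n \<omega>. if n = 0 then 1 else ennreal (S n \<omega>)"
  have S0: "0 \<le> ?S n \<omega>" if "\<omega> \<in> space M" for n \<omega>
    using S that by (auto simp: test_supermartingale_def nonneg_adapted_def)
  define R where "R n \<omega> = (ennreal (1 - \<epsilon>) * ?V n \<omega> + ennreal \<epsilon>) / ennreal (L n \<omega>)" for n \<omega>
  have R: "set_supermartingale R"
    unfolding R_def using \<epsilon>
    by (intro likelihood_ratio_supermartingale null.mixture_supermartingale null.test_supermartingale_imp_set[OF S]) auto
  have R0: "(\<integral>\<^sup>+\<omega>. R 0 \<omega> \<partial>Q) = 1"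
    using \<epsilon> by (simp add: R_def emeasure_space_1 flip: ennreal_plus)
  let ?B = "uncrossed M W \<alpha>"
  have adapted: "W k \<in> borel_measurable (nat_filtration M X k)" if "1 \<le> k" for k
    using W that by (auto simp: e_process_def nonneg_adapted_def)
  have B: "?B n \<in> sets (nat_filtration M X n)" for n by (rule uncrossed_sets[OF adapted])
  note [measurable] = sets_filtration_P[OF B]
  let ?t = "stopped_index ?B"
  have ER: "(\<integral>\<^sup>+\<omega>. R (?t N \<omega>) \<omega> \<partial>Q) \<le> 1"
    using optional_stopping[OF R B uncrossed_decreasing, of N] R0 by simp
  let ?f = "\<lambda>x. ln (payoff \<mu>0 gs x)"
  define D where "D N \<omega> = (\<Sum>i<N. indicator (?B i) \<omega> * ?f (X (Suc i) \<omega>))" for N \<omega>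
  have f: "?f \<in> borel_measurable borel" "integrable Q (\<lambda>\<omega>. ?f (X 1 \<omega>))"
    using log_optimal_finite(2)[OF opt] by auto
  have D_int: "integrable Q (D N)" "(\<integral>\<omega>. D N \<omega> \<partial>Q) = growth * (\<Sum>i<N. q i)"
    unfolding D_def q_def using wald_identity[OF f B] by auto
  define G where "G \<omega> = ln ((1 - \<epsilon>) / \<alpha>) * (1 - indicator (?B N) \<omega>) + ln \<epsilon> * indicator (?B N) \<omega>" for \<omega>
  have BN_int: "integrable Q (indicator (?B N) :: 'a \<Rightarrow> real)" by (simp add: emeasure_eq_measure)
  have BN: "(\<integral>\<omega>. indicator (?B N) \<omega> \<partial>Q) = q N"
  proof -
    have "?B N \<inter> space Q = ?B N" by (auto simp: uncrossed_def space_P)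
    then show ?thesis by (simp add: q_def)
  qed
  have G_int: "integrable Q G" unfolding G_def using BN_int by auto
  have G_eq: "(\<integral>\<omega>. G \<omega> \<partial>Q) = ln ((1 - \<epsilon>) / \<alpha>) * (1 - q N) + ln \<epsilon> * q N"
    unfolding G_def using BN_int BN by (simp add: prob_space)
  define T where "T \<omega> = 1 + G \<omega> - D N \<omega>" for \<omega>
  have T_int: "integrable Q T" unfolding T_def using G_int D_int by auto
  have T_le: "AE \<omega> in Q. ennreal (T \<omega>) \<le> R (?t N \<omega>) \<omega>"
    using dom payoff_pos AE_space
  proof eventually_elim
    case (elim \<omega>)
    then have w: "\<omega> \<in> space M" by (simp add: space_P)
    have Lp: "0 < L n \<omega>" for n by (rule L_pos[OF elim(2)])
    \<comment> \<open>\<open>D N\<close> collects the logarithmic payoffs up to the stopped index.\<close>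
    have DL: "D N \<omega> = ln (L (?t N \<omega>) \<omega>)" for N
    proof (induction N)
      case (Suc N)
      show ?case
      proof (cases "\<omega> \<in> ?B N")
        case True
        then show ?thesis
          using Suc ln_L[OF elim(2), of N] stopped_index_eq[of ?B, OF uncrossed_decreasing True]
          by (simp add: D_def)
      qed (use Suc in \<open>simp add: D_def\<close>)
    qed (simp add: D_def)
    let ?n = "?t N \<omega>"
    have S'_ge: "\<epsilon> \<le> S' ?n \<omega>" unfolding S'_def using S0[OF w] \<epsilon> by simp
    have G_le: "G \<omega> \<le> ln (S' ?n \<omega>)"
    proof (cases "\<omega> \<in> ?B N")
      case True
      then show ?thesis using S'_ge \<epsilon> by (simp add: G_def)
    next
      case False
      note cross = stopped_index_uncrossed[OF w False]
      have "W ?n \<omega> \<le> S ?n \<omega>" using elim(1)[rule_format, of "?n - 1"] cross(1) by simp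
      then have "1 / \<alpha> \<le> ?S ?n \<omega>" using cross by simp
      then have "(1 - \<epsilon>) * (1 / \<alpha>) \<le> (1 - \<epsilon>) * ?S ?n \<omega>" using \<epsilon> by (intro mult_left_mono) auto
      then have "(1 - \<epsilon>) / \<alpha> \<le> S' ?n \<omega>" unfolding S'_def using \<epsilon> by simp
      then have "ln ((1 - \<epsilon>) / \<alpha>) \<le> ln (S' ?n \<omega>)" using \<epsilon> \<alpha> S'_ge by (subst ln_le_cancel_iff) auto
      then show ?thesis using False by (simp add: G_def)
    qed
    have pos: "0 < S' ?n \<omega> / L ?n \<omega>" using S'_ge \<epsilon> Lp[of ?n] by simp
    have "T \<omega> \<le> 1 + (ln (S' ?n \<omega>) - ln (L ?n \<omega>))" using G_le DL[of N] by (simp add: T_def)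
    also have "ln (S' ?n \<omega>) - ln (L ?n \<omega>) = ln (S' ?n \<omega> / L ?n \<omega>)"
      using S'_ge \<epsilon> Lp[of ?n] by (simp add: ln_div)
    also have "1 + ln (S' ?n \<omega> / L ?n \<omega>) \<le> S' ?n \<omega> / L ?n \<omega>"
      using ln_le_minus_one[OF pos] by simp
    finally have "ennreal (T \<omega>) \<le> ennreal (S' ?n \<omega> / L ?n \<omega>)" by (rule ennreal_leI)
    also have "\<dots> = ennreal (S' ?n \<omega>) / ennreal (L ?n \<omega>)"
      using S'_ge \<epsilon> Lp[of ?n] by (intro divide_ennreal[symmetric]) auto
    also have "ennreal (S' ?n \<omega>) = ennreal (1 - \<epsilon>) * ennreal (?S ?n \<omega>) + ennreal \<epsilon>"
    proof -
      have "ennreal (S' ?n \<omega>) = ennreal ((1 - \<epsilon>) * ?S ?n \<omega>) + ennreal \<epsilon>"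
        unfolding S'_def using \<epsilon> S0[OF w, of ?n] by (intro ennreal_plus mult_nonneg_nonneg) auto
      also have "ennreal ((1 - \<epsilon>) * ?S ?n \<omega>) = ennreal (1 - \<epsilon>) * ennreal (?S ?n \<omega>)"
        using \<epsilon> S0[OF w, of ?n] by (intro ennreal_mult) auto
      finally show ?thesis .
    qed
    finally show ?case by (cases "?n = 0") (simp_all add: R_def)
  qed
  have "(\<integral>\<omega>. T \<omega> \<partial>Q) \<le> (\<integral>\<omega>. max 0 (T \<omega>) \<partial>Q)"
    using T_int by (intro integral_mono) auto
  moreover have "(\<integral>\<omega>. max 0 (T \<omega>) \<partial>Q) \<le> 1"
  proof -
    have "ennreal (\<integral>\<omega>. max 0 (T \<omega>) \<partial>Q) = (\<integral>\<^sup>+\<omega>. ennreal (max 0 (T \<omega>)) \<partial>Q)"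
      using T_int by (intro nn_integral_eq_integral[symmetric]) auto
    also have "\<dots> = (\<integral>\<^sup>+\<omega>. ennreal (T \<omega>) \<partial>Q)" by (intro nn_integral_cong) (simp add: max_def ennreal_neg)
    also have "\<dots> \<le> 1" using nn_integral_mono_AE[OF T_le] ER by simp
    finally show ?thesis by simp
  qed
  moreover have "(\<integral>\<omega>. T \<omega> \<partial>Q) = 1 + (\<integral>\<omega>. G \<omega> \<partial>Q) - (\<integral>\<omega>. D N \<omega> \<partial>Q)"
    unfolding T_def using G_int D_int(1) by (simp add: prob_space)
  ultimately show ?thesis using G_eq D_int(2) by simp
qed

text \<open>
  If the expected crossing time is finite, then the probability of not having crossed by time \<open>N\<close>
  vanishes as \<open>N\<close> grows, and with it the contribution of \<open>ln \<epsilon>\<close>. Afterwards \<open>\<epsilon>\<close> tends to \<open>0\<close>.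
\<close>

lemma summable_crossing_bound:
  assumes W: "e_process M X \<P> W" and P: "P \<in> \<P>" and \<alpha>: "0 < \<alpha>"
    and sum: "summable (\<lambda>n. prob (uncrossed M W \<alpha> n))"
  shows "ln (1 / \<alpha>) \<le> growth * (\<Sum>n. prob (uncrossed M W \<alpha> n))"
proof -
  let ?q = "\<lambda>n. prob (uncrossed M W \<alpha> n)"
  have eps: "ln (1 - \<epsilon>) + ln (1 / \<alpha>) \<le> growth * (\<Sum>n. ?q n)" if \<epsilon>: "0 < \<epsilon>" "\<epsilon> < 1" for \<epsilon>
  proof -
    have "ln ((1 - \<epsilon>) / \<alpha>) * (1 - 0) + ln \<epsilon> * 0 \<le> growth * (\<Sum>n. ?q n)"
    proof (rule LIMSEQ_le)
      show "(\<lambda>N. ln ((1 - \<epsilon>) / \<alpha>) * (1 - ?q N) + ln \<epsilon> * ?q N) \<longlonglongrightarrow> ln ((1 - \<epsilon>) / \<alpha>) * (1 - 0) + ln \<epsilon> * 0"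
        by (intro tendsto_intros summable_LIMSEQ_zero sum)
      show "(\<lambda>N. growth * (\<Sum>i<N. ?q i)) \<longlonglongrightarrow> growth * (\<Sum>n. ?q n)"
        by (intro tendsto_intros summable_LIMSEQ sum)
    qed (use truncated_crossing_bound[OF W P \<alpha> \<epsilon>] in blast)
    moreover have "ln ((1 - \<epsilon>) / \<alpha>) = ln (1 - \<epsilon>) + ln (1 / \<alpha>)"
      using \<epsilon> \<alpha> by (simp add: ln_div)
    ultimately show ?thesis by simp
  qed
  have lim: "(\<lambda>k. ln (1 - 1 / (real k + 2)) + ln (1 / \<alpha>)) \<longlonglongrightarrow> 0 + ln (1 / \<alpha>)"
    by (intro tendsto_add tendsto_const) real_asymp
  have "0 + ln (1 / \<alpha>) \<le> growth * (\<Sum>n. ?q n)"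
    by (rule LIMSEQ_le_const2[OF lim]) (use eps in \<open>auto intro!: exI[of _ 0]\<close>)
  then show ?thesis by simp
qed

end

section \<open>Attaining the bound under sublinear regret\<close>

text \<open>
  Finite regret against a bet that is not ruined excludes ruin of \<open>W\<close>, because a vanishing wealth
  has infinite regret.
\<close>

lemma regret_lower_bound:
  assumes regret: "portfolio_regret X \<mu>0 W n \<omega> \<le> ereal r"
    and g: "g \<in> bet_range \<mu>0" and pos: "\<forall>i\<in>{1..n}. 0 < payoff \<mu>0 g (X i \<omega>)"
  shows "0 < W n \<omega>" and "(\<Sum>i=1..n. ln (payoff \<mu>0 g (X i \<omega>))) - r \<le> ln (W n \<omega>)"
proof -
  let ?s = "\<Sum>i=1..n. ln (payoff \<mu>0 g (X i \<omega>))"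
  let ?S = "SUP g\<in>bet_range \<mu>0. \<Sum>i=1..n. elog (1 + g * (X i \<omega> - \<mu>0))"
  have "(\<Sum>i=1..n. elog (1 + g * (X i \<omega> - \<mu>0))) = (\<Sum>i=1..n. ereal (ln (payoff \<mu>0 g (X i \<omega>))))"
  proof (rule sum.cong[OF refl])
    fix i assume "i \<in> {1..n}"
    then have "0 < payoff \<mu>0 g (X i \<omega>)" using pos by blast
    then show "elog (1 + g * (X i \<omega> - \<mu>0)) = ereal (ln (payoff \<mu>0 g (X i \<omega>)))"
      by (simp add: elog_def payoff_def)
  qed
  also have "\<dots> = ereal ?s" by simp
  finally have "ereal ?s = (\<Sum>i=1..n. elog (1 + g * (X i \<omega> - \<mu>0)))" by (rule sym)
  also have "\<dots> \<le> ?S" by (rule SUP_upper[OF g])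
  finally have S: "ereal ?s \<le> ?S" .
  then have S': "?S \<noteq> -\<infinity>" by auto
  have reg: "?S - elog (W n \<omega>) \<le> ereal r" using regret by (simp add: portfolio_regret_def)
  show W: "0 < W n \<omega>"
  proof (rule ccontr)
    assume "\<not> 0 < W n \<omega>"
    then have "?S - elog (W n \<omega>) = \<infinity>" using S' by (simp add: elog_def)
    then show False using reg by simp
  qed
  have "ereal ?s - ereal (ln (W n \<omega>)) \<le> ?S - elog (W n \<omega>)"
    using S W by (intro ereal_minus_mono) (auto simp: elog_def)
  also note reg
  finally show "?s - r \<le> ln (W n \<omega>)" by simp
qed

lemma smallo_real_linear_bound:
  fixes r :: "nat \<Rightarrow> real"
  assumes "r \<in> o(\<lambda>n. real n)" "0 < \<epsilon>"
  obtains K where "0 \<le> K" "\<And>n. r n \<le> \<epsilon> * real n + K"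
proof -
  have "eventually (\<lambda>n. norm (r n) \<le> \<epsilon> * norm (real n)) sequentially"
    using landau_o.smallD[OF assms] .
  then obtain n0 where n0: "\<And>n. n0 \<le> n \<Longrightarrow> \<bar>r n\<bar> \<le> \<epsilon> * real n"
    by (auto simp: eventually_sequentially)
  show ?thesis
  proof (rule that[of "\<Sum>n<n0. \<bar>r n\<bar>"])
    show "0 \<le> (\<Sum>n<n0. \<bar>r n\<bar>)" by (intro sum_nonneg) auto
    fix n show "r n \<le> \<epsilon> * real n + (\<Sum>n<n0. \<bar>r n\<bar>)"
    proof (cases "n < n0")
      case True
      then have "\<bar>r n\<bar> \<le> (\<Sum>n<n0. \<bar>r n\<bar>)" by (intro member_le_sum) auto
      moreover have "0 \<le> \<epsilon> * real n" using assms(2) by simp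
      ultimately show ?thesis by linarith
    next
      case False
      then have "\<bar>r n\<bar> \<le> \<epsilon> * real n" using n0 by simp
      moreover have "0 \<le> (\<Sum>n<n0. \<bar>r n\<bar>)" by (intro sum_nonneg) auto
      ultimately show ?thesis by linarith
    qed
  qed
qed

context unit_betting begin

text \<open>
  The richness of the sample space turns the least favourable law of one observation into a null
  distribution of the whole sequence.
\<close>

lemma dual_pair_exists:
  assumes full: "full_sequence_model M X" and opt: "log_optimal gs"
  obtains P where "P \<in> mean_eq M X \<mu>0" "dual_pair Q M X \<mu>0 P gs"
proof -
  obtain \<nu> :: "real measure" where \<nu>: "prob_space \<nu>" "sets \<nu> = sets borel" "AE x in \<nu>. x \<in> {0..1}"
    "(\<integral>x. x \<partial>\<nu>) = \<mu>0" "distr Q borel (X 1) = density \<nu> (\<lambda>x. ennreal (payoff \<mu>0 gs x))"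
    using least_favourable_law[OF opt] .
  obtain P where P: "P \<in> iid_distributions M X" "distr P borel (X 1) = \<nu>"
    using full \<nu> unfolding full_sequence_model_def by blast
  interpret P: unit_iid P M X
    by (rule unit_iid.intro, use P(1) in \<open>simp add: iid_distributions_def\<close>)
      (unfold_locales, use P(1) X_range in auto)
  have "(\<integral>\<omega>. X 1 \<omega> \<partial>P) = (\<integral>x. x \<partial>distr P borel (X 1))"
    by (subst integral_distr) auto
  then have "P \<in> mean_eq M X \<mu>0" using P \<nu>(4) by (simp add: mean_eq_def)
  moreover have "dual_pair Q M X \<mu>0 P gs"
    by unfold_locales (use opt \<nu>(5) P(2) in auto)
  ultimately show ?thesis by (rule that)
qed

text \<open>
  The competitor of \<open>W\<close> in both attainment results. In contrast to the optimal bet it has bounded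
  logarithmic payoffs, and it loses only a factor \<open>s\<close> of the optimal growth.
\<close>

lemma shrunk_bet:
  assumes opt: "log_optimal gs" and s: "0 < s" "s < 1"
  shows "s * gs \<in> bet_range \<mu>0"
    and "x \<in> {0..1} \<Longrightarrow> 0 < payoff \<mu>0 (s * gs) x"
    and "x \<in> {0..1} \<Longrightarrow> \<bar>ln (payoff \<mu>0 (s * gs) x)\<bar> \<le> cap + \<bar>ln (1 - s)\<bar>"
    and "s * (\<integral>\<omega>. ln (payoff \<mu>0 gs (X 1 \<omega>)) \<partial>Q) \<le> (\<integral>\<omega>. ln (payoff \<mu>0 (s * gs) (X 1 \<omega>)) \<partial>Q)"
proof -
  note gs = log_optimalD(1)[OF opt]
  show range: "s * gs \<in> bet_range \<mu>0"
    using bet_range_convex[OF zero_bet gs, of s] s by simp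
  show pos: "0 < payoff \<mu>0 (s * gs) x" if "x \<in> {0..1}" for x
    using shrunk_payoff(1)[OF gs that s] s by linarith
  show bound: "\<bar>ln (payoff \<mu>0 (s * gs) x)\<bar> \<le> cap + \<bar>ln (1 - s)\<bar>" if x: "x \<in> {0..1}" for x
  proof -
    have "ln (1 - s) \<le> ln (payoff \<mu>0 (s * gs) x)"
      using shrunk_payoff(1)[OF gs x s] pos[OF x] s by (subst ln_le_cancel_iff) auto
    moreover have "ln (payoff \<mu>0 (s * gs) x) \<le> cap" by (rule ln_payoff_le_cap[OF range x pos[OF x]])
    ultimately show ?thesis using cap_pos by linarith
  qed
  have X: "X 1 \<omega> \<in> {0..1}" if "\<omega> \<in> space Q" for \<omega> using that X_range[of 1] by (simp add: space_P)
  have int: "integrable Q (\<lambda>\<omega>. ln (payoff \<mu>0 (s * gs) (X 1 \<omega>)))"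
    using X bound by (intro integrable_const_bound[of _ "cap + \<bar>ln (1 - s)\<bar>"]) auto
  have "(\<integral>\<omega>. s * ln (payoff \<mu>0 gs (X 1 \<omega>)) \<partial>Q) \<le> (\<integral>\<omega>. ln (payoff \<mu>0 (s * gs) (X 1 \<omega>)) \<partial>Q)"
  proof (rule integral_mono_AE[OF _ int])
    show "integrable Q (\<lambda>\<omega>. s * ln (payoff \<mu>0 gs (X 1 \<omega>)))" using log_optimal_finite(2)[OF opt] by simp
    show "AE \<omega> in Q. s * ln (payoff \<mu>0 gs (X 1 \<omega>)) \<le> ln (payoff \<mu>0 (s * gs) (X 1 \<omega>))"
      using log_optimal_finite(1)[OF opt] AE_space
      by eventually_elim (rule shrunk_payoff(2)[OF gs X s])
  qed
  then show "s * (\<integral>\<omega>. ln (payoff \<mu>0 gs (X 1 \<omega>)) \<partial>Q) \<le> (\<integral>\<omega>. ln (payoff \<mu>0 (s * gs) (X 1 \<omega>)) \<partial>Q)" by simp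
qed

text \<open>
  Up to the regret, \<open>W\<close> grows at least as fast as every shrunken bet, and the law of large numbers
  gives the growth of the latter. The shrinking factor tends to \<open>1\<close> along a sequence.
\<close>

lemma sublinear_regret_growth_rate_ge:
  assumes opt: "log_optimal gs" and regret: "sublinear_portfolio_regret M X \<mu>0 W"
  shows "AE \<omega> in Q. log_growth Q X \<mu>0 gs \<le> liminf (\<lambda>n. ereal (1 / real n) * elog (W n \<omega>))"
proof -
  obtain r where r: "r \<in> o(\<lambda>n. real n)"
    and reg: "\<And>n \<omega>. 1 \<le> n \<Longrightarrow> \<omega> \<in> space M \<Longrightarrow> portfolio_regret X \<mu>0 W n \<omega> \<le> ereal (r n)"
    using regret unfolding sublinear_portfolio_regret_def by blast
  let ?s = "\<lambda>k. 1 - 1 / (real k + 2)"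
  let ?f = "\<lambda>k x. ln (payoff \<mu>0 (?s k * gs) x)"
  let ?m = "\<lambda>k. \<integral>\<omega>. ?f k (X 1 \<omega>) \<partial>Q"
  let ?l = "\<integral>\<omega>. ln (payoff \<mu>0 gs (X 1 \<omega>)) \<partial>Q"
  have s: "0 < ?s k" "?s k < 1" for k by (auto simp: field_simps)
  have "AE \<omega> in Q. (\<lambda>n. (\<Sum>i=1..n. ?f k (X i \<omega>)) / real n) \<longlonglongrightarrow> ?m k" for k
    by (rule bounded_strong_law) (use shrunk_bet(3)[OF opt s] in auto)
  then have "AE \<omega> in Q. \<forall>k. (\<lambda>n. (\<Sum>i=1..n. ?f k (X i \<omega>)) / real n) \<longlonglongrightarrow> ?m k"
    by (simp add: AE_all_countable)
  then show ?thesis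
    using AE_space
  proof eventually_elim
    case (elim \<omega>)
    then have w: "\<omega> \<in> space M" by (simp add: space_P)
    have le: "ereal (?s k * ?l) \<le> liminf (\<lambda>n. ereal (1 / real n) * elog (W n \<omega>))" for k
    proof -
      have lim: "(\<lambda>n. ereal ((\<Sum>i=1..n. ?f k (X i \<omega>)) / real n - r n / real n)) \<longlonglongrightarrow> ereal (?m k - 0)"
        using elim(1) smalloD_tendsto[OF r] by (intro tendsto_ereal tendsto_diff) auto
      have "ereal (?s k * ?l) \<le> ereal (?m k - 0)" using shrunk_bet(4)[OF opt s, of k] by simp
      also have "\<dots> = liminf (\<lambda>n. ereal ((\<Sum>i=1..n. ?f k (X i \<omega>)) / real n - r n / real n))"
        using lim_imp_Liminf[OF _ lim] by simp
      also have "\<dots> \<le> liminf (\<lambda>n. ereal (1 / real n) * elog (W n \<omega>))"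
      proof (intro Liminf_mono eventually_mono[OF eventually_ge_at_top[of 1]])
        fix n :: nat assume n: "1 \<le> n"
        have pos: "\<forall>i\<in>{1..n}. 0 < payoff \<mu>0 (?s k * gs) (X i \<omega>)"
          using shrunk_bet(2)[OF opt s X_range] w by auto
        note W = regret_lower_bound[OF reg[OF n w] shrunk_bet(1)[OF opt s, of k] pos]
        have "((\<Sum>i=1..n. ?f k (X i \<omega>)) - r n) / real n \<le> ln (W n \<omega>) / real n"
          using W(2) by (rule divide_right_mono) simp
        then show "ereal ((\<Sum>i=1..n. ?f k (X i \<omega>)) / real n - r n / real n) \<le> ereal (1 / real n) * elog (W n \<omega>)"
          using W(1) by (simp add: elog_def diff_divide_distrib)
      qed
      finally show ?thesis .
    qed
    have "(\<lambda>k. ereal (?s k * ?l)) \<longlonglongrightarrow> ereal (1 * ?l)"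
      by (intro tendsto_ereal tendsto_mult tendsto_const) real_asymp
    then have "ereal (1 * ?l) \<le> liminf (\<lambda>n. ereal (1 / real n) * elog (W n \<omega>))"
      by (rule LIMSEQ_le_const2) (use le in blast)
    then show ?case using log_optimal_finite(3)[OF opt] by simp
  qed
qed

text \<open>
  A sublinear regret is at most \<open>\<epsilon> n + K\<close>. As long as \<open>W\<close> has not crossed the level \<open>1 / \<alpha>\<close>, the random
  walk of logarithmic payoffs of a shrunken bet, with drift reduced by \<open>\<epsilon>\<close>, thus stays below
  \<open>ln (1 / \<alpha>) + K\<close>, and \<open>random_walk_exit_bound\<close> limits the time for which it can do so.
\<close>

lemma sublinear_regret_crossing_bound:
  assumes opt: "log_optimal gs" and regret: "sublinear_portfolio_regret M X \<mu>0 W"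
    and adapted: "\<And>k. 1 \<le> k \<Longrightarrow> W k \<in> borel_measurable (nat_filtration M X k)"
    and d: "0 < d" "ereal d < log_growth Q X \<mu>0 gs"
  obtains K where "\<And>\<alpha>. 0 < \<alpha> \<Longrightarrow> \<alpha> < 1 \<Longrightarrow> expected_crossing_time Q W \<alpha> \<le> ereal ((ln (1 / \<alpha>) + K) / d)"
proof -
  obtain r where r: "r \<in> o(\<lambda>n. real n)"
    and reg: "\<And>n \<omega>. 1 \<le> n \<Longrightarrow> \<omega> \<in> space M \<Longrightarrow> portfolio_regret X \<mu>0 W n \<omega> \<le> ereal (r n)"
    using regret unfolding sublinear_portfolio_regret_def by blast
  define l where "l = (\<integral>\<omega>. ln (payoff \<mu>0 gs (X 1 \<omega>)) \<partial>Q)"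
  have l: "d < l" using d(2) log_optimal_finite(3)[OF opt] by (simp add: l_def)
  \<comment> \<open>Half of the gap \<open>l - d\<close> is spent on shrinking the bet, the other half on the regret.\<close>
  define s where "s = (d + l) / (2 * l)"
  define \<epsilon> where "\<epsilon> = (l - d) / 2"
  have s: "0 < s" "s < 1" using d l by (auto simp: s_def field_simps)
  have \<epsilon>: "0 < \<epsilon>" using l by (simp add: \<epsilon>_def)
  have sl: "s * l - \<epsilon> = d" using d l by (simp add: s_def \<epsilon>_def field_simps)
  obtain K where K: "0 \<le> K" "\<And>n. r n \<le> \<epsilon> * real n + K"
    by (rule smallo_real_linear_bound[OF r \<epsilon>]) blast
  let ?f = "\<lambda>x. ln (payoff \<mu>0 (s * gs) x) - \<epsilon>"
  define C where "C = cap + \<bar>ln (1 - s)\<bar> + \<epsilon>"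
  have C: "\<bar>?f x\<bar> \<le> C" if "x \<in> {0..1}" for x
    using shrunk_bet(3)[OF opt s that] \<epsilon> by (simp add: C_def)
  have X: "X 1 \<omega> \<in> {0..1}" if "\<omega> \<in> space Q" for \<omega> using that X_range[of 1] by (simp add: space_P)
  have int: "integrable Q (\<lambda>\<omega>. ln (payoff \<mu>0 (s * gs) (X 1 \<omega>)))"
    using X shrunk_bet(3)[OF opt s] by (intro integrable_const_bound[of _ "cap + \<bar>ln (1 - s)\<bar>"]) auto
  have drift: "d \<le> (\<integral>\<omega>. ?f (X 1 \<omega>) \<partial>Q)"
  proof -
    have "(\<integral>\<omega>. ?f (X 1 \<omega>) \<partial>Q) = (\<integral>\<omega>. ln (payoff \<mu>0 (s * gs) (X 1 \<omega>)) \<partial>Q) - \<epsilon>"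
      using int by (simp add: prob_space)
    then show ?thesis using shrunk_bet(4)[OF opt s] sl by (simp add: l_def)
  qed
  have "expected_crossing_time Q W \<alpha> \<le> ereal ((ln (1 / \<alpha>) + (K + C)) / d)" if \<alpha>: "0 < \<alpha>" "\<alpha> < 1" for \<alpha>
  proof -
    let ?B = "uncrossed M W \<alpha>"
    have B: "?B n \<in> sets (nat_filtration M X n)" for n by (rule uncrossed_sets[OF adapted])
    have "(\<integral>\<omega>. ?f (X 1 \<omega>) \<partial>Q) * (\<Sum>i<N. prob (?B i)) \<le> (ln (1 / \<alpha>) + K) + C" for N
    proof (rule random_walk_exit_bound[OF _ C B uncrossed_decreasing])
      show "0 \<le> ln (1 / \<alpha>) + K" using \<alpha> K by (intro add_nonneg_nonneg ln_ge_zero) auto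
      fix n \<omega> assume n: "1 \<le> n" and \<omega>: "\<omega> \<in> ?B n"
      have w: "\<omega> \<in> space M" and lt: "W n \<omega> < 1 / \<alpha>" using \<omega> n by (auto simp: uncrossed_def)
      have pos: "\<forall>i\<in>{1..n}. 0 < payoff \<mu>0 (s * gs) (X i \<omega>)"
        using shrunk_bet(2)[OF opt s X_range] w by auto
      note Wn = regret_lower_bound[OF reg[OF n w] shrunk_bet(1)[OF opt s] pos]
      have "ln (W n \<omega>) \<le> ln (1 / \<alpha>)" using Wn(1) lt \<alpha> by (subst ln_le_cancel_iff) auto
      then have "(\<Sum>i=1..n. ln (payoff \<mu>0 (s * gs) (X i \<omega>))) \<le> ln (1 / \<alpha>) + (\<epsilon> * real n + K)"
        using Wn(2) K(2)[of n] by linarith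
      then show "(\<Sum>i=1..n. ?f (X i \<omega>)) \<le> ln (1 / \<alpha>) + K"
        by (simp add: sum_subtractf mult.commute)
    qed measurable
    moreover have "d * (\<Sum>i<N. prob (?B i)) \<le> (\<integral>\<omega>. ?f (X 1 \<omega>) \<partial>Q) * (\<Sum>i<N. prob (?B i))" for N
      by (intro mult_right_mono drift sum_nonneg) auto
    ultimately have "d * (\<Sum>i<N. prob (?B i)) \<le> (ln (1 / \<alpha>) + K) + C" for N
      by (meson order_trans)
    then have part: "(\<Sum>i<N. prob (?B i)) \<le> (ln (1 / \<alpha>) + (K + C)) / d" for N
      using d by (simp add: field_simps)
    have sum: "summable (\<lambda>i. prob (?B i))"
      by (rule summableI_nonneg_bounded[OF _ part]) simp
    have "(\<Sum>n. emeasure Q (?B n)) = ennreal (\<Sum>n. prob (?B n))"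
      using sum by (simp add: emeasure_eq_measure suminf_ennreal2)
    moreover have "0 \<le> (\<Sum>n. prob (?B n))" by (intro suminf_nonneg sum) auto
    ultimately have "expected_crossing_time Q W \<alpha> = ereal (\<Sum>n. prob (?B n))"
      by (simp add: expected_crossing_time_eq[OF adapted] enn2ereal_ennreal)
    also have "\<dots> \<le> ereal ((ln (1 / \<alpha>) + (K + C)) / d)"
      using suminf_le_const[OF sum part] by simp
    finally show ?thesis .
  qed
  then show ?thesis by (rule that)
qed

end

context dual_pair begin

lemma e_process_crossing_bound:
  assumes W: "e_process M X \<P> W" and P: "P \<in> \<P>" and \<alpha>: "0 < \<alpha>" "\<alpha> < 1" and growth: "0 < growth"
  shows "ereal (1 / growth) \<le> expected_crossing_time Q W \<alpha> / ereal (ln (1 / \<alpha>))"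
proof -
  let ?B = "uncrossed M W \<alpha>"
  have adapted: "W k \<in> borel_measurable (nat_filtration M X k)" if "1 \<le> k" for k
    using W that by (auto simp: e_process_def nonneg_adapted_def)
  have ln: "0 < ln (1 / \<alpha>)" using \<alpha> by simp
  show ?thesis
  proof (cases "summable (\<lambda>n. prob (?B n))")
    case True
    have "(\<Sum>n. emeasure Q (?B n)) = ennreal (\<Sum>n. prob (?B n))"
      using True by (simp add: emeasure_eq_measure suminf_ennreal2)
    moreover have "0 \<le> (\<Sum>n. prob (?B n))" by (intro suminf_nonneg True) auto
    ultimately have "expected_crossing_time Q W \<alpha> = ereal (\<Sum>n. prob (?B n))"
      by (simp add: expected_crossing_time_eq[OF adapted] enn2ereal_ennreal)
    moreover have "1 / growth \<le> (\<Sum>n. prob (?B n)) / ln (1 / \<alpha>)"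
      using summable_crossing_bound[OF W P \<alpha>(1) True] growth ln by (simp add: divide_simps mult.commute)
    ultimately show ?thesis using ln by simp
  next
    case False
    then have "(\<Sum>n. emeasure Q (?B n)) = top"
      by (simp add: emeasure_eq_measure summable_iff_suminf_neq_top)
    then have "expected_crossing_time Q W \<alpha> = \<infinity>"
      by (simp add: expected_crossing_time_eq[OF adapted])
    then show ?thesis using ln by simp
  qed
qed

end

lemma unit_betting_if_iid:
  assumes "0 < \<mu>0" "\<mu>0 < 1" "full_sequence_model M X" "P \<in> iid_distributions M X"
  shows "unit_betting P M X \<mu>0"
proof (rule unit_betting.intro)
  show "unit_iid P M X"
  proof (rule unit_iid.intro)
    show "prob_space P" using assms(4) by (simp add: iid_distributions_def)
    show "unit_iid_axioms P M X"
      by unfold_locales (use assms in \<open>auto simp: full_sequence_model_def\<close>)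
  qed
  show "unit_betting_axioms \<mu>0" by unfold_locales (use assms in auto)
qed

text \<open>
  The wealth is a test martingale under every null distribution, so it dominates itself. Hence
  the upper bounds for e-processes apply to \<open>W\<close>.
\<close>

lemma (in unit_betting) wealth_e_process:
  assumes full: "full_sequence_model M X"
    and pred: "predictable M X \<gamma>"
    and range: "\<forall>n\<ge>1. \<forall>\<omega>\<in>space M. \<gamma> n \<omega> \<in> bet_range \<mu>0"
  shows "e_process M X (mean_eq M X \<mu>0) (wealth X \<mu>0 \<gamma>)"
  unfolding e_process_def
proof (intro conjI ballI)
  show "nonneg_adapted M X (wealth X \<mu>0 \<gamma>)"
    using wealth_adapted[OF pred] wealth_bounds[OF range] by (auto simp: nonneg_adapted_def)
  fix P assume P: "P \<in> mean_eq M X \<mu>0"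
  interpret P: unit_betting P M X \<mu>0
    by (rule unit_betting_if_iid) (use P \<mu>0 full in \<open>auto simp: mean_eq_def\<close>)
  have "test_supermartingale M X P (wealth X \<mu>0 \<gamma>)"
    by (rule P.wealth_test_supermartingale[OF pred range]) (use P in \<open>simp add: mean_eq_def\<close>)
  then show "\<exists>S. test_supermartingale M X P S \<and> (AE \<omega> in P. \<forall>n\<ge>1. wealth X \<mu>0 \<gamma> n \<omega> \<le> S n \<omega>)"
    by (intro exI[of _ "wealth X \<mu>0 \<gamma>"]) simp
qed

theorem corollary4p2:
  fixes M :: "'a measure" and X :: "nat \<Rightarrow> 'a \<Rightarrow> real" and \<mu>0 :: real
    and \<gamma> :: "nat \<Rightarrow> 'a \<Rightarrow> real" and W :: "nat \<Rightarrow> 'a \<Rightarrow> real" and Q :: "'a measure"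
  assumes "0 < \<mu>0" "\<mu>0 < 1"
    and "full_sequence_model M X"
    and "predictable M X \<gamma>"
    and "\<forall>n\<ge>1. \<forall>\<omega>\<in>space M. \<gamma> n \<omega> \<in> bet_range \<mu>0"
    and "W = wealth X \<mu>0 \<gamma>"
    and "sublinear_portfolio_regret M X \<mu>0 W"
    and "Q \<in> mean_neq M X \<mu>0"
  shows "(\<exists>g. is_arg_max (log_growth Q X \<mu>0) (\<lambda>g. g \<in> bet_range \<mu>0) g) \<and>
    (AE \<omega> in Q. (\<lambda>n. ereal (1 / real n) * elog (W n \<omega>))
       \<longlonglongrightarrow> (SUP g\<in>bet_range \<mu>0. log_growth Q X \<mu>0 g)) \<and>
    (\<forall>W'. e_process M X (mean_eq M X \<mu>0) W' \<longrightarrow>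
       (AE \<omega> in Q. limsup (\<lambda>n. ereal (1 / real n) * elog (W' n \<omega>))
          \<le> (SUP g\<in>bet_range \<mu>0. log_growth Q X \<mu>0 g))) \<and>
    (\<forall>gQ. is_arg_max (log_growth Q X \<mu>0) (\<lambda>g. g \<in> bet_range \<mu>0) gQ \<longrightarrow>
       ((\<lambda>\<alpha>. expected_crossing_time Q W \<alpha> / ereal (ln (1 / \<alpha>)))
          \<longlongrightarrow> 1 / log_growth Q X \<mu>0 gQ) (at_right 0) \<and>
       (\<forall>W' \<alpha>. e_process M X (mean_eq M X \<mu>0) W' \<and> 0 < \<alpha> \<and> \<alpha> < 1 \<longrightarrow>
          expected_crossing_time Q W' \<alpha> / ereal (ln (1 / \<alpha>)) \<ge> 1 / log_growth Q X \<mu>0 gQ))"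
proof -
  have Q: "Q \<in> iid_distributions M X" "(\<integral>\<omega>. X 1 \<omega> \<partial>Q) \<noteq> \<mu>0" using assms(8) by (auto simp: mean_neq_def)
  interpret unit_betting Q M X \<mu>0
    by (rule unit_betting_if_iid) (use assms Q in auto)
  obtain g0 where g0: "log_optimal g0" using log_optimal_exists by blast
  obtain P where P: "P \<in> mean_eq M X \<mu>0" "dual_pair Q M X \<mu>0 P g0"
    using dual_pair_exists[OF assms(3) g0] .
  interpret dual_pair Q M X \<mu>0 P g0 by (rule P(2))
  note sup = log_optimalD(4)[OF g0]
  have gr: "log_growth Q X \<mu>0 g = ereal growth" if "log_optimal g" for g
    using log_optimalD(4)[OF that] sup growth_eq by simp
  have growth: "0 < growth" using log_optimal_growth_pos[OF g0 Q(2)] growth_eq by simp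
  have W: "e_process M X (mean_eq M X \<mu>0) W"
    unfolding assms(6) by (rule wealth_e_process[OF assms(3,4,5)])
  have adapted: "W k \<in> borel_measurable (nat_filtration M X k)" for k
    unfolding assms(6) by (rule wealth_adapted[OF assms(4)])
  \<comment> \<open>The two bounds squeeze the limit inferior and superior together.\<close>
  have rate: "AE \<omega> in Q. (\<lambda>n. ereal (1 / real n) * elog (W n \<omega>)) \<longlonglongrightarrow> ereal growth"
    using sublinear_regret_growth_rate_ge[OF g0 assms(7)] e_process_growth_rate_le[OF W P(1)]
  proof eventually_elim
    case (elim \<omega>)
    let ?r = "\<lambda>n. ereal (1 / real n) * elog (W n \<omega>)"
    have "liminf ?r \<le> limsup ?r" by (rule Liminf_le_Limsup) simp
    then have "liminf ?r = ereal growth" "limsup ?r = ereal growth" using elim growth_eq by auto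
    then show ?case by (simp add: tendsto_iff_Liminf_eq_Limsup)
  qed
  have lower: "ereal (1 / growth) \<le> expected_crossing_time Q W' \<alpha> / ereal (ln (1 / \<alpha>))"
    if "e_process M X (mean_eq M X \<mu>0) W'" "0 < \<alpha>" "\<alpha> < 1" for W' \<alpha>
    by (rule e_process_crossing_bound[OF that(1) P(1) that(2,3) growth])
  have ev01: "eventually (\<lambda>\<alpha>::real. 0 < \<alpha> \<and> \<alpha> < 1) (at_right 0)"
    by (simp add: eventually_at_right_less eventually_conj eventually_at_right_field exI[of _ 1])
  have "((\<lambda>\<alpha>. expected_crossing_time Q W \<alpha> / ereal (ln (1 / \<alpha>))) \<longlongrightarrow> ereal (1 / growth)) (at_right 0)"
  proof (rule order_tendstoI)
    fix a assume a: "a < ereal (1 / growth)"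
    show "eventually (\<lambda>\<alpha>. a < expected_crossing_time Q W \<alpha> / ereal (ln (1 / \<alpha>))) (at_right 0)"
      using ev01 by eventually_elim (use lower[OF W] a in \<open>blast intro: less_le_trans\<close>)
  next
    fix a assume "ereal (1 / growth) < a"
    then obtain c where c: "1 / growth < c" "ereal c \<le> a"
      by (cases a) (auto intro: that[of "1 / growth + 1"])
    have c0: "0 < c" using c(1) growth by (meson divide_pos_pos less_trans zero_less_one)
    have "1 / c < growth" using c(1) c0 growth by (simp add: field_simps)
    \<comment> \<open>A rate strictly between \<open>1 / c\<close> and the optimal growth leaves room to absorb the constant \<open>K\<close>
      of the crossing bound, which vanishes relative to \<open>ln (1 / \<alpha>)\<close>.\<close>
    then obtain d where d: "1 / c < d" "d < growth" using dense by blast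
    have d0: "0 < d" using d(1) c0 by (meson divide_pos_pos less_trans zero_less_one)
    obtain K where K: "\<And>\<alpha>. 0 < \<alpha> \<Longrightarrow> \<alpha> < 1 \<Longrightarrow> expected_crossing_time Q W \<alpha> \<le> ereal ((ln (1 / \<alpha>) + K) / d)"
      by (rule sublinear_regret_crossing_bound[OF g0 assms(7) adapted d0]) (use d(2) growth_eq in auto)
    have "((\<lambda>\<alpha>. (1 + K * (1 / ln (1 / \<alpha>))) / d) \<longlongrightarrow> (1 + K * 0) / d) (at_right 0)"
      using d0 by (intro tendsto_divide tendsto_add tendsto_mult tendsto_const) (real_asymp, simp)
    moreover have "(1 + K * 0) / d < c" using d(1) d0 c0 by (simp add: field_simps)
    ultimately have "eventually (\<lambda>\<alpha>. (1 + K * (1 / ln (1 / \<alpha>))) / d < c) (at_right 0)"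
      by (rule order_tendstoD(2))
    then show "eventually (\<lambda>\<alpha>. expected_crossing_time Q W \<alpha> / ereal (ln (1 / \<alpha>)) < a) (at_right 0)"
      using ev01
    proof eventually_elim
      case (elim \<alpha>)
      have ln: "0 < ln (1 / \<alpha>)" using elim by simp
      have "expected_crossing_time Q W \<alpha> / ereal (ln (1 / \<alpha>)) \<le> ereal ((ln (1 / \<alpha>) + K) / d) / ereal (ln (1 / \<alpha>))"
        using K elim ln by (intro ereal_divide_right_mono) auto
      also have "\<dots> = ereal ((1 + K * (1 / ln (1 / \<alpha>))) / d)"
        using ln d0 by (simp add: field_simps)
      also have "\<dots> < ereal c" using elim by simp
      finally show ?case using c(2) by (rule less_le_trans)
    qed
  qed
  moreover have "1 / ereal growth = ereal (1 / growth)" using growth by (simp add: one_ereal_def)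
  ultimately show ?thesis
    using g0 rate e_process_growth_rate_le[OF _ P(1)] lower gr sup growth_eq by auto
qed

end
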